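(* The 2-adjunction $\mathrm E\dashv\mathrm U_e$ between $\mathbf{ERD}$ and $\mathbf{RD}$ (with $\mathrm E:R\mapsto R^e$ the extensional collapse and $\mathrm U_e$ the inclusion) restricts to a 2-adjunction $\mathrm E'\dashv\mathrm U_e'$ between $\mathbf{EQRD}$ and $\mathbf{QRD}$, where $\mathrm U_e':\mathbf{EQRD}\to\mathbf{QRD}$ is the inclusion 2-functor.
   Context: $\mathbf{Pos}$ is the category of posets and monotone maps. A relational doctrine consists of a category $\mathcal C$ (its base); a functor $R:(\mathcal C\times\mathcal C)^{op}\to\mathbf{Pos}$ (for $f:X\to A$, $g:Y\to B$ write $R_{f,g}:R(A,B)\to R(X,Y)$); elements $d_X\in R(X,X)$ with $d_X\le R_{f,f}(d_Y)$ for all $f:X\to Y$; monotone maps $;:R(X,Y)\times R(Y,Z)\to R(X,Z)$ with $R_{f,g}(\alpha);R_{g,h}(\beta)\le R_{f,h}(\alpha;\beta)$; monotone maps $(-)^\bot:R(X,Y)\to R(Y,X)$ with $(R_{f,g}(\alpha))^\bot\le R_{g,f}(\alpha^\bot)$; such that $;$ is associative with units $d$, $(\alpha;\beta)^\bot=\beta^\bot;\alpha^\bot$, $d_X^\bot=d_X$, $\alpha^{\bot\bot}=\alpha$. The graph of $f:X\to Y$ is $\Gamma_f=R_{f,\mathrm{id}_Y}(d_Y)\in R(X,Y)$. An $R$-equivalence relation on $X$ is $\rho\in R(X,X)$ with $d_X\le\rho$, $\rho^\bot\le\rho$, $\rho;\rho\le\rho$. A quotient arrow of $\rho$ is $q:X\to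 W$ with $\rho\le\Gamma_q;\Gamma_q^\bot$ such that for every $f:X\to Z$ with $\rho\le\Gamma_f;\Gamma_f^\bot$ there is a unique $h:W\to Z$ with $f=h\circ q$. It is effective if $\rho=\Gamma_q;\Gamma_q^\bot$, and descent if $d_W\le\Gamma_q^\bot;\Gamma_q$. $R$ has quotients if every $R$-equivalence relation admits an effective descent quotient arrow. The 2-category $\mathbf{RD}$: objects are relational doctrines; a 1-arrow $F:R\to S$ (bases $\mathcal C,\mathcal D$) is a pair of a functor $\widehat F:\mathcal C\to\mathcal D$ and a natural transformation with components $\overline F_{X,Y}:R(X,Y)\to S(\widehat FX,\widehat FY)$ strictly preserving $d$, $;$ and $(-)^\bot$; a 2-arrow $\theta:F\Rightarrow G$ is a natural transformation $\theta:\widehat F\to\widehat G$ with $\overline F_{X,Y}(\alpha)\le S_{\theta_X,\theta_Y}(\overline G_{X,Y}(\alpha))$. $\mathbf{QRD}$ is the sub-2-category (full on 2-arrows) of relational doctrines with quotients and 1-arrows $F$ preserving quotient arrows: if $q$ is a quotient arrow of $\rho$ on $X$ then $\widehat Fq$ is a quotient arrow of $\overline F_{X,X}(\rho)$. For parallel arrows $f,g:X\to Y$ in the base of $R$, write $f\approx g$ if $d_X\le R_{f,g}(d_Y)$. $R$ is extensional if $f\approx g$ implies $f=g$. $\mathbf{ERD}$ is the full sub-2-category of $\mathbf{RD}$ on extensional relational doctrines; $\mathbf{EQRD}$ is the full sub-2-category of $\mathbf{QRD}$ on extensional relational doctrines with quotients. The relation $\approx$ is a congruence on the base $\mathcal C$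 of $R$. The extensional collapse $R^e$ has base $\mathcal C/\!\approx$ (same objects, arrows are $\approx$-classes $[f]$), $R^e(X,Y)=R(X,Y)$, $R^e_{[f],[g]}=R_{f,g}$, and the relational operations of $R$. On 1-arrows, $\mathrm E(F)=F^e$ with $\widehat{F^e}X=\widehat FX$, $\widehat{F^e}[f]=[\widehat Ff]$, $\overline{F^e}=\overline F$; on 2-arrows $\theta^e_X=[\theta_X]$. $\mathrm E$ is left 2-adjoint to $\mathrm U_e$, with unit $C^R:R\to R^e$ given by $\widehat{C^R}X=X$, $\widehat{C^R}f=[f]$, $\overline{C^R}=\mathrm{id}$. *)

theory Defs
  imports "HOL-Library.FuncSet"
begin

section \<open>Categories and functors\<close>

record ('o, 'a) cat =
  Ob :: "'o set"
  Arr :: "'a set"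
  Dom :: "'a \<Rightarrow> 'o"
  Cod :: "'a \<Rightarrow> 'o"
  Id :: "'o \<Rightarrow> 'a"
  Comp :: "'a \<Rightarrow> 'a \<Rightarrow> 'a"  (infixr "\<cdot>\<index>" 70)

definition Hom :: "('o, 'a, 'm) cat_scheme \<Rightarrow> 'o \<Rightarrow> 'o \<Rightarrow> 'a set" where
  "Hom C X Y = {f \<in> Arr C. Dom C f = X \<and> Cod C f = Y}"

locale category =
  fixes C :: "('o, 'a, 'm) cat_scheme" (structure)
  assumes dom_in: "f \<in> Arr C \<Longrightarrow> Dom C f \<in> Ob C"
    and cod_in: "f \<in> Arr C \<Longrightarrow> Cod C f \<in> Ob C"
    and id_in: "X \<in> Ob C \<Longrightarrow> Id C X \<in> Hom C X X"
    and comp_in: "f \<in> Hom C X Y \<Longrightarrow> g \<in> Hom C Y Z \<Longrightarrow> g \<cdot> f \<in> Hom C X Z"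
    and comp_id_right: "f \<in> Hom C X Y \<Longrightarrow> f \<cdot> Id C X = f"
    and comp_id_left: "f \<in> Hom C X Y \<Longrightarrow> Id C Y \<cdot> f = f"
    and comp_assoc: "f \<in> Hom C X Y \<Longrightarrow> g \<in> Hom C Y Z \<Longrightarrow> h \<in> Hom C Z W
      \<Longrightarrow> (h \<cdot> g) \<cdot> f = h \<cdot> (g \<cdot> f)"

definition is_functor ::
  "('o, 'a, 'm) cat_scheme \<Rightarrow> ('p, 'b, 'n) cat_scheme \<Rightarrow> ('o \<Rightarrow> 'p) \<Rightarrow> ('a \<Rightarrow> 'b) \<Rightarrow> bool" where
  "is_functor C D Fo Fa \<longleftrightarrow>
     category C \<and> category D \<and>
     (\<forall>X\<in>Ob C. Fo X \<in> Ob D) \<and>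
     (\<forall>X Y. \<forall>f\<in>Hom C X Y. Fa f \<in> Hom D (Fo X) (Fo Y)) \<and>
     (\<forall>X\<in>Ob C. Fa (Id C X) = Id D (Fo X)) \<and>
     (\<forall>X Y Z. \<forall>f\<in>Hom C X Y. \<forall>g\<in>Hom C Y Z. Fa (g \<cdot>\<^bsub>C\<^esub> f) = Fa g \<cdot>\<^bsub>D\<^esub> Fa f)"


section \<open>Strict 2-categories and 2-adjunctions\<close>

text \<open>
  In a 2-category, \<open>under\<close> is the underlying category of objects and 1-arrows, and
  \<open>vert\<close> is the category of 1-arrows and 2-arrows under vertical composition (the disjoint
  union of all hom-categories).
\<close>

record ('x, 'f, 't) twocat =
  under :: "('x, 'f) cat"
  vert :: "('f, 't) cat"
  hcomp :: "'t \<Rightarrow> 't \<Rightarrow> 't"  (infixr "\<star>\<index>" 70)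

definition horiz :: "('x, 'f, 't) twocat \<Rightarrow> ('x, 't) cat" where
  "horiz K = \<lparr> Ob = Ob (under K), Arr = Arr (vert K),
     Dom = (\<lambda>t. Dom (under K) (Dom (vert K) t)),
     Cod = (\<lambda>t. Cod (under K) (Cod (vert K) t)),
     Id = (\<lambda>X. Id (vert K) (Id (under K) X)),
     Comp = hcomp K \<rparr>"

locale two_category =
  fixes K :: "('x, 'f, 't) twocat" (structure)
  assumes under_category: "category (under K)"
    and vert_category: "category (vert K)"
    and horiz_category: "category (horiz K)"
    and vert_ob: "Ob (vert K) = Arr (under K)"
    and globular_dom: "s \<in> Arr (vert K)
      \<Longrightarrow> Dom (under K) (Dom (vert K) s) = Dom (under K) (Cod (vert K) s)"
    and globular_cod: "s \<in> Arr (vert K)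
      \<Longrightarrow> Cod (under K) (Dom (vert K) s) = Cod (under K) (Cod (vert K) s)"
    and hcomp_dom: "s \<in> Hom (horiz K) X Y \<Longrightarrow> t \<in> Hom (horiz K) Y Z
      \<Longrightarrow> Dom (vert K) (t \<star> s) = Dom (vert K) t \<cdot>\<^bsub>under K\<^esub> Dom (vert K) s"
    and hcomp_cod: "s \<in> Hom (horiz K) X Y \<Longrightarrow> t \<in> Hom (horiz K) Y Z
      \<Longrightarrow> Cod (vert K) (t \<star> s) = Cod (vert K) t \<cdot>\<^bsub>under K\<^esub> Cod (vert K) s"
    and hcomp_id: "f \<in> Hom (under K) X Y \<Longrightarrow> g \<in> Hom (under K) Y Z
      \<Longrightarrow> Id (vert K) g \<star> Id (vert K) f = Id (vert K) (g \<cdot>\<^bsub>under K\<^esub> f)"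
    and interchange: "f \<in> Hom (under K) X Y \<Longrightarrow> g \<in> Hom (under K) Y Z
      \<Longrightarrow> s \<in> Hom (vert K) f f' \<Longrightarrow> s' \<in> Hom (vert K) f' f''
      \<Longrightarrow> t \<in> Hom (vert K) g g' \<Longrightarrow> t' \<in> Hom (vert K) g' g''
      \<Longrightarrow> (t' \<cdot>\<^bsub>vert K\<^esub> t) \<star> (s' \<cdot>\<^bsub>vert K\<^esub> s) = (t' \<star> s') \<cdot>\<^bsub>vert K\<^esub> (t \<star> s)"

record ('x, 'f, 't, 'y, 'g, 's) twofun =
  on0 :: "'x \<Rightarrow> 'y"
  on1 :: "'f \<Rightarrow> 'g"
  on2 :: "'t \<Rightarrow> 's"

text \<open>
  Only the values of a 2-functor on the cells of its source matter, so the restriction of a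
  2-functor to a sub-2-category is given by the same three functions, and every inclusion
  2-functor is given by \<open>twofun_id\<close>.
\<close>

definition two_functor ::
  "('x, 'f, 't) twocat \<Rightarrow> ('y, 'g, 's) twocat \<Rightarrow> ('x, 'f, 't, 'y, 'g, 's) twofun \<Rightarrow> bool" where
  "two_functor K L F \<longleftrightarrow>
     two_category K \<and> two_category L \<and>
     is_functor (under K) (under L) (on0 F) (on1 F) \<and>
     is_functor (vert K) (vert L) (on1 F) (on2 F) \<and>
     (\<forall>X Y Z. \<forall>s\<in>Hom (horiz K) X Y. \<forall>t\<in>Hom (horiz K) Y Z.
        on2 F (t \<star>\<^bsub>K\<^esub> s) = on2 F t \<star>\<^bsub>L\<^esub> on2 F s)"

definition twofun_id :: "('x, 'f, 't, 'x, 'f, 't) twofun" where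
  "twofun_id = \<lparr> on0 = (\<lambda>X. X), on1 = (\<lambda>f. f), on2 = (\<lambda>t. t) \<rparr>"

definition twofun_comp ::
  "('y, 'g, 's, 'z, 'h, 'u) twofun \<Rightarrow> ('x, 'f, 't, 'y, 'g, 's) twofun
    \<Rightarrow> ('x, 'f, 't, 'z, 'h, 'u) twofun" where
  "twofun_comp G F = \<lparr> on0 = on0 G \<circ> on0 F, on1 = on1 G \<circ> on1 F, on2 = on2 G \<circ> on2 F \<rparr>"

definition two_natural ::
  "('x, 'f, 't) twocat \<Rightarrow> ('y, 'g, 's) twocat \<Rightarrow> ('x, 'f, 't, 'y, 'g, 's) twofun
    \<Rightarrow> ('x, 'f, 't, 'y, 'g, 's) twofun \<Rightarrow> ('x \<Rightarrow> 'g) \<Rightarrow> bool" where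
  "two_natural K L F G \<eta> \<longleftrightarrow>
     two_functor K L F \<and> two_functor K L G \<and>
     (\<forall>X\<in>Ob (under K). \<eta> X \<in> Hom (under L) (on0 F X) (on0 G X)) \<and>
     (\<forall>X Y. \<forall>f\<in>Hom (under K) X Y.
        on1 G f \<cdot>\<^bsub>under L\<^esub> \<eta> X = \<eta> Y \<cdot>\<^bsub>under L\<^esub> on1 F f) \<and>
     (\<forall>X Y. \<forall>t\<in>Hom (horiz K) X Y.
        on2 G t \<star>\<^bsub>L\<^esub> Id (vert L) (\<eta> X) = Id (vert L) (\<eta> Y) \<star>\<^bsub>L\<^esub> on2 F t)"

text \<open>\<open>F\<close> is left 2-adjoint to \<open>U\<close> with unit \<open>\<eta>\<close> and counit \<open>\<epsilon>\<close>.\<close>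

definition two_adjunction ::
  "('x, 'f, 't) twocat \<Rightarrow> ('y, 'g, 's) twocat \<Rightarrow> ('x, 'f, 't, 'y, 'g, 's) twofun
    \<Rightarrow> ('y, 'g, 's, 'x, 'f, 't) twofun \<Rightarrow> ('x \<Rightarrow> 'f) \<Rightarrow> ('y \<Rightarrow> 'g) \<Rightarrow> bool" where
  "two_adjunction K L F U \<eta> \<epsilon> \<longleftrightarrow>
     two_functor K L F \<and> two_functor L K U \<and>
     two_natural K K twofun_id (twofun_comp U F) \<eta> \<and>
     two_natural L L (twofun_comp F U) twofun_id \<epsilon> \<and>
     (\<forall>X\<in>Ob (under K). \<epsilon> (on0 F X) \<cdot>\<^bsub>under L\<^esub> on1 F (\<eta> X) = Id (under L) (on0 F X)) \<and>
     (\<forall>Y\<in>Ob (under L). on1 U (\<epsilon> Y) \<cdot>\<^bsub>under K\<^esub> \<eta> (on0 U Y) = Id (under K) (on0 U Y))"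

text \<open>
  The part of \<open>K\<close> on the objects satisfying \<open>P\<close>, the 1-arrows between them satisfying \<open>Q\<close>,
  and all 2-arrows between those.
\<close>

definition sub_twocat ::
  "('x, 'f, 't) twocat \<Rightarrow> ('x \<Rightarrow> bool) \<Rightarrow> ('f \<Rightarrow> bool) \<Rightarrow> ('x, 'f, 't) twocat" where
  "sub_twocat K P Q =
     (let A = {f \<in> Arr (under K). P (Dom (under K) f) \<and> P (Cod (under K) f) \<and> Q f} in
      K\<lparr> under := (under K)\<lparr> Ob := {X \<in> Ob (under K). P X}, Arr := A \<rparr>,
         vert := (vert K)\<lparr> Ob := A,
           Arr := {t \<in> Arr (vert K). Dom (vert K) t \<in> A \<and> Cod (vert K) t \<in> A} \<rparr> \<rparr>)"

text \<open>\<open>J\<close> is a sub-2-category of \<open>K\<close>.\<close>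

definition is_sub_twocat :: "('x, 'f, 't) twocat \<Rightarrow> ('x, 'f, 't) twocat \<Rightarrow> bool" where
  "is_sub_twocat J K \<longleftrightarrow>
     Ob (under J) \<subseteq> Ob (under K) \<and> Arr (under J) \<subseteq> Arr (under K) \<and>
     Arr (vert J) \<subseteq> Arr (vert K) \<and> two_functor J K twofun_id"


section \<open>Relational doctrines\<close>

text \<open>
  A relational doctrine extends the record of its base category. \<open>reidx R f g\<close> is the map
  \<open>R\<^sub>f\<^sub>,\<^sub>g\<close>; the fibre operations carry the objects over which they act, because different
  fibres may share elements of the type \<open>'r\<close>.
\<close>

record ('o, 'a, 'r) doctrine = "('o, 'a) cat" +
  Rel :: "'o \<Rightarrow> 'o \<Rightarrow> 'r set"
  rle :: "'o \<Rightarrow> 'o \<Rightarrow> 'r \<Rightarrow> 'r \<Rightarrow> bool"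
  reidx :: "'a \<Rightarrow> 'a \<Rightarrow> 'r \<Rightarrow> 'r"
  diag :: "'o \<Rightarrow> 'r"
  rcomp :: "'o \<Rightarrow> 'o \<Rightarrow> 'o \<Rightarrow> 'r \<Rightarrow> 'r \<Rightarrow> 'r"
  conv :: "'o \<Rightarrow> 'o \<Rightarrow> 'r \<Rightarrow> 'r"

locale relational_doctrine = category R
  for R :: "('o, 'a, 'r) doctrine" (structure) +
  assumes rle_refl: "X \<in> Ob R \<Longrightarrow> Y \<in> Ob R \<Longrightarrow> reflp_on (Rel R X Y) (rle R X Y)"
    and rle_trans: "X \<in> Ob R \<Longrightarrow> Y \<in> Ob R \<Longrightarrow> transp_on (Rel R X Y) (rle R X Y)"
    and rle_antisym: "X \<in> Ob R \<Longrightarrow> Y \<in> Ob R \<Longrightarrow> antisymp_on (Rel R X Y) (rle R X Y)"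
    and reidx_in: "f \<in> Hom R X A \<Longrightarrow> g \<in> Hom R Y B \<Longrightarrow> \<alpha> \<in> Rel R A B
      \<Longrightarrow> reidx R f g \<alpha> \<in> Rel R X Y"
    and reidx_mono: "f \<in> Hom R X A \<Longrightarrow> g \<in> Hom R Y B
      \<Longrightarrow> monotone_on (Rel R A B) (rle R A B) (rle R X Y) (reidx R f g)"
    and reidx_id: "X \<in> Ob R \<Longrightarrow> Y \<in> Ob R \<Longrightarrow> \<alpha> \<in> Rel R X Y
      \<Longrightarrow> reidx R (Id R X) (Id R Y) \<alpha> = \<alpha>"
    and reidx_comp: "f \<in> Hom R X A \<Longrightarrow> f' \<in> Hom R X' X \<Longrightarrow> g \<in> Hom R Y B \<Longrightarrow> g' \<in> Hom R Y' Y
      \<Longrightarrow> \<alpha> \<in> Rel R A B \<Longrightarrow> reidx R (f \<cdot> f') (g \<cdot> g') \<alpha> = reidx R f' g' (reidx R f g \<alpha>)"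
    and diag_in: "X \<in> Ob R \<Longrightarrow> diag R X \<in> Rel R X X"
    and diag_reidx: "f \<in> Hom R X Y \<Longrightarrow> rle R X X (diag R X) (reidx R f f (diag R Y))"
    and rcomp_in: "X \<in> Ob R \<Longrightarrow> Y \<in> Ob R \<Longrightarrow> Z \<in> Ob R \<Longrightarrow> \<alpha> \<in> Rel R X Y \<Longrightarrow> \<beta> \<in> Rel R Y Z
      \<Longrightarrow> rcomp R X Y Z \<alpha> \<beta> \<in> Rel R X Z"
    and rcomp_mono: "X \<in> Ob R \<Longrightarrow> Y \<in> Ob R \<Longrightarrow> Z \<in> Ob R
      \<Longrightarrow> \<alpha> \<in> Rel R X Y \<Longrightarrow> \<alpha>' \<in> Rel R X Y \<Longrightarrow> \<beta> \<in> Rel R Y Z \<Longrightarrow> \<beta>' \<in> Rel R Y Z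
      \<Longrightarrow> rle R X Y \<alpha> \<alpha>' \<Longrightarrow> rle R Y Z \<beta> \<beta>'
      \<Longrightarrow> rle R X Z (rcomp R X Y Z \<alpha> \<beta>) (rcomp R X Y Z \<alpha>' \<beta>')"
    and rcomp_reidx: "f \<in> Hom R X A \<Longrightarrow> g \<in> Hom R Y B \<Longrightarrow> h \<in> Hom R Z C
      \<Longrightarrow> \<alpha> \<in> Rel R A B \<Longrightarrow> \<beta> \<in> Rel R B C
      \<Longrightarrow> rle R X Z (rcomp R X Y Z (reidx R f g \<alpha>) (reidx R g h \<beta>))
            (reidx R f h (rcomp R A B C \<alpha> \<beta>))"
    and conv_in: "X \<in> Ob R \<Longrightarrow> Y \<in> Ob R \<Longrightarrow> \<alpha> \<in> Rel R X Y \<Longrightarrow> conv R X Y \<alpha> \<in> Rel R Y X"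
    and conv_mono: "X \<in> Ob R \<Longrightarrow> Y \<in> Ob R
      \<Longrightarrow> monotone_on (Rel R X Y) (rle R X Y) (rle R Y X) (conv R X Y)"
    and conv_reidx: "f \<in> Hom R X A \<Longrightarrow> g \<in> Hom R Y B \<Longrightarrow> \<alpha> \<in> Rel R A B
      \<Longrightarrow> rle R Y X (conv R X Y (reidx R f g \<alpha>)) (reidx R g f (conv R A B \<alpha>))"
    and rcomp_assoc: "X \<in> Ob R \<Longrightarrow> Y \<in> Ob R \<Longrightarrow> Z \<in> Ob R \<Longrightarrow> W \<in> Ob R
      \<Longrightarrow> \<alpha> \<in> Rel R X Y \<Longrightarrow> \<beta> \<in> Rel R Y Z \<Longrightarrow> \<gamma> \<in> Rel R Z W
      \<Longrightarrow> rcomp R X Z W (rcomp R X Y Z \<alpha> \<beta>) \<gamma> = rcomp R X Y W \<alpha> (rcomp R Y Z W \<beta> \<gamma>)"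
    and rcomp_diag_left: "X \<in> Ob R \<Longrightarrow> Y \<in> Ob R \<Longrightarrow> \<alpha> \<in> Rel R X Y
      \<Longrightarrow> rcomp R X X Y (diag R X) \<alpha> = \<alpha>"
    and rcomp_diag_right: "X \<in> Ob R \<Longrightarrow> Y \<in> Ob R \<Longrightarrow> \<alpha> \<in> Rel R X Y
      \<Longrightarrow> rcomp R X Y Y \<alpha> (diag R Y) = \<alpha>"
    and conv_rcomp: "X \<in> Ob R \<Longrightarrow> Y \<in> Ob R \<Longrightarrow> Z \<in> Ob R \<Longrightarrow> \<alpha> \<in> Rel R X Y \<Longrightarrow> \<beta> \<in> Rel R Y Z
      \<Longrightarrow> conv R X Z (rcomp R X Y Z \<alpha> \<beta>) = rcomp R Z Y X (conv R Y Z \<beta>) (conv R X Y \<alpha>)"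
    and conv_diag: "X \<in> Ob R \<Longrightarrow> conv R X X (diag R X) = diag R X"
    and conv_conv: "X \<in> Ob R \<Longrightarrow> Y \<in> Ob R \<Longrightarrow> \<alpha> \<in> Rel R X Y
      \<Longrightarrow> conv R Y X (conv R X Y \<alpha>) = \<alpha>"

definition graph :: "('o, 'a, 'r) doctrine \<Rightarrow> 'a \<Rightarrow> 'r" where
  "graph R f = reidx R f (Id R (Cod R f)) (diag R (Cod R f))"

text \<open>The relation \<open>\<Gamma>\<^sub>f ; \<Gamma>\<^sub>f\<^sup>\<bottom>\<close> on the domain of \<open>f\<close>.\<close>

definition kernel :: "('o, 'a, 'r) doctrine \<Rightarrow> 'a \<Rightarrow> 'r" where
  "kernel R f = (let X = Dom R f; Y = Cod R f in
     rcomp R X Y X (graph R f) (conv R X Y (graph R f)))"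

definition equiv_rel :: "('o, 'a, 'r) doctrine \<Rightarrow> 'o \<Rightarrow> 'r \<Rightarrow> bool" where
  "equiv_rel R X \<rho> \<longleftrightarrow> X \<in> Ob R \<and> \<rho> \<in> Rel R X X \<and>
     rle R X X (diag R X) \<rho> \<and> rle R X X (conv R X X \<rho>) \<rho> \<and>
     rle R X X (rcomp R X X X \<rho> \<rho>) \<rho>"

definition quotient_arrow :: "('o, 'a, 'r) doctrine \<Rightarrow> 'o \<Rightarrow> 'r \<Rightarrow> 'a \<Rightarrow> bool" where
  "quotient_arrow R X \<rho> q \<longleftrightarrow> equiv_rel R X \<rho> \<and> q \<in> Arr R \<and> Dom R q = X \<and>
     rle R X X \<rho> (kernel R q) \<and>
     (\<forall>Z. \<forall>f\<in>Hom R X Z. rle R X X \<rho> (kernel R f)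
        \<longrightarrow> (\<exists>!h. h \<in> Hom R (Cod R q) Z \<and> f = h \<cdot>\<^bsub>R\<^esub> q))"

definition effective :: "('o, 'a, 'r) doctrine \<Rightarrow> 'r \<Rightarrow> 'a \<Rightarrow> bool" where
  "effective R \<rho> q \<longleftrightarrow> \<rho> = kernel R q"

definition descent :: "('o, 'a, 'r) doctrine \<Rightarrow> 'a \<Rightarrow> bool" where
  "descent R q \<longleftrightarrow> (let X = Dom R q; W = Cod R q in
     rle R W W (diag R W) (rcomp R W X W (conv R X W (graph R q)) (graph R q)))"

definition has_quotients :: "('o, 'a, 'r) doctrine \<Rightarrow> bool" where
  "has_quotients R \<longleftrightarrow> (\<forall>X \<rho>. equiv_rel R X \<rho> \<longrightarrow>
     (\<exists>q. quotient_arrow R X \<rho> q \<and> effective R \<rho> q \<and> descent R q))"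

text \<open>The relation \<open>\<approx>\<close> between parallel arrows of the base.\<close>

definition approx :: "('o, 'a, 'r) doctrine \<Rightarrow> 'a rel" where
  "approx R = {(f, g). \<exists>X Y. f \<in> Hom R X Y \<and> g \<in> Hom R X Y \<and>
     rle R X X (diag R X) (reidx R f g (diag R Y))}"

definition extensional_doctrine :: "('o, 'a, 'r) doctrine \<Rightarrow> bool" where
  "extensional_doctrine R \<longleftrightarrow> (\<forall>f g. (f, g) \<in> approx R \<longrightarrow> f = g)"


section \<open>The 2-category of relational doctrines\<close>

text \<open>
  So that equality of 1-arrows and 2-arrows is equality of the mathematical data, their
  components are \<open>undefined\<close> off the objects, arrows and fibres of the source doctrine.
\<close>

record ('o, 'a, 'r) rd_arr =
  Src :: "('o, 'a, 'r) doctrine"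
  Tgt :: "('o, 'a, 'r) doctrine"
  FOb :: "'o \<Rightarrow> 'o"
  FArr :: "'a \<Rightarrow> 'a"
  FRel :: "'o \<Rightarrow> 'o \<Rightarrow> 'r \<Rightarrow> 'r"

definition restrict_rel ::
  "('o, 'a, 'r) doctrine \<Rightarrow> ('o \<Rightarrow> 'o \<Rightarrow> 'r \<Rightarrow> 'r) \<Rightarrow> 'o \<Rightarrow> 'o \<Rightarrow> 'r \<Rightarrow> 'r" where
  "restrict_rel R h = (\<lambda>X Y \<alpha>.
     if X \<in> Ob R \<and> Y \<in> Ob R \<and> \<alpha> \<in> Rel R X Y then h X Y \<alpha> else undefined)"

locale rd_1arrow =
  fixes F :: "('o, 'a, 'r) rd_arr"
  assumes src: "relational_doctrine (Src F)"
    and tgt: "relational_doctrine (Tgt F)"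
    and FOb_ext: "FOb F \<in> extensional (Ob (Src F))"
    and FArr_ext: "FArr F \<in> extensional (Arr (Src F))"
    and FRel_ext: "restrict_rel (Src F) (FRel F) = FRel F"
    and base_functor: "is_functor (Src F) (Tgt F) (FOb F) (FArr F)"
    and FRel_in: "X \<in> Ob (Src F) \<Longrightarrow> Y \<in> Ob (Src F) \<Longrightarrow> \<alpha> \<in> Rel (Src F) X Y
      \<Longrightarrow> FRel F X Y \<alpha> \<in> Rel (Tgt F) (FOb F X) (FOb F Y)"
    and FRel_mono: "X \<in> Ob (Src F) \<Longrightarrow> Y \<in> Ob (Src F)
      \<Longrightarrow> monotone_on (Rel (Src F) X Y) (rle (Src F) X Y) (rle (Tgt F) (FOb F X) (FOb F Y))
            (FRel F X Y)"
    and FRel_natural: "f \<in> Hom (Src F) X A \<Longrightarrow> g \<in> Hom (Src F) Y B \<Longrightarrow> \<alpha> \<in> Rel (Src F) A B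
      \<Longrightarrow> FRel F X Y (reidx (Src F) f g \<alpha>) = reidx (Tgt F) (FArr F f) (FArr F g) (FRel F A B \<alpha>)"
    and FRel_diag: "X \<in> Ob (Src F) \<Longrightarrow> FRel F X X (diag (Src F) X) = diag (Tgt F) (FOb F X)"
    and FRel_rcomp: "X \<in> Ob (Src F) \<Longrightarrow> Y \<in> Ob (Src F) \<Longrightarrow> Z \<in> Ob (Src F)
      \<Longrightarrow> \<alpha> \<in> Rel (Src F) X Y \<Longrightarrow> \<beta> \<in> Rel (Src F) Y Z
      \<Longrightarrow> FRel F X Z (rcomp (Src F) X Y Z \<alpha> \<beta>)
          = rcomp (Tgt F) (FOb F X) (FOb F Y) (FOb F Z) (FRel F X Y \<alpha>) (FRel F Y Z \<beta>)"
    and FRel_conv: "X \<in> Ob (Src F) \<Longrightarrow> Y \<in> Ob (Src F) \<Longrightarrow> \<alpha> \<in> Rel (Src F) X Y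
      \<Longrightarrow> FRel F Y X (conv (Src F) X Y \<alpha>) = conv (Tgt F) (FOb F X) (FOb F Y) (FRel F X Y \<alpha>)"

record ('o, 'a, 'r) rd_cell =
  Src2 :: "('o, 'a, 'r) rd_arr"
  Tgt2 :: "('o, 'a, 'r) rd_arr"
  Cmp :: "'o \<Rightarrow> 'a"

locale rd_2arrow =
  fixes \<theta> :: "('o, 'a, 'r) rd_cell"
    and F G :: "('o, 'a, 'r) rd_arr" and R S :: "('o, 'a, 'r) doctrine"
  defines "F \<equiv> Src2 \<theta>" and "G \<equiv> Tgt2 \<theta>" and "R \<equiv> Src F" and "S \<equiv> Tgt F"
  assumes src2: "rd_1arrow F"
    and tgt2: "rd_1arrow G"
    and parallel: "Src G = R" "Tgt G = S"
    and Cmp_ext: "Cmp \<theta> \<in> extensional (Ob R)"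
    and Cmp_in: "X \<in> Ob R \<Longrightarrow> Cmp \<theta> X \<in> Hom S (FOb F X) (FOb G X)"
    and Cmp_natural: "f \<in> Hom R X Y
      \<Longrightarrow> FArr G f \<cdot>\<^bsub>S\<^esub> Cmp \<theta> X = Cmp \<theta> Y \<cdot>\<^bsub>S\<^esub> FArr F f"
    and Cmp_rle: "X \<in> Ob R \<Longrightarrow> Y \<in> Ob R \<Longrightarrow> \<alpha> \<in> Rel R X Y
      \<Longrightarrow> rle S (FOb F X) (FOb F Y) (FRel F X Y \<alpha>)
            (reidx S (Cmp \<theta> X) (Cmp \<theta> Y) (FRel G X Y \<alpha>))"

definition rd_id :: "('o, 'a, 'r) doctrine \<Rightarrow> ('o, 'a, 'r) rd_arr" where
  "rd_id R = \<lparr> Src = R, Tgt = R,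
     FOb = restrict (\<lambda>X. X) (Ob R), FArr = restrict (\<lambda>f. f) (Arr R),
     FRel = restrict_rel R (\<lambda>X Y \<alpha>. \<alpha>) \<rparr>"

definition rd_comp ::
  "('o, 'a, 'r) rd_arr \<Rightarrow> ('o, 'a, 'r) rd_arr \<Rightarrow> ('o, 'a, 'r) rd_arr" where
  "rd_comp G F = \<lparr> Src = Src F, Tgt = Tgt G,
     FOb = compose (Ob (Src F)) (FOb G) (FOb F),
     FArr = compose (Arr (Src F)) (FArr G) (FArr F),
     FRel = restrict_rel (Src F) (\<lambda>X Y \<alpha>. FRel G (FOb F X) (FOb F Y) (FRel F X Y \<alpha>)) \<rparr>"

definition rd_id2 :: "('o, 'a, 'r) rd_arr \<Rightarrow> ('o, 'a, 'r) rd_cell" where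
  "rd_id2 F = \<lparr> Src2 = F, Tgt2 = F,
     Cmp = restrict (\<lambda>X. Id (Tgt F) (FOb F X)) (Ob (Src F)) \<rparr>"

definition rd_vcomp ::
  "('o, 'a, 'r) rd_cell \<Rightarrow> ('o, 'a, 'r) rd_cell \<Rightarrow> ('o, 'a, 'r) rd_cell" where
  "rd_vcomp \<phi> \<theta> = \<lparr> Src2 = Src2 \<theta>, Tgt2 = Tgt2 \<phi>,
     Cmp = restrict (\<lambda>X. Cmp \<phi> X \<cdot>\<^bsub>Tgt (Src2 \<theta>)\<^esub> Cmp \<theta> X) (Ob (Src (Src2 \<theta>))) \<rparr>"

definition rd_hcomp ::
  "('o, 'a, 'r) rd_cell \<Rightarrow> ('o, 'a, 'r) rd_cell \<Rightarrow> ('o, 'a, 'r) rd_cell" where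
  "rd_hcomp \<phi> \<theta> = \<lparr> Src2 = rd_comp (Src2 \<phi>) (Src2 \<theta>), Tgt2 = rd_comp (Tgt2 \<phi>) (Tgt2 \<theta>),
     Cmp = restrict
       (\<lambda>X. FArr (Tgt2 \<phi>) (Cmp \<theta> X) \<cdot>\<^bsub>Tgt (Src2 \<phi>)\<^esub> Cmp \<phi> (FOb (Src2 \<theta>) X))
       (Ob (Src (Src2 \<theta>))) \<rparr>"

definition RD ::
  "(('o, 'a, 'r) doctrine, ('o, 'a, 'r) rd_arr, ('o, 'a, 'r) rd_cell) twocat" where
  "RD = \<lparr> under = \<lparr> Ob = {R. relational_doctrine R}, Arr = {F. rd_1arrow F},
            Dom = Src, Cod = Tgt, Id = rd_id, Comp = rd_comp \<rparr>,
          vert = \<lparr> Ob = {F. rd_1arrow F}, Arr = {\<theta>. rd_2arrow \<theta>},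
            Dom = Src2, Cod = Tgt2, Id = rd_id2, Comp = rd_vcomp \<rparr>,
          hcomp = rd_hcomp \<rparr>"

definition preserves_quotients :: "('o, 'a, 'r) rd_arr \<Rightarrow> bool" where
  "preserves_quotients F \<longleftrightarrow> (\<forall>X \<rho> q. quotient_arrow (Src F) X \<rho> q
     \<longrightarrow> quotient_arrow (Tgt F) (FOb F X) (FRel F X X \<rho>) (FArr F q))"

definition QRD ::
  "(('o, 'a, 'r) doctrine, ('o, 'a, 'r) rd_arr, ('o, 'a, 'r) rd_cell) twocat" where
  "QRD = sub_twocat RD has_quotients preserves_quotients"

definition ERD ::
  "(('o, 'a, 'r) doctrine, ('o, 'a, 'r) rd_arr, ('o, 'a, 'r) rd_cell) twocat" where
  "ERD = sub_twocat RD extensional_doctrine (\<lambda>_. True)"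

definition EQRD ::
  "(('o, 'a, 'r) doctrine, ('o, 'a, 'r) rd_arr, ('o, 'a, 'r) rd_cell) twocat" where
  "EQRD = sub_twocat QRD extensional_doctrine (\<lambda>_. True)"


section \<open>The extensional collapse\<close>

text \<open>
  The collapse must again be a doctrine over the arrow type \<open>'a\<close>, whereas \<open>\<approx>\<close>-classes live in
  \<open>'a set\<close>. So a class, as an arrow of the collapse, is named by one of its elements:
  \<open>ecls R f\<close> is the arrow \<open>[f]\<close>. Lemmas \<open>ecls_eq_iff\<close> and \<open>bij_betw_classes\<close> below say that
  this names the elements of the quotient \<open>Arr R // approx R\<close> faithfully.
\<close>

definition class_name :: "'a set \<Rightarrow> 'a" where
  "class_name K = (SOME f. f \<in> K)"

definition ecls :: "('o, 'a, 'r) doctrine \<Rightarrow> 'a \<Rightarrow> 'a" where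
  "ecls R f = class_name (approx R `` {f})"

text \<open>
  \<open>Dom\<close>, \<open>Cod\<close>, \<open>reidx\<close> and the relational operations of \<open>R\<close> are kept: they are applied to
  class names, which are arrows of \<open>R\<close> belonging to the class they name.
\<close>

definition collapse :: "('o, 'a, 'r) doctrine \<Rightarrow> ('o, 'a, 'r) doctrine" where
  "collapse R = R\<lparr> Arr := ecls R ` Arr R, Id := (\<lambda>X. ecls R (Id R X)),
     Comp := (\<lambda>g f. ecls R (g \<cdot>\<^bsub>R\<^esub> f)) \<rparr>"

definition collapse1 :: "('o, 'a, 'r) rd_arr \<Rightarrow> ('o, 'a, 'r) rd_arr" where
  "collapse1 F = \<lparr> Src = collapse (Src F), Tgt = collapse (Tgt F),
     FOb = FOb F,
     FArr = restrict (\<lambda>k. ecls (Tgt F) (FArr F k)) (Arr (collapse (Src F))),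
     FRel = FRel F \<rparr>"

definition collapse2 :: "('o, 'a, 'r) rd_cell \<Rightarrow> ('o, 'a, 'r) rd_cell" where
  "collapse2 \<theta> = \<lparr> Src2 = collapse1 (Src2 \<theta>), Tgt2 = collapse1 (Tgt2 \<theta>),
     Cmp = restrict (\<lambda>X. ecls (Tgt (Src2 \<theta>)) (Cmp \<theta> X)) (Ob (Src (Src2 \<theta>))) \<rparr>"

definition E_functor ::
  "(('o, 'a, 'r) doctrine, ('o, 'a, 'r) rd_arr, ('o, 'a, 'r) rd_cell,
    ('o, 'a, 'r) doctrine, ('o, 'a, 'r) rd_arr, ('o, 'a, 'r) rd_cell) twofun" where
  "E_functor = \<lparr> on0 = collapse, on1 = collapse1, on2 = collapse2 \<rparr>"

definition collapse_unit :: "('o, 'a, 'r) doctrine \<Rightarrow> ('o, 'a, 'r) rd_arr" where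
  "collapse_unit R = \<lparr> Src = R, Tgt = collapse R,
     FOb = restrict (\<lambda>X. X) (Ob R), FArr = restrict (ecls R) (Arr R),
     FRel = restrict_rel R (\<lambda>X Y \<alpha>. \<alpha>) \<rparr>"

text \<open>For extensional \<open>S\<close>, the counit \<open>S\<^sup>e \<rightarrow> S\<close> sends \<open>[f]\<close> to \<open>f\<close>.\<close>

definition collapse_counit :: "('o, 'a, 'r) doctrine \<Rightarrow> ('o, 'a, 'r) rd_arr" where
  "collapse_counit S = \<lparr> Src = collapse S, Tgt = S,
     FOb = restrict (\<lambda>X. X) (Ob S),
     FArr = restrict (\<lambda>k. THE f. f \<in> Arr S \<and> ecls S f = k) (Arr (collapse S)),
     FRel = restrict_rel S (\<lambda>X Y \<alpha>. \<alpha>) \<rparr>"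

context relational_doctrine
begin

lemma equiv_approx: "equiv (Arr R) (approx R)"
proof (rule equivI)
  show "approx R \<subseteq> Arr R \<times> Arr R"
    by (auto simp: approx_def Hom_def)
  show "refl_on (Arr R) (approx R)"
    using diag_reidx by (auto simp: refl_on_def approx_def Hom_def)
  show "sym (approx R)"
  proof (rule symI)
    fix f g assume "(f, g) \<in> approx R"
    then obtain X Y where f: "f \<in> Hom R X Y" and g: "g \<in> Hom R X Y"
      and le: "rle R X X (diag R X) (reidx R f g (diag R Y))"
      by (auto simp: approx_def)
    have X: "X \<in> Ob R" and Y: "Y \<in> Ob R"
      using f dom_in cod_in by (auto simp: Hom_def)
    have r: "reidx R f g (diag R Y) \<in> Rel R X X" "reidx R g f (diag R Y) \<in> Rel R X X"
      using reidx_in[OF f g diag_in[OF Y]] reidx_in[OF g f diag_in[OF Y]] by auto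
    have 1: "rle R X X (diag R X) (conv R X X (reidx R f g (diag R Y)))"
      using monotone_onD[OF conv_mono[OF X X] diag_in[OF X] r(1) le] conv_diag[OF X] by simp
    have 2: "rle R X X (conv R X X (reidx R f g (diag R Y))) (reidx R g f (diag R Y))"
      using conv_reidx[OF f g diag_in[OF Y]] conv_diag[OF Y] by simp
    have "rle R X X (diag R X) (reidx R g f (diag R Y))"
      using transp_onD[OF rle_trans[OF X X] diag_in[OF X] conv_in[OF X X r(1)] r(2) 1 2] .
    then show "(g, f) \<in> approx R"
      using f g by (auto simp: approx_def)
  qed
  show "trans (approx R)"
  proof (rule transI)
    fix f g h assume "(f, g) \<in> approx R" "(g, h) \<in> approx R"
    then obtain X Y where f: "f \<in> Hom R X Y" and g: "g \<in> Hom R X Y" and h: "h \<in> Hom R X Y"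
      and le1: "rle R X X (diag R X) (reidx R f g (diag R Y))"
      and le2: "rle R X X (diag R X) (reidx R g h (diag R Y))"
      by (auto simp: approx_def Hom_def)
    have X: "X \<in> Ob R" and Y: "Y \<in> Ob R"
      using f dom_in cod_in by (auto simp: Hom_def)
    note d = diag_in[OF X] diag_in[OF Y]
    have r: "reidx R f g (diag R Y) \<in> Rel R X X" "reidx R g h (diag R Y) \<in> Rel R X X"
      "reidx R f h (diag R Y) \<in> Rel R X X"
      using reidx_in[OF f g d(2)] reidx_in[OF g h d(2)] reidx_in[OF f h d(2)] by auto
    let ?c = "rcomp R X X X (reidx R f g (diag R Y)) (reidx R g h (diag R Y))"
    have 1: "rle R X X (diag R X) ?c"
      using rcomp_mono[OF X X X d(1) r(1) d(1) r(2) le1 le2] rcomp_diag_left[OF X X d(1)] by simp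
    have 2: "rle R X X ?c (reidx R f h (diag R Y))"
      using rcomp_reidx[OF f g h d(2) d(2)] rcomp_diag_left[OF Y Y d(2)] by simp
    have "rle R X X (diag R X) (reidx R f h (diag R Y))"
      using transp_onD[OF rle_trans[OF X X] d(1) rcomp_in[OF X X X r(1) r(2)] r(3) 1 2] .
    then show "(f, h) \<in> approx R"
      using f h by (auto simp: approx_def)
  qed
qed

lemma class_name_in:
  assumes "K \<in> Arr R // approx R"
  shows "class_name K \<in> K"
proof -
  have "K \<noteq> {}"
    using in_quotient_imp_non_empty[OF equiv_approx assms] .
  then show ?thesis
    unfolding class_name_def by (rule some_in_eq[THEN iffD2])
qed

lemma ecls_approx: "f \<in> Arr R \<Longrightarrow> (f, ecls R f) \<in> approx R"
  using class_name_in[OF quotientI[of f "Arr R" "approx R"]] by (simp add: ecls_def)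

lemma ecls_eq_iff:
  assumes f: "f \<in> Arr R" and g: "g \<in> Arr R"
  shows "ecls R f = ecls R g \<longleftrightarrow> (f, g) \<in> approx R"
proof
  assume eq: "ecls R f = ecls R g"
  have "approx R `` {f} = approx R `` {ecls R g}"
    using equiv_class_eq[OF equiv_approx ecls_approx[OF f]] unfolding eq .
  also have "\<dots> = approx R `` {g}"
    using equiv_class_eq[OF equiv_approx ecls_approx[OF g]] by (rule sym)
  finally show "(f, g) \<in> approx R"
    by (rule eq_equiv_class[OF _ equiv_approx g])
next
  assume "(f, g) \<in> approx R"
  then show "ecls R f = ecls R g"
    unfolding ecls_def by (simp only: equiv_class_eq[OF equiv_approx])
qed

lemma bij_betw_classes: "bij_betw class_name (Arr R // approx R) (Arr (collapse R))"
proof (rule bij_betw_imageI)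
  show "inj_on class_name (Arr R // approx R)"
  proof (rule inj_onI)
    fix K L assume K: "K \<in> Arr R // approx R" and L: "L \<in> Arr R // approx R"
      and eq: "class_name K = class_name L"
    have "class_name K \<in> K \<inter> L"
      using class_name_in[OF K] class_name_in[OF L] unfolding eq by (rule IntI)
    then show "K = L"
      using quotient_disj[OF equiv_approx K L] by (elim disjE) simp_all
  qed
  have "Arr R // approx R = (\<lambda>f. approx R `` {f}) ` Arr R"
    unfolding quotient_def by (rule UNION_singleton_eq_range)
  then show "class_name ` (Arr R // approx R) = Arr (collapse R)"
    by (simp add: collapse_def ecls_def image_image)
qed

end

end

theory Submission
  imports Defs
begin

text \<open>
  The collapse of a doctrine leaves all relations and all operations on them alone and only
  identifies arrows \<open>f \<approx> g\<close>. It is well defined because such arrows reindex every relation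
  in the same way (\<open>reidx_approx\<close>): sandwiching \<open>R\<^bsub>f,g\<^esub>(\<alpha>)\<close> between two diagonals, and bounding these
  by \<open>R\<^bsub>f',f\<^esub>(d)\<close> and \<open>R\<^bsub>g,g'\<^esub>(d)\<close>, gives \<open>R\<^bsub>f,g\<^esub>(\<alpha>) \<le> R\<^bsub>f',g'\<^esub>(\<alpha>)\<close>. Unit and counit are the identity on
  objects and relations, so all equations of the 2-adjunction between \<open>RD\<close> and \<open>ERD\<close> reduce to
  equations between classes of arrows; 1-arrows preserve \<open>\<approx>\<close> because they preserve diagonals and
  reindexing.

  A 2-adjunction restricts to sub-2-categories that are full on 2-arrows as soon as both
  2-functors, the unit and the counit stay inside them (\<open>two_adjunction_restrict\<close>). Moreover
  \<open>EQRD\<close> is cut out of \<open>ERD\<close> by the conditions that cut \<open>QRD\<close> out of \<open>RD\<close>. Four facts about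
  quotients remain: if \<open>R\<close> has quotients then so does its collapse, and
  the collapse \<open>F\<^sup>e\<close> of a quotient-preserving \<open>F\<close>, the unit and the counit preserve quotient arrows.

  The crux is that an effective descent quotient arrow \<open>q\<close> remains a quotient arrow in the collapse.
  Kernels do not change, so factorizations exist. For their uniqueness, \<open>h \<circ> q \<approx> k \<circ> q\<close> must imply
  \<open>h \<approx> k\<close>, and this is what descent provides (\<open>descent_cancel\<close>). Any other quotient arrow of the
  same relation differs from \<open>q\<close> by an isomorphism, and 1-arrows preserve isomorphisms; hence it
  is enough to test preservation of quotient arrows on a single quotient arrow of each relation
  (\<open>quotient_arrow_FArr_transfer\<close>). For the unit one tests on a descent quotient arrow, for
  \<open>F\<^sup>e\<close> on the class of a quotient arrow of \<open>R\<close>. The counit poses no problem, since an extensional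
  doctrine and its collapse have the same arrows and the same composites.
\<close>

lemma HomD:
  assumes "f \<in> Hom C X Y"
  shows "f \<in> Arr C" "Dom C f = X" "Cod C f = Y"
  using assms by (simp_all add: Hom_def)

lemma is_functor_arr: "is_functor C D Fo Fa \<Longrightarrow> f \<in> Arr C \<Longrightarrow> Fa f \<in> Arr D"
  by (auto simp: is_functor_def Hom_def)

section \<open>Sub-2-categories and restriction of 2-adjunctions\<close>

text \<open>
  As \<open>sub_twocat\<close> keeps all 2-arrows between the chosen 1-arrows, it yields a 2-category as soon
  as the chosen 1-arrows contain the identities and are closed under composition.
\<close>

locale sub_two_category = two_category K
  for K :: "('x, 'f, 't) twocat" (structure) +
  fixes P :: "'x \<Rightarrow> bool" and Q :: "'f \<Rightarrow> bool"
  assumes Q_id: "X \<in> Ob (under K) \<Longrightarrow> P X \<Longrightarrow> Q (Id (under K) X)"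
    and Q_comp: "f \<in> Hom (under K) X Y \<Longrightarrow> g \<in> Hom (under K) Y Z
      \<Longrightarrow> P X \<Longrightarrow> P Y \<Longrightarrow> P Z \<Longrightarrow> Q f \<Longrightarrow> Q g \<Longrightarrow> Q (g \<cdot>\<^bsub>under K\<^esub> f)"

lemma sub_twocat_simps [simp]:
  "Ob (under (sub_twocat K P Q)) = {X \<in> Ob (under K). P X}"
  "Arr (under (sub_twocat K P Q))
    = {f \<in> Arr (under K). P (Dom (under K) f) \<and> P (Cod (under K) f) \<and> Q f}"
  "Dom (under (sub_twocat K P Q)) = Dom (under K)"
  "Cod (under (sub_twocat K P Q)) = Cod (under K)"
  "Id (under (sub_twocat K P Q)) = Id (under K)"
  "Comp (under (sub_twocat K P Q)) = Comp (under K)"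
  "Ob (vert (sub_twocat K P Q)) = Arr (under (sub_twocat K P Q))"
  "Arr (vert (sub_twocat K P Q)) = {t \<in> Arr (vert K).
     Dom (vert K) t \<in> Arr (under (sub_twocat K P Q)) \<and>
     Cod (vert K) t \<in> Arr (under (sub_twocat K P Q))}"
  "Dom (vert (sub_twocat K P Q)) = Dom (vert K)"
  "Cod (vert (sub_twocat K P Q)) = Cod (vert K)"
  "Id (vert (sub_twocat K P Q)) = Id (vert K)"
  "Comp (vert (sub_twocat K P Q)) = Comp (vert K)"
  "hcomp (sub_twocat K P Q) = hcomp K"
  by (simp_all add: sub_twocat_def Let_def)

lemma horiz_simps [simp]:
  "Ob (horiz K) = Ob (under K)" "Arr (horiz K) = Arr (vert K)"
  "Dom (horiz K) t = Dom (under K) (Dom (vert K) t)"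
  "Cod (horiz K) t = Cod (under K) (Cod (vert K) t)"
  "Id (horiz K) X = Id (vert K) (Id (under K) X)"
  "Comp (horiz K) = hcomp K"
  by (simp_all add: horiz_def)

lemma Hom_sub_twocat:
  "f \<in> Hom (under (sub_twocat K P Q)) X Y \<longleftrightarrow> f \<in> Hom (under K) X Y \<and> P X \<and> P Y \<and> Q f"
  "t \<in> Hom (vert (sub_twocat K P Q)) f g \<longleftrightarrow> t \<in> Hom (vert K) f g \<and>
     f \<in> Arr (under (sub_twocat K P Q)) \<and> g \<in> Arr (under (sub_twocat K P Q))"
  "t \<in> Hom (horiz (sub_twocat K P Q)) X Y \<longleftrightarrow> t \<in> Hom (horiz K) X Y \<and>
     Dom (vert K) t \<in> Arr (under (sub_twocat K P Q)) \<and>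
     Cod (vert K) t \<in> Arr (under (sub_twocat K P Q))"
  by (auto simp: Hom_def)

lemma Hom_sub_twocatD:
  "f \<in> Hom (under (sub_twocat K P Q)) X Y \<Longrightarrow> f \<in> Hom (under K) X Y"
  "t \<in> Hom (vert (sub_twocat K P Q)) f g \<Longrightarrow> t \<in> Hom (vert K) f g"
  "t \<in> Hom (horiz (sub_twocat K P Q)) X Y \<Longrightarrow> t \<in> Hom (horiz K) X Y"
  by (simp_all only: Hom_sub_twocat)

lemma (in sub_two_category) Q_comp_arr:
  assumes "f \<in> Arr (under (sub_twocat K P Q))" "g \<in> Arr (under (sub_twocat K P Q))"
    and "Cod (under K) f = Dom (under K) g"
  shows "g \<cdot>\<^bsub>under K\<^esub> f \<in> Arr (under (sub_twocat K P Q))"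
  using assms Q_comp[of f "Dom (under K) f" "Cod (under K) f" g "Cod (under K) g"]
    category.comp_in[OF under_category, of f "Dom (under K) f" "Cod (under K) f" g "Cod (under K) g"]
  by (auto simp: Hom_def)

lemma (in sub_two_category) two_category_sub: "two_category (sub_twocat K P Q)"
proof -
  let ?J = "sub_twocat K P Q"
  have u: "category (under ?J)"
  proof
    show "Id (under ?J) X \<in> Hom (under ?J) X X" if "X \<in> Ob (under ?J)" for X
      using that Q_id category.id_in[OF under_category] by (simp add: Hom_sub_twocat)
    show "g \<cdot>\<^bsub>under ?J\<^esub> f \<in> Hom (under ?J) X Z"
      if "f \<in> Hom (under ?J) X Y" "g \<in> Hom (under ?J) Y Z" for f g X Y Z
      using that Q_comp category.comp_in[OF under_category]
      by (fastforce simp: Hom_sub_twocat)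
  qed (auto simp: Hom_sub_twocat category.dom_in[OF under_category]
      category.cod_in[OF under_category] category.comp_id_left[OF under_category]
      category.comp_id_right[OF under_category] category.comp_assoc[OF under_category])
  have v: "category (vert ?J)"
  proof
    show "Id (vert ?J) f \<in> Hom (vert ?J) f f" if "f \<in> Ob (vert ?J)" for f
      using that category.id_in[OF vert_category, of f]
      by (simp add: Hom_sub_twocat vert_ob)
    show "t \<cdot>\<^bsub>vert ?J\<^esub> s \<in> Hom (vert ?J) f h"
      if "s \<in> Hom (vert ?J) f g" "t \<in> Hom (vert ?J) g h" for s t f g h
      using that category.comp_in[OF vert_category, of s f g t h]
      by (simp add: Hom_sub_twocat)
  qed (auto simp: Hom_sub_twocat category.comp_id_left[OF vert_category]
      category.comp_id_right[OF vert_category] category.comp_assoc[OF vert_category])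
  have h: "category (horiz ?J)"
  proof
    show "Dom (horiz ?J) t \<in> Ob (horiz ?J)" if "t \<in> Arr (horiz ?J)" for t
      using that category.dom_in[OF under_category] by auto
    show "Cod (horiz ?J) t \<in> Ob (horiz ?J)" if "t \<in> Arr (horiz ?J)" for t
      using that category.cod_in[OF under_category] by auto
    show "Id (horiz ?J) X \<in> Hom (horiz ?J) X X" if "X \<in> Ob (horiz ?J)" for X
    proof -
      have i: "Id (under K) X \<in> Hom (under K) X X"
        using that category.id_in[OF under_category] by simp
      have "Id (vert K) (Id (under K) X)
          \<in> Hom (vert K) (Id (under K) X) (Id (under K) X)"
        using HomD(1)[OF i] category.id_in[OF vert_category] by (simp add: vert_ob)
      then show ?thesis
        using that i Q_id by (simp add: Hom_def)
    qed
    show "t \<cdot>\<^bsub>horiz ?J\<^esub> s \<in> Hom (horiz ?J) X Z"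
      if "s \<in> Hom (horiz ?J) X Y" "t \<in> Hom (horiz ?J) Y Z" for s t X Y Z
    proof -
      have K: "s \<in> Hom (horiz K) X Y" "t \<in> Hom (horiz K) Y Z"
        and J: "s \<in> Arr (vert ?J)" "t \<in> Arr (vert ?J)"
        using that by (auto simp: Hom_def)
      have "Cod (under K) (Dom (vert K) s) = Dom (under K) (Dom (vert K) t)"
        "Cod (under K) (Cod (vert K) s) = Dom (under K) (Cod (vert K) t)"
        using K globular_cod[of s] globular_dom[of t] by (simp_all add: Hom_def)
      then show ?thesis
        using J category.comp_in[OF horiz_category K] hcomp_dom[OF K] hcomp_cod[OF K]
          Q_comp_arr[of "Dom (vert K) s" "Dom (vert K) t"]
          Q_comp_arr[of "Cod (vert K) s" "Cod (vert K) t"]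
        by (simp add: Hom_sub_twocat)
    qed
  next
    fix s X Y assume "s \<in> Hom (horiz ?J) X Y"
    then show "s \<cdot>\<^bsub>horiz ?J\<^esub> Id (horiz ?J) X = s" "Id (horiz ?J) Y \<cdot>\<^bsub>horiz ?J\<^esub> s = s"
      using category.comp_id_right[OF horiz_category, of s X Y]
        category.comp_id_left[OF horiz_category, of s X Y]
      by (simp_all add: Hom_sub_twocat)
  next
    fix s t r X Y Z W
    assume "s \<in> Hom (horiz ?J) X Y" "t \<in> Hom (horiz ?J) Y Z" "r \<in> Hom (horiz ?J) Z W"
    then show "(r \<cdot>\<^bsub>horiz ?J\<^esub> t) \<cdot>\<^bsub>horiz ?J\<^esub> s = r \<cdot>\<^bsub>horiz ?J\<^esub> (t \<cdot>\<^bsub>horiz ?J\<^esub> s)"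
      using category.comp_assoc[OF horiz_category, of s X Y t Z r W]
      by (simp add: Hom_sub_twocat)
  qed
  show ?thesis
  proof (rule two_category.intro)
    show "category (under ?J)" "category (vert ?J)" "category (horiz ?J)"
      by fact+
    show "(t' \<cdot>\<^bsub>vert ?J\<^esub> t) \<star>\<^bsub>?J\<^esub> (s' \<cdot>\<^bsub>vert ?J\<^esub> s) = (t' \<star>\<^bsub>?J\<^esub> s') \<cdot>\<^bsub>vert ?J\<^esub> (t \<star>\<^bsub>?J\<^esub> s)"
      if "f \<in> Hom (under ?J) X Y" "g \<in> Hom (under ?J) Y Z"
        "s \<in> Hom (vert ?J) f f'" "s' \<in> Hom (vert ?J) f' f''"
        "t \<in> Hom (vert ?J) g g'" "t' \<in> Hom (vert ?J) g' g''"
      for f X Y g Z s f' s' f'' t g' t' g''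
      using that interchange[of f X Y g Z s f' s' f'' t g' t' g'']
      by (simp add: Hom_sub_twocat)
    show "Id (vert ?J) g \<star>\<^bsub>?J\<^esub> Id (vert ?J) f = Id (vert ?J) (g \<cdot>\<^bsub>under ?J\<^esub> f)"
      if "f \<in> Hom (under ?J) X Y" "g \<in> Hom (under ?J) Y Z" for f g X Y Z
      using that hcomp_id[of f X Y g Z] by (simp add: Hom_sub_twocat)
    show "Dom (vert ?J) (t \<star>\<^bsub>?J\<^esub> s) = Dom (vert ?J) t \<cdot>\<^bsub>under ?J\<^esub> Dom (vert ?J) s"
      "Cod (vert ?J) (t \<star>\<^bsub>?J\<^esub> s) = Cod (vert ?J) t \<cdot>\<^bsub>under ?J\<^esub> Cod (vert ?J) s"
      if "s \<in> Hom (horiz ?J) X Y" "t \<in> Hom (horiz ?J) Y Z" for s t X Y Z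
      using that hcomp_dom[of s X Y t Z] hcomp_cod[of s X Y t Z]
      by (simp_all add: Hom_sub_twocat)
  qed (simp_all add: globular_dom globular_cod)
qed

lemma two_functor_cells:
  assumes "two_functor K L F"
  shows "X \<in> Ob (under K) \<Longrightarrow> on0 F X \<in> Ob (under L)"
    and "f \<in> Arr (under K) \<Longrightarrow> on1 F f \<in> Arr (under L)"
proof -
  have F: "is_functor (under K) (under L) (on0 F) (on1 F)"
    using assms by (simp only: two_functor_def)
  show "on0 F X \<in> Ob (under L)" if "X \<in> Ob (under K)"
    using F that by (simp only: is_functor_def)
  show "on1 F f \<in> Arr (under L)" if "f \<in> Arr (under K)"
    using is_functor_arr[OF F that] .
qed

text \<open>
  Corestricting and restricting 2-functors and 2-natural transformations: the equations
  they satisfy are inherited, and only membership of cells needs an argument.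
\<close>

lemma two_functor_into_sub:
  assumes F: "two_functor K L F" and L: "two_category (sub_twocat L P Q)"
    and P: "\<And>X. X \<in> Ob (under K) \<Longrightarrow> P (on0 F X)"
    and Q: "\<And>f. f \<in> Arr (under K) \<Longrightarrow> Q (on1 F f)"
  shows "two_functor K (sub_twocat L P Q) F"
proof -
  interpret K: two_category K using F by (simp add: two_functor_def)
  note u = category.dom_in[OF K.under_category] category.cod_in[OF K.under_category]
  have a: "on1 F f \<in> Arr (under (sub_twocat L P Q))" if f: "f \<in> Arr (under K)" for f
  proof -
    have "on1 F f \<in> Hom (under L) (on0 F (Dom (under K) f)) (on0 F (Cod (under K) f))"
      using F f by (auto simp: two_functor_def is_functor_def Hom_def)
    then show ?thesis
      using f u P Q by (auto simp: Hom_def)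
  qed
  have v: "on1 F f \<in> Arr (under (sub_twocat L P Q))" if "f \<in> Ob (vert K)" for f
    using a that by (simp add: K.vert_ob)
  have h: "f \<in> Arr (under K)" "g \<in> Arr (under K)" if "t \<in> Hom (vert K) f g" for t f g
    using that category.dom_in[OF K.vert_category] category.cod_in[OF K.vert_category]
    by (auto simp: Hom_def K.vert_ob)
  have LL: "category (under (sub_twocat L P Q))" "category (vert (sub_twocat L P Q))"
    using L by (auto simp: two_category_def)
  have oa: "X \<in> Ob (under K)" "Y \<in> Ob (under K)" if "f \<in> Hom (under K) X Y" for f X Y
    using that u by (auto simp: Hom_def)
  have "is_functor (under K) (under (sub_twocat L P Q)) (on0 F) (on1 F)"
    using F LL(1) P Q oa
    unfolding is_functor_def two_functor_def Hom_sub_twocat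
    by (auto simp: dest: HomD(1))
  moreover have "is_functor (vert K) (vert (sub_twocat L P Q)) (on1 F) (on2 F)"
    using F LL(2) a v h
    unfolding is_functor_def two_functor_def Hom_sub_twocat
    by (auto simp del: sub_twocat_simps(2))
  ultimately show ?thesis
    using F L unfolding two_functor_def by simp
qed

lemma two_functor_from_sub:
  assumes F: "two_functor K L F" and K: "two_category (sub_twocat K P Q)"
  shows "two_functor (sub_twocat K P Q) L F"
proof -
  interpret K: two_category K using F by (simp add: two_functor_def)
  have KK: "category (under (sub_twocat K P Q))" "category (vert (sub_twocat K P Q))"
    using K by (auto simp: two_category_def)
  have "is_functor (under (sub_twocat K P Q)) (under L) (on0 F) (on1 F)"
    using F KK(1) unfolding is_functor_def two_functor_def
    by (auto dest!: Hom_sub_twocatD(1))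
  moreover have "is_functor (vert (sub_twocat K P Q)) (vert L) (on1 F) (on2 F)"
    using F KK(2) unfolding is_functor_def two_functor_def
    by (auto simp: K.vert_ob dest!: Hom_sub_twocatD(2))
  ultimately show ?thesis
    using F K unfolding two_functor_def by (auto dest!: Hom_sub_twocatD(3))
qed

lemma two_functor_id: "two_category K \<Longrightarrow> two_functor K K twofun_id"
  by (simp add: two_functor_def is_functor_def twofun_id_def two_category_def)

lemma (in sub_two_category) two_functor_inclusion:
  "two_functor (sub_twocat K P Q) K twofun_id"
  using two_functor_from_sub[OF two_functor_id two_category_sub] two_category_axioms .

lemma (in sub_two_category) is_sub_twocat_sub: "is_sub_twocat (sub_twocat K P Q) K"
  using two_functor_inclusion by (auto simp: is_sub_twocat_def)

lemma two_natural_into_sub: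
  assumes nat: "two_natural K L F G \<eta>"
    and F: "two_functor K (sub_twocat L P Q) F" and G: "two_functor K (sub_twocat L P Q) G"
    and Q: "\<And>X. X \<in> Ob (under K) \<Longrightarrow> Q (\<eta> X)"
  shows "two_natural K (sub_twocat L P Q) F G \<eta>"
proof -
  have "P (on0 F X)" "P (on0 G X)" if "X \<in> Ob (under K)" for X
    using F G that by (auto simp: two_functor_def is_functor_def)
  then show ?thesis
    using nat F G Q unfolding two_natural_def Hom_sub_twocat by simp
qed

lemma two_natural_from_sub:
  assumes nat: "two_natural K L F G \<eta>" and K: "two_category (sub_twocat K P Q)"
  shows "two_natural (sub_twocat K P Q) L F G \<eta>"
  using nat two_functor_from_sub[OF _ K] unfolding two_natural_def
  by (auto dest!: Hom_sub_twocatD)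

lemma two_functor_restrict:
  assumes F: "two_functor K L F"
    and K: "two_category (sub_twocat K P Q)" and L: "two_category (sub_twocat L P' Q')"
    and F0: "\<And>X. X \<in> Ob (under (sub_twocat K P Q)) \<Longrightarrow> P' (on0 F X)"
    and F1: "\<And>f. f \<in> Arr (under (sub_twocat K P Q)) \<Longrightarrow> Q' (on1 F f)"
  shows "two_functor (sub_twocat K P Q) (sub_twocat L P' Q') F"
  using two_functor_into_sub[OF two_functor_from_sub[OF F K] L F0 F1] .

theorem two_adjunction_restrict:
  assumes adj: "two_adjunction K L F U \<eta> \<epsilon>"
    and K: "two_category (sub_twocat K P Q)" and L: "two_category (sub_twocat L P' Q')"
    and F0: "\<And>X. X \<in> Ob (under (sub_twocat K P Q)) \<Longrightarrow> P' (on0 F X)"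
    and F1: "\<And>f. f \<in> Arr (under (sub_twocat K P Q)) \<Longrightarrow> Q' (on1 F f)"
    and U0: "\<And>Y. Y \<in> Ob (under (sub_twocat L P' Q')) \<Longrightarrow> P (on0 U Y)"
    and U1: "\<And>g. g \<in> Arr (under (sub_twocat L P' Q')) \<Longrightarrow> Q (on1 U g)"
    and \<eta>: "\<And>X. X \<in> Ob (under (sub_twocat K P Q)) \<Longrightarrow> Q (\<eta> X)"
    and \<epsilon>: "\<And>Y. Y \<in> Ob (under (sub_twocat L P' Q')) \<Longrightarrow> Q' (\<epsilon> Y)"
  shows "two_adjunction (sub_twocat K P Q) (sub_twocat L P' Q') F U \<eta> \<epsilon>"
proof -
  let ?K = "sub_twocat K P Q" and ?L = "sub_twocat L P' Q'"
  have F: "two_functor K L F" and U: "two_functor L K U"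
    and n: "two_natural K K twofun_id (twofun_comp U F) \<eta>"
    and e: "two_natural L L (twofun_comp F U) twofun_id \<epsilon>"
    using adj by (auto simp: two_adjunction_def)
  have F': "two_functor ?K ?L F" using two_functor_restrict[OF F K L F0 F1] .
  have U': "two_functor ?L ?K U" using two_functor_restrict[OF U L K U0 U1] .
  note F'0 = two_functor_cells(1)[OF F'] and F'1 = two_functor_cells(2)[OF F']
    and U'0 = two_functor_cells(1)[OF U'] and U'1 = two_functor_cells(2)[OF U']
  have UF: "two_functor ?K ?K (twofun_comp U F)"
    using n two_functor_restrict[of K K "twofun_comp U F" P Q P Q] K U0[OF F'0] U1[OF F'1]
    by (simp add: two_natural_def twofun_comp_def)
  have FU: "two_functor ?L ?L (twofun_comp F U)"
    using e two_functor_restrict[of L L "twofun_comp F U" P' Q' P' Q'] L F0[OF U'0] F1[OF U'1]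
    by (simp add: two_natural_def twofun_comp_def)
  have "two_natural ?K ?K twofun_id (twofun_comp U F) \<eta>"
    using two_natural_into_sub[OF two_natural_from_sub[OF n K] two_functor_id[OF K] UF \<eta>] .
  moreover have "two_natural ?L ?L (twofun_comp F U) twofun_id \<epsilon>"
    using two_natural_into_sub[OF two_natural_from_sub[OF e L] FU two_functor_id[OF L] \<epsilon>] .
  ultimately show ?thesis
    using adj F' U' by (simp add: two_adjunction_def)
qed

section \<open>Reindexing along equivalent arrows\<close>

context relational_doctrine
begin

lemma Hom_ob:
  assumes "f \<in> Hom R X Y"
  shows "X \<in> Ob R" "Y \<in> Ob R"
  using assms dom_in cod_in by (auto simp: Hom_def)

lemma rle_tr:
  assumes "X \<in> Ob R" "Y \<in> Ob R" "rle R X Y \<alpha> \<beta>" "rle R X Y \<beta> \<gamma>"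
    "\<alpha> \<in> Rel R X Y" "\<beta> \<in> Rel R X Y" "\<gamma> \<in> Rel R X Y"
  shows "rle R X Y \<alpha> \<gamma>"
  using transp_onD[OF rle_trans[OF assms(1,2)] assms(5-7)] assms(3,4) by blast

lemma reidx_le:
  assumes "f \<in> Hom R X A" "g \<in> Hom R Y B" "\<alpha> \<in> Rel R A B" "\<beta> \<in> Rel R A B" "rle R A B \<alpha> \<beta>"
  shows "rle R X Y (reidx R f g \<alpha>) (reidx R f g \<beta>)"
  using monotone_onD[OF reidx_mono[OF assms(1,2)]] assms(3-5) by blast

text \<open>
  Lax functoriality of relational composition, applied twice. In terms of squares of the double
  category of arrows and relations, three squares are pasted side by side.
\<close>

lemma rcomp3_reidx_le:
  assumes f': "f' \<in> Hom R X' A'" and f: "f \<in> Hom R X A"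
    and g: "g \<in> Hom R Y B" and g': "g' \<in> Hom R Y' B'"
    and \<sigma>: "\<sigma> \<in> Rel R A' A" and \<alpha>: "\<alpha> \<in> Rel R A B" and \<tau>: "\<tau> \<in> Rel R B B'"
  shows "rle R X' Y'
    (rcomp R X' X Y' (reidx R f' f \<sigma>) (rcomp R X Y Y' (reidx R f g \<alpha>) (reidx R g g' \<tau>)))
    (reidx R f' g' (rcomp R A' A B' \<sigma> (rcomp R A B B' \<alpha> \<tau>)))"
proof -
  note ob = Hom_ob[OF f'] Hom_ob[OF f] Hom_ob[OF g] Hom_ob[OF g']
  note r = reidx_in[OF f' f \<sigma>] reidx_in[OF f g \<alpha>] reidx_in[OF g g' \<tau>]
  have \<alpha>\<tau>: "rcomp R A B B' \<alpha> \<tau> \<in> Rel R A B'"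
    using rcomp_in ob \<alpha> \<tau> by simp
  note m = reidx_in[OF f g' \<alpha>\<tau>]
  have "rle R X' Y'
      (rcomp R X' X Y' (reidx R f' f \<sigma>) (rcomp R X Y Y' (reidx R f g \<alpha>) (reidx R g g' \<tau>)))
      (rcomp R X' X Y' (reidx R f' f \<sigma>) (reidx R f g' (rcomp R A B B' \<alpha> \<tau>)))"
    using rcomp_mono r m ob rcomp_reidx[OF f g g' \<alpha> \<tau>] rcomp_in
      reflp_onD[OF rle_refl[OF ob(1,3)] r(1)] by simp
  from rle_tr[OF ob(1,7) this rcomp_reidx[OF f' f g' \<sigma> \<alpha>\<tau>]] show ?thesis
    using ob r m \<sigma> \<alpha>\<tau> reidx_in[OF f' g'] by (simp add: rcomp_in)
qed

text \<open>
  A relation may be multiplied by diagonals for free, and these diagonals may then be enlarged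
  to reindexed relations. Diagonals \<open>\<sigma>\<close>, \<open>\<tau>\<close> yield invariance of reindexing under \<open>\<approx>\<close>; the graph
  of \<open>f\<close> and its converse yield the formula for the kernel of \<open>f\<close>.
\<close>

lemma reidx_sandwich:
  assumes f': "f' \<in> Hom R X A'" and f: "f \<in> Hom R X A"
    and g: "g \<in> Hom R Y B" and g': "g' \<in> Hom R Y B'"
    and \<sigma>: "\<sigma> \<in> Rel R A' A" and \<alpha>: "\<alpha> \<in> Rel R A B" and \<tau>: "\<tau> \<in> Rel R B B'"
    and \<sigma>d: "rle R X X (diag R X) (reidx R f' f \<sigma>)"
    and \<tau>d: "rle R Y Y (diag R Y) (reidx R g g' \<tau>)"
  shows "rle R X Y (reidx R f g \<alpha>) (reidx R f' g' (rcomp R A' A B' \<sigma> (rcomp R A B B' \<alpha> \<tau>)))"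
proof -
  note ob = Hom_ob[OF f'] Hom_ob[OF f] Hom_ob[OF g] Hom_ob[OF g']
  note r = reidx_in[OF f' f \<sigma>] reidx_in[OF f g \<alpha>] reidx_in[OF g g' \<tau>]
  note d = diag_in[OF ob(1)] diag_in[OF ob(5)]
  have 1: "rle R X Y (rcomp R X Y Y (reidx R f g \<alpha>) (diag R Y))
      (rcomp R X Y Y (reidx R f g \<alpha>) (reidx R g g' \<tau>))"
    using rcomp_mono[of X Y Y] ob r d \<tau>d reflp_onD[OF rle_refl[OF ob(1,5)] r(2)] by simp
  have "rle R X Y (rcomp R X X Y (diag R X) (rcomp R X Y Y (reidx R f g \<alpha>) (diag R Y)))
      (rcomp R X X Y (reidx R f' f \<sigma>) (rcomp R X Y Y (reidx R f g \<alpha>) (reidx R g g' \<tau>)))"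
    using rcomp_mono[of X X Y, OF _ _ _ _ _ _ _ \<sigma>d 1] ob r d rcomp_in by simp
  then have "rle R X Y (reidx R f g \<alpha>)
      (rcomp R X X Y (reidx R f' f \<sigma>) (rcomp R X Y Y (reidx R f g \<alpha>) (reidx R g g' \<tau>)))"
    using ob r by (simp add: rcomp_diag_left rcomp_diag_right)
  from rle_tr[OF ob(1,5) this rcomp3_reidx_le[OF f' f g g' \<sigma> \<alpha> \<tau>]] show ?thesis
    using ob r \<sigma> \<alpha> \<tau> reidx_in[OF f' g'] by (simp add: rcomp_in)
qed

lemma approx_iff:
  assumes "f \<in> Hom R X Y" "g \<in> Hom R X Y"
  shows "(f, g) \<in> approx R \<longleftrightarrow> rle R X X (diag R X) (reidx R f g (diag R Y))"
  using assms by (auto simp: approx_def Hom_def)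

lemma approx_Hom:
  assumes "(f, g) \<in> approx R" "f \<in> Hom R X Y"
  shows "g \<in> Hom R X Y"
  using assms by (auto simp: approx_def Hom_def)

lemma approx_sym: "(f, g) \<in> approx R \<Longrightarrow> (g, f) \<in> approx R"
  using equiv_approx by (auto elim: equivE dest: symD)

lemma approx_refl: "f \<in> Arr R \<Longrightarrow> (f, f) \<in> approx R"
  using equiv_approx by (auto elim: equivE dest: refl_onD)

text \<open>
  The sandwich with \<open>\<sigma>\<close> and \<open>\<tau>\<close> diagonal: \<open>f \<approx> f'\<close> and \<open>g \<approx> g'\<close> are just its two side conditions.
  The reverse inequality follows by symmetry of \<open>\<approx>\<close>, so fibres being partially ordered makes
  reindexing a function of \<open>\<approx>\<close>-classes.
\<close>

lemma reidx_approx_le: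
  assumes ff': "(f, f') \<in> approx R" and gg': "(g, g') \<in> approx R"
    and f: "f \<in> Hom R X A" and g: "g \<in> Hom R Y B" and \<alpha>: "\<alpha> \<in> Rel R A B"
  shows "rle R X Y (reidx R f g \<alpha>) (reidx R f' g' \<alpha>)"
proof -
  have f': "f' \<in> Hom R X A" and g': "g' \<in> Hom R Y B"
    using approx_Hom assms by blast+
  note ob = Hom_ob[OF f] Hom_ob[OF g]
  have "rle R X X (diag R X) (reidx R f' f (diag R A))"
    using approx_sym[OF ff'] approx_iff[OF f' f] by simp
  moreover have "rle R Y Y (diag R Y) (reidx R g g' (diag R B))"
    using gg' approx_iff[OF g g'] by simp
  ultimately show ?thesis
    using reidx_sandwich[OF f' f g g' diag_in \<alpha> diag_in] ob \<alpha>
    by (simp add: rcomp_diag_left rcomp_diag_right)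
qed

lemma reidx_approx:
  assumes ff': "(f, f') \<in> approx R" and gg': "(g, g') \<in> approx R"
    and f: "f \<in> Hom R X A" and g: "g \<in> Hom R Y B" and \<alpha>: "\<alpha> \<in> Rel R A B"
  shows "reidx R f g \<alpha> = reidx R f' g' \<alpha>"
proof -
  have f': "f' \<in> Hom R X A" and g': "g' \<in> Hom R Y B"
    using approx_Hom assms by blast+
  note ob = Hom_ob[OF f] Hom_ob[OF g]
  show ?thesis
    using antisymp_onD[OF rle_antisym[OF ob(1,3)] reidx_in[OF f g \<alpha>] reidx_in[OF f' g' \<alpha>]
        reidx_approx_le[OF ff' gg' f g \<alpha>]
        reidx_approx_le[OF approx_sym[OF ff'] approx_sym[OF gg'] f' g' \<alpha>]] .
qed

lemma approx_comp:
  assumes ff': "(f, f') \<in> approx R" and gg': "(g, g') \<in> approx R"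
    and f: "f \<in> Hom R X Y" and g: "g \<in> Hom R Y Z"
  shows "(g \<cdot> f, g' \<cdot> f') \<in> approx R"
proof -
  have f': "f' \<in> Hom R X Y" and g': "g' \<in> Hom R Y Z"
    using approx_Hom assms by blast+
  note ob = Hom_ob[OF f] Hom_ob[OF g]
  note d = diag_in[OF ob(1)] diag_in[OF ob(2)] diag_in[OF ob(4)]
  have "rle R X X (reidx R f f' (diag R Y)) (reidx R f f' (reidx R g g' (diag R Z)))"
    using reidx_le[OF f f' d(2) reidx_in[OF g g' d(3)]] gg' approx_iff[OF g g'] by simp
  then have "rle R X X (diag R X) (reidx R f f' (reidx R g g' (diag R Z)))"
    using ff' approx_iff[OF f f']
      rle_tr[OF ob(1,1) _ _ d(1) reidx_in[OF f f' d(2)] reidx_in[OF f f' reidx_in[OF g g' d(3)]]]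
    by simp
  then show ?thesis
    using approx_iff[OF comp_in[OF f g] comp_in[OF f' g']] reidx_comp[OF g f g' f' d(3)] by simp
qed

section \<open>Graphs, kernels and descent\<close>

lemma graph_eq: "f \<in> Hom R X Y \<Longrightarrow> graph R f = reidx R f (Id R Y) (diag R Y)"
  by (simp add: graph_def Hom_def)

text \<open>
  The axioms give only one inequality between the converse of a reindexed relation and the
  reindexed converse; the other one is its conjugate under the involution.
\<close>

lemma conv_graph:
  assumes f: "f \<in> Hom R X Y"
  shows "conv R X Y (graph R f) = reidx R (Id R Y) f (diag R Y)"
proof -
  note ob = Hom_ob[OF f]
  note i = id_in[OF ob(2)] and d = diag_in[OF ob(2)]
  note r = reidx_in[OF f i d] reidx_in[OF i f d]
  have 1: "rle R Y X (conv R X Y (reidx R f (Id R Y) (diag R Y))) (reidx R (Id R Y) f (diag R Y))"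
    using conv_reidx[OF f i d] ob by (simp add: conv_diag)
  have "rle R X Y (conv R Y X (reidx R (Id R Y) f (diag R Y))) (reidx R f (Id R Y) (diag R Y))"
    using conv_reidx[OF i f d] ob by (simp add: conv_diag)
  then have 2: "rle R Y X (reidx R (Id R Y) f (diag R Y)) (conv R X Y (reidx R f (Id R Y) (diag R Y)))"
    using monotone_onD[OF conv_mono[OF ob] conv_in[OF ob(2,1) r(2)] r(1)] ob r
    by (simp add: conv_conv)
  show ?thesis
    using antisymp_onD[OF rle_antisym[OF ob(2,1)] _ _ 1 2] r conv_in[OF ob r(1)]
    by (simp add: graph_eq[OF f])
qed

text \<open>
  The relation \<open>\<Gamma>\<^sub>f ; \<Gamma>\<^sub>f\<^sup>\<bottom>\<close> is the inverse image of the diagonal. One inequality is lax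
  functoriality of composition. For the other one, \<open>d\<^sub>X \<le> R\<^bsub>f,f\<^esub>(d\<^sub>Y) = R\<^bsub>id,f\<^esub>(\<Gamma>\<^sub>f) = R\<^bsub>f,id\<^esub>(\<Gamma>\<^sub>f\<^sup>\<bottom>)\<close>, so
  sandwiching \<open>R\<^bsub>f,f\<^esub>(d\<^sub>Y)\<close> between \<open>\<Gamma>\<^sub>f\<close> and \<open>\<Gamma>\<^sub>f\<^sup>\<bottom>\<close> bounds it by \<open>\<Gamma>\<^sub>f ; d\<^sub>Y ; \<Gamma>\<^sub>f\<^sup>\<bottom>\<close>.
\<close>

lemma kernel_eq:
  assumes f: "f \<in> Hom R X Y"
  shows "kernel R f = reidx R f f (diag R Y)"
proof -
  note ob = Hom_ob[OF f]
  note i = id_in[OF ob(1)] id_in[OF ob(2)] and d = diag_in[OF ob(1)] diag_in[OF ob(2)]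
  let ?G = "reidx R f (Id R Y) (diag R Y)" and ?H = "reidx R (Id R Y) f (diag R Y)"
  have G: "?G \<in> Rel R X Y" and H: "?H \<in> Rel R Y X"
    using reidx_in f i d by blast+
  have k: "kernel R f = rcomp R X Y X ?G ?H"
    using f conv_graph[OF f] by (simp add: kernel_def graph_eq[OF f] Hom_def Let_def)
  have GH: "rcomp R X Y X ?G ?H \<in> Rel R X X" using rcomp_in ob G H by blast
  have 1: "rle R X X (rcomp R X Y X ?G ?H) (reidx R f f (diag R Y))"
    using rcomp_reidx[OF f i(2) f d(2) d(2)] ob d by (simp add: rcomp_diag_left)
  have "reidx R (Id R X) f ?G = reidx R f f (diag R Y)"
    using reidx_comp[OF f i(1) i(2) f d(2)] f by (simp add: comp_id_right comp_id_left)
  moreover have "reidx R f (Id R X) ?H = reidx R f f (diag R Y)"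
    using reidx_comp[OF i(2) f f i(1) d(2)] f by (simp add: comp_id_right comp_id_left)
  ultimately have 2: "rle R X X (reidx R f f (diag R Y)) (rcomp R X Y X ?G ?H)"
    using reidx_sandwich[OF i(1) f f i(1) G d(2) H] diag_reidx[OF f] GH ob H
    by (simp add: reidx_id rcomp_diag_left)
  show ?thesis
    using antisymp_onD[OF rle_antisym[OF ob(1,1)] GH reidx_in[OF f f d(2)] 1 2] k by simp
qed

lemma kernel_in: "f \<in> Hom R X Y \<Longrightarrow> kernel R f \<in> Rel R X X"
  using reidx_in[of f X Y f X Y] diag_in Hom_ob(2) by (simp add: kernel_eq)

lemma kernel_comp_le:
  assumes f: "f \<in> Hom R X Y" and g: "g \<in> Hom R Y Z"
  shows "rle R X X (kernel R f) (kernel R (g \<cdot> f))"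
proof -
  note ob = Hom_ob[OF f] Hom_ob[OF g]
  show ?thesis
    using reidx_le[OF f f diag_in[OF ob(2)] reidx_in[OF g g diag_in[OF ob(4)]] diag_reidx[OF g]]
      reidx_comp[OF g f g f diag_in[OF ob(4)]]
    by (simp add: kernel_eq[OF f] kernel_eq[OF comp_in[OF f g]])
qed

text \<open>
  Descent arrows are epimorphisms up to \<open>\<approx>\<close>. From \<open>d\<^sub>W \<le> \<Gamma>\<^sub>q\<^sup>\<bottom> ; d\<^sub>X ; \<Gamma>\<^sub>q\<close> and
  \<open>d\<^sub>X \<le> R\<^bsub>q,q\<^esub>(R\<^bsub>h,k\<^esub>(d\<^sub>Z))\<close> one gets \<open>d\<^sub>W \<le> \<Gamma>\<^sub>q\<^sup>\<bottom> ; R\<^bsub>q,q\<^esub>(R\<^bsub>h,k\<^esub>(d\<^sub>Z)) ; \<Gamma>\<^sub>q \<le> R\<^bsub>h,k\<^esub>(d\<^sub>Z)\<close>.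
\<close>

lemma descent_cancel:
  assumes q: "q \<in> Hom R X W" and descent: "descent R q"
    and h: "h \<in> Hom R W Z" and k: "k \<in> Hom R W Z"
    and hk: "(h \<cdot> q, k \<cdot> q) \<in> approx R"
  shows "(h, k) \<in> approx R"
proof -
  note ob = Hom_ob[OF q] Hom_ob[OF h]
  note d = diag_in[OF ob(1)] diag_in[OF ob(2)] diag_in[OF ob(4)]
  note i = id_in[OF ob(2)]
  let ?G = "reidx R q (Id R W) (diag R W)" and ?H = "reidx R (Id R W) q (diag R W)"
  let ?\<gamma> = "reidx R h k (diag R Z)"
  have G: "?G \<in> Rel R X W" and H: "?H \<in> Rel R W X" and \<gamma>: "?\<gamma> \<in> Rel R W W"
    using reidx_in q i d h k by blast+
  have q\<gamma>: "reidx R q q ?\<gamma> \<in> Rel R X X" using reidx_in q \<gamma> by blast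
  have des: "rle R W W (diag R W) (rcomp R W X W ?H ?G)"
    using descent q conv_graph[OF q] by (simp add: descent_def graph_eq[OF q] Hom_def Let_def)
  have "rle R X X (diag R X) (reidx R q q ?\<gamma>)"
    using hk approx_iff[OF comp_in[OF q h] comp_in[OF q k]] reidx_comp[OF h q k q d(3)] by simp
  then have "rle R X W (rcomp R X X W (diag R X) ?G) (rcomp R X X W (reidx R q q ?\<gamma>) ?G)"
    using rcomp_mono[of X X W] ob d G q\<gamma> reflp_onD[OF rle_refl[OF ob(1,2)] G] by simp
  then have "rle R W W (rcomp R W X W ?H ?G) (rcomp R W X W ?H (rcomp R X X W (reidx R q q ?\<gamma>) ?G))"
    using rcomp_mono[of W X W] ob d G H q\<gamma> rcomp_in[of X X W] reflp_onD[OF rle_refl[OF ob(2,1)] H]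
    by (simp add: rcomp_diag_left)
  moreover have "rle R W W (rcomp R W X W ?H (rcomp R X X W (reidx R q q ?\<gamma>) ?G)) ?\<gamma>"
    using rcomp3_reidx_le[OF i q q i d(2) \<gamma> d(2)]
    unfolding rcomp_diag_right[OF ob(2,2) \<gamma>] rcomp_diag_left[OF ob(2,2) \<gamma>]
      reidx_id[OF ob(2,2) \<gamma>] .
  moreover have "rcomp R X X W (reidx R q q ?\<gamma>) ?G \<in> Rel R X W"
    "rcomp R W X W ?H ?G \<in> Rel R W W"
    using rcomp_in[OF ob(1,1,2) q\<gamma> G] rcomp_in[OF ob(2,1,2) H G] by simp_all
  moreover from this(1) have "rcomp R W X W ?H (rcomp R X X W (reidx R q q ?\<gamma>) ?G) \<in> Rel R W W"
    using rcomp_in[OF ob(2,1,2) H] by blast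
  ultimately have "rle R W W (diag R W) ?\<gamma>"
    using rle_tr[OF ob(2,2) des _ d(2)] rle_tr[OF ob(2,2) _ _ _ _ \<gamma>] d(2) by blast
  then show ?thesis
    using approx_iff[OF h k] by simp
qed

section \<open>Quotient arrows are unique up to isomorphism\<close>

lemma quotient_arrow_comp_iso:
  assumes q: "quotient_arrow R X \<rho> q" and i: "i \<in> Hom R (Cod R q) V" and j: "j \<in> Hom R V (Cod R q)"
    and ji: "j \<cdot> i = Id R (Cod R q)" and ij: "i \<cdot> j = Id R V"
  shows "quotient_arrow R X \<rho> (i \<cdot> q)"
proof -
  let ?W = "Cod R q"
  have q': "q \<in> Hom R X ?W" using q by (simp add: quotient_arrow_def Hom_def)
  have iq: "i \<cdot> q \<in> Hom R X V" using comp_in q' i by blast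
  note ob = Hom_ob[OF q']
  have \<rho>: "\<rho> \<in> Rel R X X" "equiv_rel R X \<rho>" "rle R X X \<rho> (kernel R q)"
    using q by (auto simp: quotient_arrow_def equiv_rel_def)
  have "rle R X X \<rho> (kernel R (i \<cdot> q))"
    using rle_tr[OF ob(1,1) \<rho>(3) kernel_comp_le[OF q' i] \<rho>(1)] kernel_in q' iq by blast
  moreover have "\<exists>!k. k \<in> Hom R V Z \<and> f = k \<cdot> (i \<cdot> q)"
    if f: "f \<in> Hom R X Z" and le: "rle R X X \<rho> (kernel R f)" for f Z
  proof -
    obtain h where h: "h \<in> Hom R ?W Z" "f = h \<cdot> q"
      and u: "\<And>h'. h' \<in> Hom R ?W Z \<Longrightarrow> f = h' \<cdot> q \<Longrightarrow> h' = h"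
      using q f le unfolding quotient_arrow_def by metis
    have "(h \<cdot> j) \<cdot> (i \<cdot> q) = h \<cdot> ((j \<cdot> i) \<cdot> q)"
      using comp_assoc[OF iq j h(1)] comp_assoc[OF q' i j] by simp
    then have 1: "f = (h \<cdot> j) \<cdot> (i \<cdot> q)"
      using h ji comp_id_left[OF q'] by simp
    have "k = h \<cdot> j" if k: "k \<in> Hom R V Z" "f = k \<cdot> (i \<cdot> q)" for k
    proof -
      have "k \<cdot> i = h" using u[OF comp_in[OF i k(1)]] k comp_assoc[OF q' i k(1)] by simp
      then show ?thesis using comp_assoc[OF j i k(1)] ij comp_id_right[OF k(1)] by simp
    qed
    then show ?thesis using 1 comp_in[OF j h(1)] by blast
  qed
  ultimately show ?thesis
    using \<rho> iq by (simp add: quotient_arrow_def Hom_def)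
qed

lemma quotient_arrow_unique:
  assumes q: "quotient_arrow R X \<rho> q" and q': "quotient_arrow R X \<rho> q'"
  obtains i j where "i \<in> Hom R (Cod R q) (Cod R q')" "j \<in> Hom R (Cod R q') (Cod R q)"
    "j \<cdot> i = Id R (Cod R q)" "i \<cdot> j = Id R (Cod R q')" "q' = i \<cdot> q"
proof -
  have ex: "\<exists>i \<in> Hom R (Cod R a) (Cod R b). b = i \<cdot> a"
    if "quotient_arrow R X \<rho> a" "quotient_arrow R X \<rho> b" for a b
  proof -
    have "b \<in> Hom R X (Cod R b)" "rle R X X \<rho> (kernel R b)"
      using that by (auto simp: quotient_arrow_def Hom_def)
    then show ?thesis using that(1) unfolding quotient_arrow_def by blast
  qed
  have endo: "k = Id R (Cod R a)"
    if a: "quotient_arrow R X \<rho> a" and k: "k \<in> Hom R (Cod R a) (Cod R a)" "a = k \<cdot> a" for a k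
  proof -
    have "a \<in> Hom R X (Cod R a)" "rle R X X \<rho> (kernel R a)"
      using a by (auto simp: quotient_arrow_def Hom_def)
    moreover from this have "Id R (Cod R a) \<in> Hom R (Cod R a) (Cod R a)" "a = Id R (Cod R a) \<cdot> a"
      using id_in Hom_ob comp_id_left by auto
    ultimately show ?thesis using a k unfolding quotient_arrow_def by metis
  qed
  obtain i j where i: "i \<in> Hom R (Cod R q) (Cod R q')" "q' = i \<cdot> q"
    and j: "j \<in> Hom R (Cod R q') (Cod R q)" "q = j \<cdot> q'"
    using ex[OF q q'] ex[OF q' q] by blast
  have h: "q \<in> Hom R X (Cod R q)" "q' \<in> Hom R X (Cod R q')"
    using q q' by (auto simp: quotient_arrow_def Hom_def)
  have "j \<cdot> i = Id R (Cod R q)"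
    using endo[OF q comp_in[OF i(1) j(1)]]
    by (simp add: comp_assoc[OF h(1) i(1) j(1)] i(2)[symmetric] j(2)[symmetric])
  moreover have "i \<cdot> j = Id R (Cod R q')"
    using endo[OF q' comp_in[OF j(1) i(1)]]
    by (simp add: comp_assoc[OF h(2) j(1) i(1)] i(2)[symmetric] j(2)[symmetric])
  ultimately show ?thesis using that i j by blast
qed

end

section \<open>The extensional collapse of a doctrine\<close>

lemma collapse_simps [simp]:
  "Ob (collapse R) = Ob R" "Dom (collapse R) = Dom R" "Cod (collapse R) = Cod R"
  "Id (collapse R) X = ecls R (Id R X)" "Comp (collapse R) g f = ecls R (g \<cdot>\<^bsub>R\<^esub> f)"
  "Rel (collapse R) = Rel R" "rle (collapse R) = rle R" "reidx (collapse R) = reidx R"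
  "diag (collapse R) = diag R" "rcomp (collapse R) = rcomp R" "conv (collapse R) = conv R"
  by (simp_all add: collapse_def)

context relational_doctrine
begin

lemma ecls_Hom: "f \<in> Hom R X Y \<Longrightarrow> ecls R f \<in> Hom R X Y"
  by (rule approx_Hom[OF ecls_approx[OF HomD(1)]])

lemma ecls_ecls [simp]: "f \<in> Arr R \<Longrightarrow> ecls R (ecls R f) = ecls R f"
  using ecls_eq_iff[of "ecls R f" f] approx_sym[OF ecls_approx[of f]] ecls_Hom[of f]
  by (simp add: Hom_def)

text \<open>
  Naming classes is idempotent, so the arrows of the collapse are the fixed points of
  \<open>ecls R\<close>. This turns statements about the base of the collapse into statements
  about arrows of \<open>R\<close>.
\<close>

lemma Arr_collapse: "f \<in> Arr (collapse R) \<longleftrightarrow> f \<in> Arr R \<and> ecls R f = f"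
  using ecls_Hom by (auto simp: collapse_def Hom_def intro: rev_image_eqI)

lemma Hom_collapse: "f \<in> Hom (collapse R) X Y \<longleftrightarrow> f \<in> Hom R X Y \<and> ecls R f = f"
  using Arr_collapse by (auto simp: Hom_def)

lemma ecls_Hom_collapse: "f \<in> Hom R X Y \<Longrightarrow> ecls R f \<in> Hom (collapse R) X Y"
  using ecls_Hom by (auto simp: Hom_collapse dest: HomD(1))

lemma ecls_comp:
  assumes f: "f \<in> Hom R X Y" and g: "g \<in> Hom R Y Z"
  shows "ecls R (ecls R g \<cdot> f) = ecls R (g \<cdot> f)" "ecls R (g \<cdot> ecls R f) = ecls R (g \<cdot> f)"
proof -
  note a = HomD(1)[OF f] HomD(1)[OF g]
  show "ecls R (ecls R g \<cdot> f) = ecls R (g \<cdot> f)"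
    using approx_sym[OF approx_comp[OF approx_refl[OF a(1)] ecls_approx[OF a(2)] f g]] f g
    by (simp add: ecls_eq_iff HomD(1)[OF comp_in[OF f ecls_Hom[OF g]]] HomD(1)[OF comp_in[OF f g]])
  show "ecls R (g \<cdot> ecls R f) = ecls R (g \<cdot> f)"
    using approx_sym[OF approx_comp[OF ecls_approx[OF a(1)] approx_refl[OF a(2)] f g]] f g
    by (simp add: ecls_eq_iff HomD(1)[OF comp_in[OF ecls_Hom[OF f] g]] HomD(1)[OF comp_in[OF f g]])
qed

lemma reidx_ecls:
  assumes f: "f \<in> Hom R X A" and g: "g \<in> Hom R Y B" and \<alpha>: "\<alpha> \<in> Rel R A B"
  shows "reidx R (ecls R f) (ecls R g) \<alpha> = reidx R f g \<alpha>"
  using reidx_approx[OF ecls_approx ecls_approx f g \<alpha>] f g by (simp add: Hom_def)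

lemma category_collapse: "category (collapse R)"
proof
  show "Dom (collapse R) f \<in> Ob (collapse R)" "Cod (collapse R) f \<in> Ob (collapse R)"
    if "f \<in> Arr (collapse R)" for f
    using that dom_in cod_in by (auto simp: Arr_collapse)
  show "Id (collapse R) X \<in> Hom (collapse R) X X" if "X \<in> Ob (collapse R)" for X
    using that id_in ecls_Hom_collapse by simp
  show "g \<cdot>\<^bsub>collapse R\<^esub> f \<in> Hom (collapse R) X Z"
    if "f \<in> Hom (collapse R) X Y" "g \<in> Hom (collapse R) Y Z" for f g X Y Z
    using that comp_in[of f X Y g Z] ecls_Hom_collapse by (simp add: Hom_collapse[of f] Hom_collapse[of g])
next
  fix f X Y assume "f \<in> Hom (collapse R) X Y"
  then have f: "f \<in> Hom R X Y" "ecls R f = f" by (simp_all add: Hom_collapse)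
  note ob = Hom_ob[OF f(1)]
  show "f \<cdot>\<^bsub>collapse R\<^esub> Id (collapse R) X = f"
    using ecls_comp(2)[OF id_in[OF ob(1)] f(1)] f by (simp add: comp_id_right)
  show "Id (collapse R) Y \<cdot>\<^bsub>collapse R\<^esub> f = f"
    using ecls_comp(1)[OF f(1) id_in[OF ob(2)]] f by (simp add: comp_id_left)
next
  fix f g h X Y Z W
  assume "f \<in> Hom (collapse R) X Y" "g \<in> Hom (collapse R) Y Z" "h \<in> Hom (collapse R) Z W"
  then have f: "f \<in> Hom R X Y" and g: "g \<in> Hom R Y Z" and h: "h \<in> Hom R Z W"
    by (simp_all add: Hom_collapse)
  show "(h \<cdot>\<^bsub>collapse R\<^esub> g) \<cdot>\<^bsub>collapse R\<^esub> f = h \<cdot>\<^bsub>collapse R\<^esub> (g \<cdot>\<^bsub>collapse R\<^esub> f)"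
    using ecls_comp(1)[OF f comp_in[OF g h]] ecls_comp(2)[OF comp_in[OF f g] h]
      comp_assoc[OF f g h] by simp
qed

text \<open>
  Only the two functoriality axioms of reindexing mention identities and composites, which
  are replaced by names of their classes; there \<open>reidx_ecls\<close> undoes the replacement.
  All other axioms are instances of those of \<open>R\<close>.
\<close>

lemma relational_doctrine_collapse: "relational_doctrine (collapse R)"
proof (rule relational_doctrine.intro[OF category_collapse relational_doctrine_axioms.intro])
  show "reidx (collapse R) (Id (collapse R) X) (Id (collapse R) Y) \<alpha> = \<alpha>"
    if "X \<in> Ob (collapse R)" "Y \<in> Ob (collapse R)" "\<alpha> \<in> Rel (collapse R) X Y" for X Y \<alpha>
    using that reidx_ecls[OF id_in id_in] reidx_id by simp
  show "reidx (collapse R) (f \<cdot>\<^bsub>collapse R\<^esub> f') (g \<cdot>\<^bsub>collapse R\<^esub> g') \<alpha>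
      = reidx (collapse R) f' g' (reidx (collapse R) f g \<alpha>)"
    if "f \<in> Hom (collapse R) X A" "f' \<in> Hom (collapse R) X' X"
      "g \<in> Hom (collapse R) Y B" "g' \<in> Hom (collapse R) Y' Y" "\<alpha> \<in> Rel (collapse R) A B"
    for f f' g g' \<alpha> X A X' Y B Y'
    using that reidx_ecls[OF comp_in comp_in, of f' X' X f A g' Y' Y g B \<alpha>]
      reidx_comp[of f X A f' X' g Y B g' Y' \<alpha>] by (simp add: Hom_collapse)
qed (auto simp: Hom_collapse rle_refl rle_trans rle_antisym reidx_in reidx_mono diag_in diag_reidx
    rcomp_in rcomp_mono rcomp_reidx conv_in conv_mono conv_reidx rcomp_assoc rcomp_diag_left
    rcomp_diag_right conv_rcomp conv_diag conv_conv)

lemma approx_collapse: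
  "(f, g) \<in> approx (collapse R) \<longleftrightarrow> (f, g) \<in> approx R \<and> ecls R f = f \<and> ecls R g = g"
  by (auto simp: approx_def Hom_collapse)

lemma extensional_collapse: "extensional_doctrine (collapse R)"
  unfolding extensional_doctrine_def
proof (intro allI impI)
  fix f g assume "(f, g) \<in> approx (collapse R)"
  then have fg: "(f, g) \<in> approx R" "ecls R f = f" "ecls R g = g"
    by (simp_all add: approx_collapse)
  have "f \<in> Arr R" "g \<in> Arr R"
    using fg(1) by (auto simp: approx_def Hom_def)
  then show "f = g" using fg ecls_eq_iff by metis
qed

lemma graph_ecls:
  assumes f: "f \<in> Hom R X Y"
  shows "graph (collapse R) (ecls R f) = graph R f"
  using f ecls_Hom[OF f] reidx_ecls[OF f id_in diag_in] Hom_ob[OF f]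
  by (simp add: graph_def Hom_def)

lemma kernel_ecls: "f \<in> Hom R X Y \<Longrightarrow> kernel (collapse R) (ecls R f) = kernel R f"
  using ecls_Hom[of f] graph_ecls[of f] by (simp add: kernel_def Hom_def)

lemma descent_ecls: "f \<in> Hom R X Y \<Longrightarrow> descent (collapse R) (ecls R f) = descent R f"
  using ecls_Hom[of f] graph_ecls[of f] by (simp add: descent_def Hom_def)

lemma equiv_rel_collapse: "equiv_rel (collapse R) = equiv_rel R"
  by (intro ext) (simp add: equiv_rel_def)

text \<open>
  Kernels are the same in the collapse, so a factorization in \<open>R\<close> names one in the collapse. Two
  factorizations in the collapse give arrows of \<open>R\<close> that agree only up to \<open>\<approx>\<close> after
  \<open>q\<close>, so the universal property of \<open>q\<close> in \<open>R\<close> cannot identify them, but descent can.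
\<close>

lemma quotient_arrow_ecls_descent:
  assumes q: "quotient_arrow R X \<rho> q" and descent: "descent R q"
  shows "quotient_arrow (collapse R) X \<rho> (ecls R q)"
proof -
  let ?W = "Cod R q"
  have q': "q \<in> Hom R X ?W" using q by (simp add: quotient_arrow_def Hom_def)
  have c: "Cod R (ecls R q) = ?W" using ecls_Hom[OF q'] by (simp add: Hom_def)
  have "\<exists>!h. h \<in> Hom (collapse R) ?W Z \<and> f = h \<cdot>\<^bsub>collapse R\<^esub> ecls R q"
    if "f \<in> Hom (collapse R) X Z" and le: "rle R X X \<rho> (kernel (collapse R) f)" for f Z
  proof -
    have f: "f \<in> Hom R X Z" "ecls R f = f" using that by (simp_all add: Hom_collapse)
    have "rle R X X \<rho> (kernel R f)" using le kernel_ecls[OF f(1)] f(2) by simp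
    then obtain h where h: "h \<in> Hom R ?W Z" "f = h \<cdot> q"
      using q f(1) unfolding quotient_arrow_def by blast
    show ?thesis
    proof (rule ex1I[of _ "ecls R h"])
      have "ecls R (ecls R h \<cdot> ecls R q) = ecls R (h \<cdot> q)"
        using ecls_comp(1)[OF ecls_Hom[OF q'] h(1)] ecls_comp(2)[OF q' h(1)] by simp
      then show "ecls R h \<in> Hom (collapse R) ?W Z \<and> f = ecls R h \<cdot>\<^bsub>collapse R\<^esub> ecls R q"
        using f h ecls_Hom_collapse[OF h(1)] by simp
    next
      fix k assume "k \<in> Hom (collapse R) ?W Z \<and> f = k \<cdot>\<^bsub>collapse R\<^esub> ecls R q"
      then have k: "k \<in> Hom R ?W Z" "ecls R k = k" and fk: "f = ecls R (k \<cdot> ecls R q)"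
        by (simp_all add: Hom_collapse)
      have "ecls R (k \<cdot> q) = ecls R (h \<cdot> q)"
        using fk f h(2) ecls_comp(2)[OF q' k(1)] by simp
      then have "(k \<cdot> q, h \<cdot> q) \<in> approx R"
        using ecls_eq_iff HomD(1)[OF comp_in[OF q' k(1)]] HomD(1)[OF comp_in[OF q' h(1)]] by blast
      then have "(k, h) \<in> approx R"
        using descent_cancel[OF q' descent k(1) h(1)] by blast
      then show "k = ecls R h"
        using ecls_eq_iff[OF HomD(1)[OF k(1)] HomD(1)[OF h(1)]] k(2) by simp
    qed
  qed
  then show ?thesis
    using q kernel_ecls[OF q'] ecls_Hom_collapse[OF q'] c
    by (auto simp: quotient_arrow_def equiv_rel_collapse Hom_def)
qed

lemma has_quotients_collapse:
  assumes "has_quotients R"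
  shows "has_quotients (collapse R)"
  unfolding has_quotients_def equiv_rel_collapse
proof (intro allI impI)
  fix X \<rho> assume "equiv_rel R X \<rho>"
  then obtain q where q: "quotient_arrow R X \<rho> q" "effective R \<rho> q" "descent R q"
    using assms by (auto simp: has_quotients_def)
  have q': "q \<in> Hom R X (Cod R q)" using q by (simp add: quotient_arrow_def Hom_def)
  have "quotient_arrow (collapse R) X \<rho> (ecls R q) \<and> effective (collapse R) \<rho> (ecls R q)
      \<and> descent (collapse R) (ecls R q)"
    using quotient_arrow_ecls_descent[OF q(1,3)] q(2,3) kernel_ecls[OF q'] descent_ecls[OF q']
    by (simp add: effective_def)
  then show "\<exists>q. quotient_arrow (collapse R) X \<rho> q \<and> effective (collapse R) \<rho> q
      \<and> descent (collapse R) q" ..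
qed

lemma ecls_comp_ecls:
  assumes f: "f \<in> Hom R X Y" and g: "g \<in> Hom R Y Z"
  shows "ecls R (ecls R g \<cdot> ecls R f) = ecls R (g \<cdot> f)"
  using ecls_comp(1)[OF ecls_Hom[OF f] g] ecls_comp(2)[OF f g] by simp

lemma ecls_extensional:
  assumes "extensional_doctrine R" "f \<in> Arr R"
  shows "ecls R f = f"
  using ecls_approx[OF assms(2)] assms(1) unfolding extensional_doctrine_def by metis

end

section \<open>Composition of 1-arrows\<close>

lemma restrict_rel_apply:
  "X \<in> Ob R \<Longrightarrow> Y \<in> Ob R \<Longrightarrow> \<alpha> \<in> Rel R X Y \<Longrightarrow> restrict_rel R h X Y \<alpha> = h X Y \<alpha>"
  by (simp add: restrict_rel_def)

lemma restrict_rel_idem [simp]: "restrict_rel R (restrict_rel R h) = restrict_rel R h"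
  by (simp add: restrict_rel_def fun_eq_iff)

context rd_1arrow
begin

sublocale S: relational_doctrine "Src F" by (rule src)
sublocale T: relational_doctrine "Tgt F" by (rule tgt)

lemma FOb_in: "X \<in> Ob (Src F) \<Longrightarrow> FOb F X \<in> Ob (Tgt F)"
  using base_functor by (simp add: is_functor_def)

lemma FArr_in: "f \<in> Hom (Src F) X Y \<Longrightarrow> FArr F f \<in> Hom (Tgt F) (FOb F X) (FOb F Y)"
  using base_functor by (simp add: is_functor_def)

lemma FArr_id: "X \<in> Ob (Src F) \<Longrightarrow> FArr F (Id (Src F) X) = Id (Tgt F) (FOb F X)"
  using base_functor by (simp add: is_functor_def)

lemma FArr_comp: "f \<in> Hom (Src F) X Y \<Longrightarrow> g \<in> Hom (Src F) Y Z
    \<Longrightarrow> FArr F (g \<cdot>\<^bsub>Src F\<^esub> f) = FArr F g \<cdot>\<^bsub>Tgt F\<^esub> FArr F f"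
  using base_functor by (simp add: is_functor_def)

end

text \<open>
  The components of a 1-arrow are \<open>undefined\<close> off its source, so 1-arrows are equal as soon as
  they agree on objects, arrows and relations of the source. With \<open>rd_cell_eqI\<close>, the analogue
  for 2-arrows, every equation of cells below is checked on such elements.
\<close>

lemma rd_arr_eqI:
  assumes F: "rd_1arrow F" and G: "rd_1arrow G" and eq: "Src F = Src G" "Tgt F = Tgt G"
    and FOb: "\<And>X. X \<in> Ob (Src F) \<Longrightarrow> FOb F X = FOb G X"
    and FArr: "\<And>f. f \<in> Arr (Src F) \<Longrightarrow> FArr F f = FArr G f"
    and FRel: "\<And>X Y \<alpha>. X \<in> Ob (Src F) \<Longrightarrow> Y \<in> Ob (Src F) \<Longrightarrow> \<alpha> \<in> Rel (Src F) X Y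
      \<Longrightarrow> FRel F X Y \<alpha> = FRel G X Y \<alpha>"
  shows "F = G"
proof -
  have "FOb F = FOb G"
    using extensionalityI[OF rd_1arrow.FOb_ext[OF F], of "FOb G"] rd_1arrow.FOb_ext[OF G] FOb eq
    by simp
  moreover have "FArr F = FArr G"
    using extensionalityI[OF rd_1arrow.FArr_ext[OF F], of "FArr G"] rd_1arrow.FArr_ext[OF G] FArr eq
    by simp
  moreover have "restrict_rel (Src F) (FRel F) = restrict_rel (Src F) (FRel G)"
    using FRel by (auto simp: restrict_rel_def fun_eq_iff)
  then have "FRel F = FRel G"
    using rd_1arrow.FRel_ext[OF F] rd_1arrow.FRel_ext[OF G] eq by simp
  ultimately show ?thesis using eq by simp
qed

lemma rd_id_simps [simp]:
  "Src (rd_id R) = R" "Tgt (rd_id R) = R"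
  "X \<in> Ob R \<Longrightarrow> FOb (rd_id R) X = X" "f \<in> Arr R \<Longrightarrow> FArr (rd_id R) f = f"
  "X \<in> Ob R \<Longrightarrow> Y \<in> Ob R \<Longrightarrow> \<alpha> \<in> Rel R X Y \<Longrightarrow> FRel (rd_id R) X Y \<alpha> = \<alpha>"
  by (simp_all add: rd_id_def restrict_rel_apply)

lemma rd_comp_simps [simp]:
  "Src (rd_comp G F) = Src F" "Tgt (rd_comp G F) = Tgt G"
  "X \<in> Ob (Src F) \<Longrightarrow> FOb (rd_comp G F) X = FOb G (FOb F X)"
  "f \<in> Arr (Src F) \<Longrightarrow> FArr (rd_comp G F) f = FArr G (FArr F f)"
  "X \<in> Ob (Src F) \<Longrightarrow> Y \<in> Ob (Src F) \<Longrightarrow> \<alpha> \<in> Rel (Src F) X Y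
    \<Longrightarrow> FRel (rd_comp G F) X Y \<alpha> = FRel G (FOb F X) (FOb F Y) (FRel F X Y \<alpha>)"
  by (simp_all add: rd_comp_def compose_def restrict_rel_apply)

text \<open>
  Identities, units and counits have this form: the identity on objects and relations, and some
  functor on the base that is compatible with reindexing.
\<close>

lemma (in relational_doctrine) rd_1arrow_identity_on_relations:
  assumes S: "relational_doctrine S"
    and ob: "Ob S = Ob R" and Rel: "Rel S = Rel R" and ops: "rle S = rle R"
      "diag S = diag R" "rcomp S = rcomp R" "conv S = conv R"
    and h: "\<And>X Y f. f \<in> Hom R X Y \<Longrightarrow> h f \<in> Hom S X Y"
    and h_id: "\<And>X. X \<in> Ob R \<Longrightarrow> h (Id R X) = Id S X"
    and h_comp: "\<And>X Y Z f g. f \<in> Hom R X Y \<Longrightarrow> g \<in> Hom R Y Z \<Longrightarrow> h (g \<cdot> f) = h g \<cdot>\<^bsub>S\<^esub> h f"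
    and h_reidx: "\<And>X Y A B f g \<alpha>. f \<in> Hom R X A \<Longrightarrow> g \<in> Hom R Y B \<Longrightarrow> \<alpha> \<in> Rel R A B
      \<Longrightarrow> reidx R f g \<alpha> = reidx S (h f) (h g) \<alpha>"
  shows "rd_1arrow \<lparr> Src = R, Tgt = S, FOb = restrict (\<lambda>X. X) (Ob R),
    FArr = restrict h (Arr R), FRel = restrict_rel R (\<lambda>X Y \<alpha>. \<alpha>) \<rparr>"
proof (rule rd_1arrow.intro, unfold rd_arr.simps)
  interpret S: relational_doctrine S by (rule S)
  show "is_functor R S (restrict (\<lambda>X. X) (Ob R)) (restrict h (Arr R))"
    using category_axioms S.category_axioms ob h h_id h_comp
    by (auto simp: is_functor_def id_in[THEN HomD(1)] comp_in[THEN HomD(1)] dest: HomD(1) Hom_ob)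
  show "monotone_on (Rel R X Y) (rle R X Y)
      (rle S (restrict (\<lambda>X. X) (Ob R) X) (restrict (\<lambda>X. X) (Ob R) Y))
      (restrict_rel R (\<lambda>X Y \<alpha>. \<alpha>) X Y)" if "X \<in> Ob R" "Y \<in> Ob R" for X Y
    using that by (auto intro!: monotone_onI simp: restrict_rel_apply ops)
  show "restrict_rel R (\<lambda>X Y \<alpha>. \<alpha>) X Y (reidx R f g \<alpha>)
      = reidx S (restrict h (Arr R) f) (restrict h (Arr R) g)
          (restrict_rel R (\<lambda>X Y \<alpha>. \<alpha>) A B \<alpha>)"
    if f: "f \<in> Hom R X A" and g: "g \<in> Hom R Y B" and \<alpha>: "\<alpha> \<in> Rel R A B" for f g \<alpha> X Y A B
    using reidx_in[OF f g \<alpha>] h_reidx[OF f g \<alpha>] \<alpha> HomD(1)[OF f] HomD(1)[OF g] Hom_ob[OF f] Hom_ob[OF g]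
    by (simp add: restrict_rel_apply)
qed (simp_all add: restrict_rel_apply relational_doctrine_axioms S Rel ops diag_in rcomp_in conv_in)

lemma rd_1arrow_id:
  assumes "relational_doctrine R"
  shows "rd_1arrow (rd_id R)"
proof -
  interpret relational_doctrine R by fact
  show ?thesis
    unfolding rd_id_def using rd_1arrow_identity_on_relations[OF assms, of "\<lambda>f. f"] by simp
qed

lemma rd_1arrow_comp:
  assumes F: "rd_1arrow F" and G: "rd_1arrow G" and eq: "Tgt F = Src G"
  shows "rd_1arrow (rd_comp G F)"
proof -
  interpret F: rd_1arrow F by (rule F)
  interpret G: rd_1arrow G by (rule G)
  note F_in = F.FOb_in[unfolded eq] F.FArr_in[unfolded eq] F.FRel_in[unfolded eq]
  show ?thesis
  proof (rule rd_1arrow.intro, unfold rd_comp_simps(1,2))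
    show "is_functor (Src F) (Tgt G) (FOb (rd_comp G F)) (FArr (rd_comp G F))"
      unfolding is_functor_def
    proof (intro conjI allI ballI)
      fix X Y Z f g assume f: "f \<in> Hom (Src F) X Y" and g: "g \<in> Hom (Src F) Y Z"
      show "FArr (rd_comp G F) (g \<cdot>\<^bsub>Src F\<^esub> f)
          = FArr (rd_comp G F) g \<cdot>\<^bsub>Tgt G\<^esub> FArr (rd_comp G F) f"
        using F.FArr_comp[OF f g] G.FArr_comp[OF F_in(2)[OF f] F_in(2)[OF g]] eq
          HomD(1)[OF f] HomD(1)[OF g] HomD(1)[OF F.S.comp_in[OF f g]] by simp
    next
      fix X Y f assume f: "f \<in> Hom (Src F) X Y"
      show "FArr (rd_comp G F) f \<in> Hom (Tgt G) (FOb (rd_comp G F) X) (FOb (rd_comp G F) Y)"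
        using G.FArr_in[OF F_in(2)[OF f]] HomD(1)[OF f] F.S.Hom_ob[OF f] by simp
    qed (auto simp: F.S.category_axioms G.T.category_axioms F_in(1) G.FOb_in
        F.S.id_in[THEN HomD(1)] F.FArr_id G.FArr_id eq)
    show "monotone_on (Rel (Src F) X Y) (rle (Src F) X Y)
        (rle (Tgt G) (FOb (rd_comp G F) X) (FOb (rd_comp G F) Y)) (FRel (rd_comp G F) X Y)"
      if ob: "X \<in> Ob (Src F)" "Y \<in> Ob (Src F)" for X Y
    proof (rule monotone_onI)
      fix \<alpha> \<beta> assume ab: "\<alpha> \<in> Rel (Src F) X Y" "\<beta> \<in> Rel (Src F) X Y" "rle (Src F) X Y \<alpha> \<beta>"
      show "rle (Tgt G) (FOb (rd_comp G F) X) (FOb (rd_comp G F) Y)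
          (FRel (rd_comp G F) X Y \<alpha>) (FRel (rd_comp G F) X Y \<beta>)"
        using monotone_onD[OF F.FRel_mono[OF ob] ab] ob ab F_in(1)[OF ob(1)] F_in(1)[OF ob(2)] eq
          monotone_onD[OF G.FRel_mono[OF F_in(1)[OF ob(1)] F_in(1)[OF ob(2)]]
            F_in(3)[OF ob ab(1)] F_in(3)[OF ob ab(2)]] by simp
    qed
    show "FRel (rd_comp G F) X Y (reidx (Src F) f g \<alpha>)
        = reidx (Tgt G) (FArr (rd_comp G F) f) (FArr (rd_comp G F) g) (FRel (rd_comp G F) A B \<alpha>)"
      if f: "f \<in> Hom (Src F) X A" and g: "g \<in> Hom (Src F) Y B" and \<alpha>: "\<alpha> \<in> Rel (Src F) A B"
      for f X A g Y B \<alpha>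
    proof -
      note ob = F.S.Hom_ob[OF f] F.S.Hom_ob[OF g]
      show ?thesis
        using F.FRel_natural[OF f g \<alpha>] G.FRel_natural[OF F_in(2)[OF f] F_in(2)[OF g] F_in(3)[OF ob(2,4) \<alpha>]]
          F.S.reidx_in[OF f g \<alpha>] HomD(1)[OF f] HomD(1)[OF g] ob \<alpha> eq by simp
    qed
  qed (simp_all add: F.src G.tgt F_in G.FOb_in G.FRel_in F.S.diag_in F.S.rcomp_in F.S.conv_in
      F.FRel_diag F.FRel_rcomp F.FRel_conv G.FRel_diag G.FRel_rcomp G.FRel_conv eq,
      simp_all add: rd_comp_def compose_def)
qed

lemma rd_comp_id_right:
  assumes "rd_1arrow F"
  shows "rd_comp F (rd_id (Src F)) = F"
proof -
  interpret rd_1arrow F by fact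
  show ?thesis
    by (intro rd_arr_eqI) (simp_all add: assms rd_1arrow_comp rd_1arrow_id src)
qed

lemma rd_comp_id_left:
  assumes "rd_1arrow F"
  shows "rd_comp (rd_id (Tgt F)) F = F"
proof -
  interpret rd_1arrow F by fact
  show ?thesis
    using rd_1arrow_comp[OF assms rd_1arrow_id[OF tgt]]
    by (intro rd_arr_eqI) (auto simp: assms FOb_in FRel_in is_functor_arr[OF base_functor])
qed

lemma rd_comp_assoc:
  assumes F: "rd_1arrow F" and G: "rd_1arrow G" and H: "rd_1arrow H"
    and eq: "Tgt F = Src G" "Tgt G = Src H"
  shows "rd_comp (rd_comp H G) F = rd_comp H (rd_comp G F)"
proof -
  interpret F: rd_1arrow F by (rule F)
  note F_in = F.FOb_in F.FRel_in is_functor_arr[OF F.base_functor]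
  show ?thesis
    by (intro rd_arr_eqI) (simp_all add: rd_1arrow_comp F G H eq F_in[unfolded eq])
qed

lemma category_under_RD: "category (under RD)"
  by standard (auto simp: RD_def Hom_def rd_1arrow.src rd_1arrow.tgt rd_1arrow_id rd_1arrow_comp
      rd_comp_id_right rd_comp_id_left rd_comp_assoc)

section \<open>Vertical composition of 2-arrows\<close>

lemma rd_cell_eqI:
  assumes \<theta>: "rd_2arrow \<theta>" and \<phi>: "rd_2arrow \<phi>" and eq: "Src2 \<theta> = Src2 \<phi>" "Tgt2 \<theta> = Tgt2 \<phi>"
    and Cmp: "\<And>X. X \<in> Ob (Src (Src2 \<theta>)) \<Longrightarrow> Cmp \<theta> X = Cmp \<phi> X"
  shows "\<theta> = \<phi>"
proof -
  have "Cmp \<theta> = Cmp \<phi>"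
    using extensionalityI[OF rd_2arrow.Cmp_ext[OF \<theta>], of "Cmp \<phi>"] rd_2arrow.Cmp_ext[OF \<phi>] Cmp eq
    by simp
  then show ?thesis using eq by simp
qed

lemma rd_id2_simps [simp]:
  "Src2 (rd_id2 F) = F" "Tgt2 (rd_id2 F) = F"
  "X \<in> Ob (Src F) \<Longrightarrow> Cmp (rd_id2 F) X = Id (Tgt F) (FOb F X)"
  by (simp_all add: rd_id2_def)

lemma rd_vcomp_simps [simp]:
  "Src2 (rd_vcomp \<phi> \<theta>) = Src2 \<theta>" "Tgt2 (rd_vcomp \<phi> \<theta>) = Tgt2 \<phi>"
  "X \<in> Ob (Src (Src2 \<theta>)) \<Longrightarrow> Cmp (rd_vcomp \<phi> \<theta>) X = Cmp \<phi> X \<cdot>\<^bsub>Tgt (Src2 \<theta>)\<^esub> Cmp \<theta> X"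
  by (simp_all add: rd_vcomp_def)

lemma rd_hcomp_simps [simp]:
  "Src2 (rd_hcomp \<phi> \<theta>) = rd_comp (Src2 \<phi>) (Src2 \<theta>)"
  "Tgt2 (rd_hcomp \<phi> \<theta>) = rd_comp (Tgt2 \<phi>) (Tgt2 \<theta>)"
  "X \<in> Ob (Src (Src2 \<theta>)) \<Longrightarrow> Cmp (rd_hcomp \<phi> \<theta>) X
    = FArr (Tgt2 \<phi>) (Cmp \<theta> X) \<cdot>\<^bsub>Tgt (Src2 \<phi>)\<^esub> Cmp \<phi> (FOb (Src2 \<theta>) X)"
  by (simp_all add: rd_hcomp_def)

lemma rd_2arrow_id2:
  assumes "rd_1arrow F"
  shows "rd_2arrow (rd_id2 F)"
proof -
  interpret rd_1arrow F by (rule assms)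
  show ?thesis
  proof (rule rd_2arrow.intro, unfold rd_id2_simps(1,2))
    show "FArr F f \<cdot>\<^bsub>Tgt F\<^esub> Cmp (rd_id2 F) X = Cmp (rd_id2 F) Y \<cdot>\<^bsub>Tgt F\<^esub> FArr F f"
      if f: "f \<in> Hom (Src F) X Y" for f X Y
      using S.Hom_ob[OF f] FArr_in[OF f] by (simp add: T.comp_id_left T.comp_id_right)
  qed (auto simp: assms FOb_in T.id_in T.reidx_id FRel_in reflp_onD[OF T.rle_refl],
      simp add: rd_id2_def)
qed

lemma rd_2arrow_vcomp:
  assumes \<theta>: "rd_2arrow \<theta>" and \<phi>: "rd_2arrow \<phi>" and eq: "Tgt2 \<theta> = Src2 \<phi>"
  shows "rd_2arrow (rd_vcomp \<phi> \<theta>)"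
proof -
  interpret F: rd_1arrow "Src2 \<theta>" by (rule rd_2arrow.src2[OF \<theta>])
  interpret H: rd_1arrow "Tgt2 \<phi>" by (rule rd_2arrow.tgt2[OF \<phi>])
  interpret G: rd_1arrow "Tgt2 \<theta>" by (rule rd_2arrow.tgt2[OF \<theta>])
  let ?R = "Src (Src2 \<theta>)" and ?S = "Tgt (Src2 \<theta>)"
  note par = rd_2arrow.parallel[OF \<theta>] rd_2arrow.parallel[OF \<phi>, folded eq]
  note \<theta>_in = rd_2arrow.Cmp_in[OF \<theta>]
  have \<phi>_in: "Cmp \<phi> X \<in> Hom ?S (FOb (Tgt2 \<theta>) X) (FOb (Tgt2 \<phi>) X)" if "X \<in> Ob ?R" for X
    using rd_2arrow.Cmp_in[OF \<phi>] that par by (simp add: eq)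
  note G_in = G.FArr_in[unfolded par] G.FRel_in[unfolded par] G.FOb_in[unfolded par]
  note H_in = H.FArr_in[unfolded par] H.FRel_in[unfolded par] H.FOb_in[unfolded par]
  show ?thesis
  proof (rule rd_2arrow.intro, unfold rd_vcomp_simps(1,2))
    show "FArr (Tgt2 \<phi>) f \<cdot>\<^bsub>?S\<^esub> Cmp (rd_vcomp \<phi> \<theta>) X
        = Cmp (rd_vcomp \<phi> \<theta>) Y \<cdot>\<^bsub>?S\<^esub> FArr (Src2 \<theta>) f"
      if f: "f \<in> Hom ?R X Y" for f X Y
    proof -
      note ob = F.S.Hom_ob[OF f]
      have "FArr (Tgt2 \<phi>) f \<cdot>\<^bsub>?S\<^esub> (Cmp \<phi> X \<cdot>\<^bsub>?S\<^esub> Cmp \<theta> X)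
          = (Cmp \<phi> Y \<cdot>\<^bsub>?S\<^esub> FArr (Tgt2 \<theta>) f) \<cdot>\<^bsub>?S\<^esub> Cmp \<theta> X"
        using F.T.comp_assoc[OF \<theta>_in[OF ob(1)] \<phi>_in[OF ob(1)] H_in(1)[OF f]]
          rd_2arrow.Cmp_natural[OF \<phi>, of f X Y] par f by (simp add: eq)
      also have "\<dots> = Cmp \<phi> Y \<cdot>\<^bsub>?S\<^esub> (Cmp \<theta> Y \<cdot>\<^bsub>?S\<^esub> FArr (Src2 \<theta>) f)"
        using F.T.comp_assoc[OF \<theta>_in[OF ob(1)] G_in(1)[OF f] \<phi>_in[OF ob(2)]]
          rd_2arrow.Cmp_natural[OF \<theta> f] by simp
      also have "\<dots> = (Cmp \<phi> Y \<cdot>\<^bsub>?S\<^esub> Cmp \<theta> Y) \<cdot>\<^bsub>?S\<^esub> FArr (Src2 \<theta>) f"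
        using F.T.comp_assoc[OF F.FArr_in[OF f] \<theta>_in[OF ob(2)] \<phi>_in[OF ob(2)]] by simp
      finally show ?thesis using ob by simp
    qed
    show "rle ?S (FOb (Src2 \<theta>) X) (FOb (Src2 \<theta>) Y) (FRel (Src2 \<theta>) X Y \<alpha>)
        (reidx ?S (Cmp (rd_vcomp \<phi> \<theta>) X) (Cmp (rd_vcomp \<phi> \<theta>) Y) (FRel (Tgt2 \<phi>) X Y \<alpha>))"
      if ob: "X \<in> Ob ?R" "Y \<in> Ob ?R" and \<alpha>: "\<alpha> \<in> Rel ?R X Y" for X Y \<alpha>
    proof -
      note \<theta>X = \<theta>_in[OF ob(1)] and \<theta>Y = \<theta>_in[OF ob(2)]
      note \<phi>X = \<phi>_in[OF ob(1)] and \<phi>Y = \<phi>_in[OF ob(2)]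
      note H\<alpha> = H_in(2)[OF ob \<alpha>] and G\<alpha> = G_in(2)[OF ob \<alpha>]
      note r = F.T.reidx_in[OF \<phi>X \<phi>Y H\<alpha>]
      have "rle ?S (FOb (Tgt2 \<theta>) X) (FOb (Tgt2 \<theta>) Y) (FRel (Tgt2 \<theta>) X Y \<alpha>)
          (reidx ?S (Cmp \<phi> X) (Cmp \<phi> Y) (FRel (Tgt2 \<phi>) X Y \<alpha>))"
        using rd_2arrow.Cmp_rle[OF \<phi>, of X Y \<alpha>] ob \<alpha> par by (simp add: eq)
      from F.T.reidx_le[OF \<theta>X \<theta>Y G\<alpha> r this]
      have "rle ?S (FOb (Src2 \<theta>) X) (FOb (Src2 \<theta>) Y)
          (reidx ?S (Cmp \<theta> X) (Cmp \<theta> Y) (FRel (Tgt2 \<theta>) X Y \<alpha>))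
          (reidx ?S (Cmp (rd_vcomp \<phi> \<theta>) X) (Cmp (rd_vcomp \<phi> \<theta>) Y) (FRel (Tgt2 \<phi>) X Y \<alpha>))"
        using F.T.reidx_comp[OF \<phi>X \<theta>X \<phi>Y \<theta>Y H\<alpha>] ob by simp
      from F.T.rle_tr[OF _ _ rd_2arrow.Cmp_rle[OF \<theta> ob \<alpha>] this]
      show ?thesis
        using ob F.FRel_in[OF ob \<alpha>] F.FOb_in F.T.reidx_in[OF \<theta>X \<theta>Y G\<alpha>]
          F.T.reidx_in[OF F.T.comp_in[OF \<theta>X \<phi>X] F.T.comp_in[OF \<theta>Y \<phi>Y] H\<alpha>] by simp
    qed
    show "Cmp (rd_vcomp \<phi> \<theta>) X \<in> Hom ?S (FOb (Src2 \<theta>) X) (FOb (Tgt2 \<phi>) X)" if "X \<in> Ob ?R" for X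
      using F.T.comp_in[OF \<theta>_in[OF that] \<phi>_in[OF that]] that by simp
  qed (simp_all add: F.rd_1arrow_axioms H.rd_1arrow_axioms par, simp add: rd_vcomp_def)
qed

lemma rd_vcomp_id_right:
  assumes \<theta>: "rd_2arrow \<theta>"
  shows "rd_vcomp \<theta> (rd_id2 (Src2 \<theta>)) = \<theta>"
proof -
  interpret F: rd_1arrow "Src2 \<theta>" by (rule rd_2arrow.src2[OF \<theta>])
  show ?thesis
    using rd_2arrow_vcomp[OF rd_2arrow_id2 \<theta>] F.rd_1arrow_axioms
      F.T.comp_id_right[OF rd_2arrow.Cmp_in[OF \<theta>]]
    by (intro rd_cell_eqI) (simp_all add: \<theta>)
qed

lemma rd_vcomp_id_left:
  assumes \<theta>: "rd_2arrow \<theta>"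
  shows "rd_vcomp (rd_id2 (Tgt2 \<theta>)) \<theta> = \<theta>"
proof -
  interpret F: rd_1arrow "Src2 \<theta>" by (rule rd_2arrow.src2[OF \<theta>])
  interpret G: rd_1arrow "Tgt2 \<theta>" by (rule rd_2arrow.tgt2[OF \<theta>])
  show ?thesis
    using rd_2arrow_vcomp[OF \<theta> rd_2arrow_id2] G.rd_1arrow_axioms rd_2arrow.parallel[OF \<theta>]
      F.T.comp_id_left[OF rd_2arrow.Cmp_in[OF \<theta>]]
    by (intro rd_cell_eqI) (simp_all add: \<theta>)
qed

lemma rd_vcomp_assoc:
  assumes \<theta>: "rd_2arrow \<theta>" and \<phi>: "rd_2arrow \<phi>" and \<psi>: "rd_2arrow \<psi>"
    and eq: "Tgt2 \<theta> = Src2 \<phi>" "Tgt2 \<phi> = Src2 \<psi>"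
  shows "rd_vcomp (rd_vcomp \<psi> \<phi>) \<theta> = rd_vcomp \<psi> (rd_vcomp \<phi> \<theta>)"
proof (rule rd_cell_eqI)
  interpret F: rd_1arrow "Src2 \<theta>" by (rule rd_2arrow.src2[OF \<theta>])
  note par = rd_2arrow.parallel[OF \<theta>] rd_2arrow.parallel[OF \<phi>] rd_2arrow.parallel[OF \<psi>]
  show "rd_2arrow (rd_vcomp (rd_vcomp \<psi> \<phi>) \<theta>)" "rd_2arrow (rd_vcomp \<psi> (rd_vcomp \<phi> \<theta>))"
    by (simp_all add: rd_2arrow_vcomp \<theta> \<phi> \<psi> eq)
  fix X assume "X \<in> Ob (Src (Src2 (rd_vcomp (rd_vcomp \<psi> \<phi>) \<theta>)))"
  then show "Cmp (rd_vcomp (rd_vcomp \<psi> \<phi>) \<theta>) X = Cmp (rd_vcomp \<psi> (rd_vcomp \<phi> \<theta>)) X"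
    using F.T.comp_assoc[OF rd_2arrow.Cmp_in[OF \<theta>], of X "Cmp \<phi> X" "FOb (Tgt2 \<phi>) X"
        "Cmp \<psi> X" "FOb (Tgt2 \<psi>) X"] rd_2arrow.Cmp_in[OF \<phi>, of X] rd_2arrow.Cmp_in[OF \<psi>, of X]
      par eq by simp
qed simp_all

lemma category_vert_RD: "category (vert RD)"
  by standard (auto simp: RD_def Hom_def rd_2arrow.src2 rd_2arrow.tgt2 rd_2arrow_id2 rd_2arrow_vcomp
      rd_vcomp_id_right rd_vcomp_id_left rd_vcomp_assoc)

section \<open>Horizontal composition of 2-arrows\<close>

text \<open>
  Naturality is checked by sliding first \<open>\<theta>\<close>, inside the functor \<open>Tgt2 \<phi>\<close>, and then \<open>\<phi>\<close> across.
  The inequality on relations combines that of \<open>\<phi>\<close> at \<open>FRel (Src2 \<theta>) X Y \<alpha>\<close> with the image under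
  \<open>Tgt2 \<phi>\<close> of that of \<open>\<theta>\<close>.
\<close>

lemma rd_2arrow_hcomp:
  assumes \<theta>: "rd_2arrow \<theta>" and \<phi>: "rd_2arrow \<phi>" and eq: "Tgt (Src2 \<theta>) = Src (Src2 \<phi>)"
  shows "rd_2arrow (rd_hcomp \<phi> \<theta>)"
proof -
  interpret F: rd_1arrow "Src2 \<theta>" by (rule rd_2arrow.src2[OF \<theta>])
  interpret F': rd_1arrow "Tgt2 \<theta>" by (rule rd_2arrow.tgt2[OF \<theta>])
  interpret G: rd_1arrow "Src2 \<phi>" by (rule rd_2arrow.src2[OF \<phi>])
  interpret G': rd_1arrow "Tgt2 \<phi>" by (rule rd_2arrow.tgt2[OF \<phi>])
  let ?F = "Src2 \<theta>" and ?F' = "Tgt2 \<theta>" and ?G = "Src2 \<phi>" and ?G' = "Tgt2 \<phi>"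
  let ?R = "Src ?F" and ?S = "Src ?G" and ?T = "Tgt ?G"
  note par = rd_2arrow.parallel[OF \<theta>] rd_2arrow.parallel[OF \<phi>]
  note F_in = F.FArr_in[unfolded eq] F.FRel_in[unfolded eq] F.FOb_in[unfolded eq]
  note F'_in = F'.FArr_in[unfolded par eq] F'.FRel_in[unfolded par eq] F'.FOb_in[unfolded par eq]
  note G'_in = G'.FArr_in[unfolded par] G'.FRel_in[unfolded par] G'.FOb_in[unfolded par]
  note \<theta>_in = rd_2arrow.Cmp_in[OF \<theta>, unfolded eq]
  note \<phi>_in = rd_2arrow.Cmp_in[OF \<phi>]
  note nat\<theta> = rd_2arrow.Cmp_natural[OF \<theta>, unfolded eq] and nat\<phi> = rd_2arrow.Cmp_natural[OF \<phi>]
  show ?thesis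
  proof (rule rd_2arrow.intro, unfold rd_hcomp_simps(1,2) rd_comp_simps(1,2))
    show "rd_1arrow (rd_comp ?G ?F)" "rd_1arrow (rd_comp ?G' ?F')"
      using rd_1arrow_comp[OF F.rd_1arrow_axioms G.rd_1arrow_axioms]
        rd_1arrow_comp[OF F'.rd_1arrow_axioms G'.rd_1arrow_axioms] eq par by simp_all
    show "Src ?F' = ?R" "Tgt ?G' = ?T" by (simp_all add: par)
    show "Cmp (rd_hcomp \<phi> \<theta>) \<in> extensional (Ob ?R)" by (simp add: rd_hcomp_def)
    show "Cmp (rd_hcomp \<phi> \<theta>) X \<in> Hom ?T (FOb (rd_comp ?G ?F) X) (FOb (rd_comp ?G' ?F') X)"
      if X: "X \<in> Ob ?R" for X
      using G.T.comp_in[OF \<phi>_in[OF F_in(3)[OF X]] G'_in(1)[OF \<theta>_in[OF X]]] X by (simp add: par)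
    show "FArr (rd_comp ?G' ?F') f \<cdot>\<^bsub>?T\<^esub> Cmp (rd_hcomp \<phi> \<theta>) X
        = Cmp (rd_hcomp \<phi> \<theta>) Y \<cdot>\<^bsub>?T\<^esub> FArr (rd_comp ?G ?F) f"
      if f: "f \<in> Hom ?R X Y" for f X Y
    proof -
      note ob = F.S.Hom_ob[OF f]
      note \<theta>X = \<theta>_in[OF ob(1)] and \<theta>Y = \<theta>_in[OF ob(2)]
      note \<phi>X = \<phi>_in[OF F_in(3)[OF ob(1)]] and \<phi>Y = \<phi>_in[OF F_in(3)[OF ob(2)]]
      note Ff = F_in(1)[OF f] and F'f = F'_in(1)[OF f]
      have "FArr ?G' (FArr ?F' f) \<cdot>\<^bsub>?T\<^esub> (FArr ?G' (Cmp \<theta> X) \<cdot>\<^bsub>?T\<^esub> Cmp \<phi> (FOb ?F X))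
          = FArr ?G' (FArr ?F' f \<cdot>\<^bsub>?S\<^esub> Cmp \<theta> X) \<cdot>\<^bsub>?T\<^esub> Cmp \<phi> (FOb ?F X)"
        using G.T.comp_assoc[OF \<phi>X G'_in(1)[OF \<theta>X] G'_in(1)[OF F'f]]
          G'.FArr_comp[unfolded par, OF \<theta>X F'f] by simp
      also have "\<dots> = FArr ?G' (Cmp \<theta> Y) \<cdot>\<^bsub>?T\<^esub> (FArr ?G' (FArr ?F f) \<cdot>\<^bsub>?T\<^esub> Cmp \<phi> (FOb ?F X))"
        using nat\<theta>[OF f] G.T.comp_assoc[OF \<phi>X G'_in(1)[OF Ff] G'_in(1)[OF \<theta>Y]]
          G'.FArr_comp[unfolded par, OF Ff \<theta>Y] by simp
      also have "\<dots> = (FArr ?G' (Cmp \<theta> Y) \<cdot>\<^bsub>?T\<^esub> Cmp \<phi> (FOb ?F Y)) \<cdot>\<^bsub>?T\<^esub> FArr ?G (FArr ?F f)"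
        using nat\<phi>[OF Ff] G.T.comp_assoc[OF G.FArr_in[OF Ff] \<phi>Y G'_in(1)[OF \<theta>Y]] by simp
      finally show ?thesis using ob HomD(1)[OF f] by (simp add: par)
    qed
    show "rle ?T (FOb (rd_comp ?G ?F) X) (FOb (rd_comp ?G ?F) Y) (FRel (rd_comp ?G ?F) X Y \<alpha>)
        (reidx ?T (Cmp (rd_hcomp \<phi> \<theta>) X) (Cmp (rd_hcomp \<phi> \<theta>) Y) (FRel (rd_comp ?G' ?F') X Y \<alpha>))"
      if ob: "X \<in> Ob ?R" "Y \<in> Ob ?R" and \<alpha>: "\<alpha> \<in> Rel ?R X Y" for X Y \<alpha>
    proof -
      note \<theta>X = \<theta>_in[OF ob(1)] and \<theta>Y = \<theta>_in[OF ob(2)]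
      note FX = F_in(3)[OF ob(1)] and FY = F_in(3)[OF ob(2)]
      note \<phi>X = \<phi>_in[OF FX] and \<phi>Y = \<phi>_in[OF FY]
      note G\<theta>X = G'_in(1)[OF \<theta>X] and G\<theta>Y = G'_in(1)[OF \<theta>Y]
      note F\<alpha> = F_in(2)[OF ob \<alpha>] and F'\<alpha> = F'_in(2)[OF ob \<alpha>]
      note r\<theta> = G.S.reidx_in[OF \<theta>X \<theta>Y F'\<alpha>]
      have G'F'\<alpha>: "FRel ?G' (FOb ?F' X) (FOb ?F' Y) (FRel ?F' X Y \<alpha>)
          \<in> Rel ?T (FOb ?G' (FOb ?F' X)) (FOb ?G' (FOb ?F' Y))"
        using G'_in(2)[OF _ _ F'\<alpha>] G.S.Hom_ob[OF \<theta>X] G.S.Hom_ob[OF \<theta>Y] by simp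
      note G'F\<alpha> = G'_in(2)[OF FX FY F\<alpha>]
      have "rle ?T (FOb ?G' (FOb ?F X)) (FOb ?G' (FOb ?F Y))
          (FRel ?G' (FOb ?F X) (FOb ?F Y) (FRel ?F X Y \<alpha>))
          (FRel ?G' (FOb ?F X) (FOb ?F Y) (reidx ?S (Cmp \<theta> X) (Cmp \<theta> Y) (FRel ?F' X Y \<alpha>)))"
        using monotone_onD[OF G'.FRel_mono[unfolded par, OF FX FY] F\<alpha> r\<theta>]
          rd_2arrow.Cmp_rle[OF \<theta> ob \<alpha>] eq by simp
      then have "rle ?T (FOb ?G' (FOb ?F X)) (FOb ?G' (FOb ?F Y))
          (FRel ?G' (FOb ?F X) (FOb ?F Y) (FRel ?F X Y \<alpha>))
          (reidx ?T (FArr ?G' (Cmp \<theta> X)) (FArr ?G' (Cmp \<theta> Y))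
            (FRel ?G' (FOb ?F' X) (FOb ?F' Y) (FRel ?F' X Y \<alpha>)))"
        using G'.FRel_natural[unfolded par, OF \<theta>X \<theta>Y F'\<alpha>] by simp
      from G.T.reidx_le[OF \<phi>X \<phi>Y G'F\<alpha> G.T.reidx_in[OF G\<theta>X G\<theta>Y G'F'\<alpha>] this]
      have 1: "rle ?T (FOb ?G (FOb ?F X)) (FOb ?G (FOb ?F Y))
          (reidx ?T (Cmp \<phi> (FOb ?F X)) (Cmp \<phi> (FOb ?F Y))
            (FRel ?G' (FOb ?F X) (FOb ?F Y) (FRel ?F X Y \<alpha>)))
          (reidx ?T (FArr ?G' (Cmp \<theta> X) \<cdot>\<^bsub>?T\<^esub> Cmp \<phi> (FOb ?F X))
            (FArr ?G' (Cmp \<theta> Y) \<cdot>\<^bsub>?T\<^esub> Cmp \<phi> (FOb ?F Y))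
            (FRel ?G' (FOb ?F' X) (FOb ?F' Y) (FRel ?F' X Y \<alpha>)))"
        using G.T.reidx_comp[OF G\<theta>X \<phi>X G\<theta>Y \<phi>Y G'F'\<alpha>] by simp
      from G.T.rle_tr[OF G.FOb_in[OF FX] G.FOb_in[OF FY] rd_2arrow.Cmp_rle[OF \<phi> FX FY F\<alpha>] 1
          G.FRel_in[OF FX FY F\<alpha>] G.T.reidx_in[OF \<phi>X \<phi>Y G'F\<alpha>]
          G.T.reidx_in[OF G.T.comp_in[OF \<phi>X G\<theta>X] G.T.comp_in[OF \<phi>Y G\<theta>Y] G'F'\<alpha>]]
      show ?thesis using ob \<alpha> by (simp add: par)
    qed
  qed
qed

lemma rd_hcomp_id_right:
  assumes \<theta>: "rd_2arrow \<theta>"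
  shows "rd_hcomp \<theta> (rd_id2 (rd_id (Src (Src2 \<theta>)))) = \<theta>"
proof -
  interpret F: rd_1arrow "Src2 \<theta>" by (rule rd_2arrow.src2[OF \<theta>])
  interpret G: rd_1arrow "Tgt2 \<theta>" by (rule rd_2arrow.tgt2[OF \<theta>])
  note par = rd_2arrow.parallel[OF \<theta>]
  have 1: "rd_2arrow (rd_hcomp \<theta> (rd_id2 (rd_id (Src (Src2 \<theta>)))))"
    using rd_2arrow_hcomp[OF rd_2arrow_id2[OF rd_1arrow_id[OF F.src]] \<theta>] by simp
  show ?thesis
  proof (rule rd_cell_eqI[OF 1 \<theta>])
    fix X assume "X \<in> Ob (Src (Src2 (rd_hcomp \<theta> (rd_id2 (rd_id (Src (Src2 \<theta>)))))))"
    then have X: "X \<in> Ob (Src (Src2 \<theta>))" by simp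
    then show "Cmp (rd_hcomp \<theta> (rd_id2 (rd_id (Src (Src2 \<theta>))))) X = Cmp \<theta> X"
      using F.T.comp_id_left[OF rd_2arrow.Cmp_in[OF \<theta> X]] G.FArr_id[of X] by (simp add: par)
  qed (use rd_comp_id_right[OF F.rd_1arrow_axioms] rd_comp_id_right[OF G.rd_1arrow_axioms]
      in \<open>simp_all add: par\<close>)
qed

lemma rd_hcomp_id_left:
  assumes \<theta>: "rd_2arrow \<theta>"
  shows "rd_hcomp (rd_id2 (rd_id (Tgt (Src2 \<theta>)))) \<theta> = \<theta>"
proof -
  interpret F: rd_1arrow "Src2 \<theta>" by (rule rd_2arrow.src2[OF \<theta>])
  interpret G: rd_1arrow "Tgt2 \<theta>" by (rule rd_2arrow.tgt2[OF \<theta>])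
  note par = rd_2arrow.parallel[OF \<theta>]
  have 1: "rd_2arrow (rd_hcomp (rd_id2 (rd_id (Tgt (Src2 \<theta>)))) \<theta>)"
    using rd_2arrow_hcomp[OF \<theta> rd_2arrow_id2[OF rd_1arrow_id[OF F.tgt]]] by simp
  show ?thesis
  proof (rule rd_cell_eqI[OF 1 \<theta>])
    fix X assume "X \<in> Ob (Src (Src2 (rd_hcomp (rd_id2 (rd_id (Tgt (Src2 \<theta>)))) \<theta>)))"
    then have X: "X \<in> Ob (Src (Src2 \<theta>))" by simp
    then show "Cmp (rd_hcomp (rd_id2 (rd_id (Tgt (Src2 \<theta>)))) \<theta>) X = Cmp \<theta> X"
      using F.T.comp_id_right[OF rd_2arrow.Cmp_in[OF \<theta> X]] HomD(1)[OF rd_2arrow.Cmp_in[OF \<theta> X]]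
        F.FOb_in[OF X] by simp
  qed (use rd_comp_id_left[OF F.rd_1arrow_axioms] rd_comp_id_left[OF G.rd_1arrow_axioms]
      in \<open>simp_all add: par\<close>)
qed

lemma rd_hcomp_assoc:
  assumes \<theta>: "rd_2arrow \<theta>" and \<phi>: "rd_2arrow \<phi>" and \<psi>: "rd_2arrow \<psi>"
    and eq: "Tgt (Src2 \<theta>) = Src (Src2 \<phi>)" "Tgt (Src2 \<phi>) = Src (Src2 \<psi>)"
  shows "rd_hcomp (rd_hcomp \<psi> \<phi>) \<theta> = rd_hcomp \<psi> (rd_hcomp \<phi> \<theta>)"
proof (rule rd_cell_eqI)
  interpret F: rd_1arrow "Src2 \<theta>" by (rule rd_2arrow.src2[OF \<theta>])
  interpret F': rd_1arrow "Tgt2 \<theta>" by (rule rd_2arrow.tgt2[OF \<theta>])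
  interpret G: rd_1arrow "Src2 \<phi>" by (rule rd_2arrow.src2[OF \<phi>])
  interpret G': rd_1arrow "Tgt2 \<phi>" by (rule rd_2arrow.tgt2[OF \<phi>])
  interpret H: rd_1arrow "Src2 \<psi>" by (rule rd_2arrow.src2[OF \<psi>])
  interpret H': rd_1arrow "Tgt2 \<psi>" by (rule rd_2arrow.tgt2[OF \<psi>])
  note par = rd_2arrow.parallel[OF \<theta>] rd_2arrow.parallel[OF \<phi>] rd_2arrow.parallel[OF \<psi>]
  show "rd_2arrow (rd_hcomp (rd_hcomp \<psi> \<phi>) \<theta>)" "rd_2arrow (rd_hcomp \<psi> (rd_hcomp \<phi> \<theta>))"
    by (simp_all add: rd_2arrow_hcomp \<theta> \<phi> \<psi> eq)
  show "Src2 (rd_hcomp (rd_hcomp \<psi> \<phi>) \<theta>) = Src2 (rd_hcomp \<psi> (rd_hcomp \<phi> \<theta>))"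
    "Tgt2 (rd_hcomp (rd_hcomp \<psi> \<phi>) \<theta>) = Tgt2 (rd_hcomp \<psi> (rd_hcomp \<phi> \<theta>))"
    by (simp_all add: rd_comp_assoc F.rd_1arrow_axioms F'.rd_1arrow_axioms G.rd_1arrow_axioms
        G'.rd_1arrow_axioms H.rd_1arrow_axioms H'.rd_1arrow_axioms eq par)
  fix X assume "X \<in> Ob (Src (Src2 (rd_hcomp (rd_hcomp \<psi> \<phi>) \<theta>)))"
  then have X: "X \<in> Ob (Src (Src2 \<theta>))" by simp
  note FX = F.FOb_in[OF X, unfolded eq]
  note \<theta>X = rd_2arrow.Cmp_in[OF \<theta> X, unfolded eq] and \<phi>X = rd_2arrow.Cmp_in[OF \<phi> FX, unfolded eq]
  note \<psi>X = rd_2arrow.Cmp_in[OF \<psi> G.FOb_in[OF FX, unfolded eq]]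
  note G'\<theta>X = G'.FArr_in[unfolded par eq, OF \<theta>X]
  show "Cmp (rd_hcomp (rd_hcomp \<psi> \<phi>) \<theta>) X = Cmp (rd_hcomp \<psi> (rd_hcomp \<phi> \<theta>)) X"
    using X FX HomD(1)[OF \<theta>X] H'.FArr_comp[unfolded par, OF \<phi>X G'\<theta>X]
      H.T.comp_assoc[OF \<psi>X H'.FArr_in[unfolded par, OF \<phi>X] H'.FArr_in[unfolded par, OF G'\<theta>X]]
    by (simp add: par eq)
qed

lemma rd_hcomp_id2:
  assumes F: "rd_1arrow F" and G: "rd_1arrow G" and eq: "Tgt F = Src G"
  shows "rd_hcomp (rd_id2 G) (rd_id2 F) = rd_id2 (rd_comp G F)"
proof (rule rd_cell_eqI)
  interpret F: rd_1arrow F by (rule F)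
  interpret G: rd_1arrow G by (rule G)
  show "rd_2arrow (rd_hcomp (rd_id2 G) (rd_id2 F))" "rd_2arrow (rd_id2 (rd_comp G F))"
    by (simp_all add: rd_2arrow_hcomp rd_2arrow_id2 rd_1arrow_comp F G eq)
  fix X assume "X \<in> Ob (Src (Src2 (rd_hcomp (rd_id2 G) (rd_id2 F))))"
  then have X: "X \<in> Ob (Src F)" by simp
  note FX = F.FOb_in[OF X, unfolded eq]
  show "Cmp (rd_hcomp (rd_id2 G) (rd_id2 F)) X = Cmp (rd_id2 (rd_comp G F)) X"
    using X FX G.FArr_id[OF FX] G.T.comp_id_left[OF G.T.id_in[OF G.FOb_in[OF FX]]] eq by simp
qed simp_all

text \<open>
  Both sides are composites of four components; they differ by the naturality square of \<open>\<phi>'\<close> at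
  the component of \<open>\<theta>\<close>.
\<close>

lemma rd_interchange:
  assumes \<theta>: "rd_2arrow \<theta>" and \<theta>': "rd_2arrow \<theta>'" and \<phi>: "rd_2arrow \<phi>" and \<phi>': "rd_2arrow \<phi>'"
    and eq: "Tgt2 \<theta> = Src2 \<theta>'" "Tgt2 \<phi> = Src2 \<phi>'" "Tgt (Src2 \<theta>) = Src (Src2 \<phi>)"
  shows "rd_hcomp (rd_vcomp \<phi>' \<phi>) (rd_vcomp \<theta>' \<theta>) = rd_vcomp (rd_hcomp \<phi>' \<theta>') (rd_hcomp \<phi> \<theta>)"
proof (rule rd_cell_eqI)
  interpret F: rd_1arrow "Src2 \<theta>" by (rule rd_2arrow.src2[OF \<theta>])
  interpret G: rd_1arrow "Src2 \<phi>" by (rule rd_2arrow.src2[OF \<phi>])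
  interpret G': rd_1arrow "Src2 \<phi>'" by (rule rd_2arrow.src2[OF \<phi>'])
  interpret G'': rd_1arrow "Tgt2 \<phi>'" by (rule rd_2arrow.tgt2[OF \<phi>'])
  note par = rd_2arrow.parallel[OF \<theta>, unfolded eq] rd_2arrow.parallel[OF \<phi>, unfolded eq]
    rd_2arrow.parallel[OF \<theta>'] rd_2arrow.parallel[OF \<phi>']
  show "rd_2arrow (rd_hcomp (rd_vcomp \<phi>' \<phi>) (rd_vcomp \<theta>' \<theta>))"
    "rd_2arrow (rd_vcomp (rd_hcomp \<phi>' \<theta>') (rd_hcomp \<phi> \<theta>))"
    by (simp_all add: rd_2arrow_hcomp rd_2arrow_vcomp assms par)
  fix X assume "X \<in> Ob (Src (Src2 (rd_hcomp (rd_vcomp \<phi>' \<phi>) (rd_vcomp \<theta>' \<theta>))))"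
  then have X: "X \<in> Ob (Src (Src2 \<theta>))" by simp
  let ?S = "Src (Src2 \<phi>)" and ?T = "Tgt (Src2 \<phi>)"
  let ?F = "Src2 \<theta>" and ?F' = "Src2 \<theta>'" and ?F'' = "Tgt2 \<theta>'"
  let ?G' = "Src2 \<phi>'" and ?G'' = "Tgt2 \<phi>'"
  note FX = F.FOb_in[OF X, unfolded eq]
  have \<theta>X: "Cmp \<theta> X \<in> Hom ?S (FOb ?F X) (FOb ?F' X)"
    using rd_2arrow.Cmp_in[OF \<theta> X] eq by simp
  have \<theta>'X: "Cmp \<theta>' X \<in> Hom ?S (FOb ?F' X) (FOb ?F'' X)"
    using rd_2arrow.Cmp_in[OF \<theta>', of X] X par by simp
  note F'X = G.S.Hom_ob(2)[OF \<theta>X]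
  have \<phi>X: "Cmp \<phi> (FOb ?F X) \<in> Hom ?T (FOb (Src2 \<phi>) (FOb ?F X)) (FOb ?G' (FOb ?F X))"
    using rd_2arrow.Cmp_in[OF \<phi> FX] eq by simp
  have \<phi>'X: "Cmp \<phi>' Y \<in> Hom ?T (FOb ?G' Y) (FOb ?G'' Y)" if "Y \<in> Ob ?S" for Y
    using rd_2arrow.Cmp_in[OF \<phi>', of Y] that par by simp
  note a = \<phi>X and b = \<phi>'X[OF FX] and b' = \<phi>'X[OF F'X]
    and c' = G'.FArr_in[unfolded par, OF \<theta>X]
  have c: "FArr ?G'' (Cmp \<theta> X) \<in> Hom ?T (FOb ?G'' (FOb ?F X)) (FOb ?G'' (FOb ?F' X))"
    "FArr ?G'' (Cmp \<theta>' X) \<in> Hom ?T (FOb ?G'' (FOb ?F' X)) (FOb ?G'' (FOb ?F'' X))"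
    using G''.FArr_in[of "Cmp \<theta> X"] G''.FArr_in[of "Cmp \<theta>' X"] \<theta>X \<theta>'X by (simp_all add: par)
  have comp: "FArr ?G'' (Cmp \<theta>' X \<cdot>\<^bsub>?S\<^esub> Cmp \<theta> X) = FArr ?G'' (Cmp \<theta>' X) \<cdot>\<^bsub>?T\<^esub> FArr ?G'' (Cmp \<theta> X)"
    using G''.FArr_comp[of "Cmp \<theta> X" _ _ "Cmp \<theta>' X"] \<theta>X \<theta>'X by (simp add: par)
  have nat: "FArr ?G'' (Cmp \<theta> X) \<cdot>\<^bsub>?T\<^esub> Cmp \<phi>' (FOb ?F X) = Cmp \<phi>' (FOb ?F' X) \<cdot>\<^bsub>?T\<^esub> FArr ?G' (Cmp \<theta> X)"
    using rd_2arrow.Cmp_natural[OF \<phi>', of "Cmp \<theta> X"] \<theta>X by (simp add: par)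
  have "(FArr ?G'' (Cmp \<theta>' X) \<cdot>\<^bsub>?T\<^esub> FArr ?G'' (Cmp \<theta> X)) \<cdot>\<^bsub>?T\<^esub> (Cmp \<phi>' (FOb ?F X) \<cdot>\<^bsub>?T\<^esub> Cmp \<phi> (FOb ?F X))
      = FArr ?G'' (Cmp \<theta>' X) \<cdot>\<^bsub>?T\<^esub> ((FArr ?G'' (Cmp \<theta> X) \<cdot>\<^bsub>?T\<^esub> Cmp \<phi>' (FOb ?F X)) \<cdot>\<^bsub>?T\<^esub> Cmp \<phi> (FOb ?F X))"
    using G.T.comp_assoc[OF G.T.comp_in[OF a b] c] G.T.comp_assoc[OF a b c(1)] by simp
  also have "\<dots> = FArr ?G'' (Cmp \<theta>' X) \<cdot>\<^bsub>?T\<^esub>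
      (Cmp \<phi>' (FOb ?F' X) \<cdot>\<^bsub>?T\<^esub> (FArr ?G' (Cmp \<theta> X) \<cdot>\<^bsub>?T\<^esub> Cmp \<phi> (FOb ?F X)))"
    using nat G.T.comp_assoc[OF a c' b'] by simp
  also have "\<dots> = (FArr ?G'' (Cmp \<theta>' X) \<cdot>\<^bsub>?T\<^esub> Cmp \<phi>' (FOb ?F' X)) \<cdot>\<^bsub>?T\<^esub>
      (FArr ?G' (Cmp \<theta> X) \<cdot>\<^bsub>?T\<^esub> Cmp \<phi> (FOb ?F X))"
    using G.T.comp_assoc[OF G.T.comp_in[OF a c'] b' c(2)] by simp
  finally show "Cmp (rd_hcomp (rd_vcomp \<phi>' \<phi>) (rd_vcomp \<theta>' \<theta>)) X
      = Cmp (rd_vcomp (rd_hcomp \<phi>' \<theta>') (rd_hcomp \<phi> \<theta>)) X"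
    using X FX comp by (simp add: par eq)
qed simp_all

lemma RD_simps [simp]:
  "Ob (under RD) = {R. relational_doctrine R}" "Arr (under RD) = {F. rd_1arrow F}"
  "Dom (under RD) = Src" "Cod (under RD) = Tgt" "Id (under RD) = rd_id" "Comp (under RD) = rd_comp"
  "Ob (vert RD) = {F. rd_1arrow F}" "Arr (vert RD) = {\<theta>. rd_2arrow \<theta>}"
  "Dom (vert RD) = Src2" "Cod (vert RD) = Tgt2" "Id (vert RD) = rd_id2" "Comp (vert RD) = rd_vcomp"
  "hcomp RD = rd_hcomp"
  by (simp_all add: RD_def)

lemma two_category_RD: "two_category RD"
proof (rule two_category.intro)
  show "category (horiz RD)"
    by standard (auto simp: Hom_def rd_2arrow.src2 rd_2arrow.parallel rd_2arrow.tgt2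
        rd_1arrow.src rd_1arrow.tgt rd_1arrow_id rd_2arrow_id2
        rd_2arrow_hcomp rd_hcomp_id_right rd_hcomp_id_left rd_hcomp_assoc)
qed (auto simp: category_under_RD category_vert_RD Hom_def rd_2arrow.parallel
    rd_hcomp_id2 rd_interchange)

section \<open>The collapse 2-functor\<close>

lemma collapse1_simps [simp]:
  "Src (collapse1 F) = collapse (Src F)" "Tgt (collapse1 F) = collapse (Tgt F)"
  "FOb (collapse1 F) = FOb F" "FRel (collapse1 F) = FRel F"
  "k \<in> Arr (collapse (Src F)) \<Longrightarrow> FArr (collapse1 F) k = ecls (Tgt F) (FArr F k)"
  by (simp_all add: collapse1_def)

lemma collapse2_simps [simp]:
  "Src2 (collapse2 \<theta>) = collapse1 (Src2 \<theta>)" "Tgt2 (collapse2 \<theta>) = collapse1 (Tgt2 \<theta>)"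
  "X \<in> Ob (Src (Src2 \<theta>)) \<Longrightarrow> Cmp (collapse2 \<theta>) X = ecls (Tgt (Src2 \<theta>)) (Cmp \<theta> X)"
  by (simp_all add: collapse2_def)

context rd_1arrow
begin

text \<open>
  Since \<open>f \<approx> g\<close> is expressed by diagonals and reindexing, both of which 1-arrows preserve, it is
  preserved as well; so \<open>F\<close> descends to classes.
\<close>

lemma FArr_approx:
  assumes "(f, g) \<in> approx (Src F)"
  shows "(FArr F f, FArr F g) \<in> approx (Tgt F)"
proof -
  obtain X Y where f: "f \<in> Hom (Src F) X Y" and g: "g \<in> Hom (Src F) X Y"
    and le: "rle (Src F) X X (diag (Src F) X) (reidx (Src F) f g (diag (Src F) Y))"
    using assms by (auto simp: approx_def)
  note ob = S.Hom_ob[OF f] and d = S.diag_in[OF S.Hom_ob(2)[OF f]]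
  show ?thesis
    using monotone_onD[OF FRel_mono[OF ob(1,1)] S.diag_in[OF ob(1)] S.reidx_in[OF f g d] le]
      FRel_natural[OF f g d] FRel_diag[OF ob(1)] FRel_diag[OF ob(2)]
      T.approx_iff[OF FArr_in[OF f] FArr_in[OF g]] by simp
qed

lemma FArr_arr: "f \<in> Arr (Src F) \<Longrightarrow> FArr F f \<in> Arr (Tgt F)"
  using is_functor_arr[OF base_functor] .

lemma ecls_FArr_ecls:
  assumes f: "f \<in> Arr (Src F)"
  shows "ecls (Tgt F) (FArr F (ecls (Src F) f)) = ecls (Tgt F) (FArr F f)"
proof -
  have "ecls (Src F) f \<in> Arr (Src F)"
    using S.ecls_Hom[of f] f by (simp add: Hom_def)
  then show ?thesis
    using T.ecls_eq_iff[OF FArr_arr[OF f] FArr_arr, of "ecls (Src F) f"]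
      FArr_approx[OF S.ecls_approx[OF f]] by simp
qed

lemma FArr_collapse1_ecls:
  assumes f: "f \<in> Arr (Src F)"
  shows "FArr (collapse1 F) (ecls (Src F) f) = ecls (Tgt F) (FArr F f)"
  using ecls_FArr_ecls[OF f] f S.ecls_Hom[of f] by (simp add: S.Arr_collapse Hom_def)

lemma rd_1arrow_collapse1: "rd_1arrow (collapse1 F)"
proof (rule rd_1arrow.intro, unfold collapse1_simps(1-4))
  show "is_functor (collapse (Src F)) (collapse (Tgt F)) (FOb F) (FArr (collapse1 F))"
    unfolding is_functor_def
  proof (intro conjI allI ballI)
    show "category (collapse (Src F))" "category (collapse (Tgt F))"
      by (rule S.category_collapse, rule T.category_collapse)
  next
    fix X assume "X \<in> Ob (collapse (Src F))"
    then show "FOb F X \<in> Ob (collapse (Tgt F))"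
      "FArr (collapse1 F) (Id (collapse (Src F)) X) = Id (collapse (Tgt F)) (FOb F X)"
      using FArr_collapse1_ecls[of "Id (Src F) X"] HomD(1)[OF S.id_in] FArr_id FOb_in by simp_all
  next
    fix X Y f assume f: "f \<in> Hom (collapse (Src F)) X Y"
    show "FArr (collapse1 F) f \<in> Hom (collapse (Tgt F)) (FOb F X) (FOb F Y)"
      using T.ecls_Hom_collapse[OF FArr_in] f HomD(1)[OF f] by (simp add: S.Hom_collapse)
  next
    fix X Y Z f g assume "f \<in> Hom (collapse (Src F)) X Y" "g \<in> Hom (collapse (Src F)) Y Z"
    then have f: "f \<in> Hom (Src F) X Y" "f \<in> Arr (collapse (Src F))"
      and g: "g \<in> Hom (Src F) Y Z" "g \<in> Arr (collapse (Src F))"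
      by (auto simp: S.Hom_collapse Hom_def S.Arr_collapse)
    show "FArr (collapse1 F) (g \<cdot>\<^bsub>collapse (Src F)\<^esub> f)
        = FArr (collapse1 F) g \<cdot>\<^bsub>collapse (Tgt F)\<^esub> FArr (collapse1 F) f"
      using FArr_collapse1_ecls[OF HomD(1)[OF S.comp_in[OF f(1) g(1)]]] f(2) g(2)
        FArr_comp[OF f(1) g(1)] T.ecls_comp_ecls[OF FArr_in[OF f(1)] FArr_in[OF g(1)]]
      by simp
  qed
  show "FRel F X Y (reidx (collapse (Src F)) f g \<alpha>)
      = reidx (collapse (Tgt F)) (FArr (collapse1 F) f) (FArr (collapse1 F) g) (FRel F A B \<alpha>)"
    if "f \<in> Hom (collapse (Src F)) X A" "g \<in> Hom (collapse (Src F)) Y B"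
      "\<alpha> \<in> Rel (collapse (Src F)) A B" for f g \<alpha> X A Y B
  proof -
    have f: "f \<in> Hom (Src F) X A" and g: "g \<in> Hom (Src F) Y B" and \<alpha>: "\<alpha> \<in> Rel (Src F) A B"
      using that by (auto simp: S.Hom_collapse)
    show ?thesis
      using T.reidx_ecls[OF FArr_in[OF f] FArr_in[OF g] FRel_in[OF _ _ \<alpha>]]
        S.Hom_ob[OF f] S.Hom_ob[OF g] FRel_natural[OF f g \<alpha>] HomD(1)[OF that(1)] HomD(1)[OF that(2)]
      by simp
  qed
  show "restrict_rel (collapse (Src F)) (FRel F) = FRel F"
    using FRel_ext by (simp add: restrict_rel_def)
qed (simp_all add: S.relational_doctrine_collapse T.relational_doctrine_collapse FOb_ext
    FRel_in FRel_mono FRel_diag FRel_rcomp FRel_conv, simp add: collapse1_def)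

end

lemma collapse1_id:
  assumes "relational_doctrine R"
  shows "collapse1 (rd_id R) = rd_id (collapse R)"
proof -
  interpret relational_doctrine R by fact
  show ?thesis
    by (intro rd_arr_eqI)
      (simp_all add: assms rd_1arrow.rd_1arrow_collapse1 rd_1arrow_id relational_doctrine_collapse
        Arr_collapse)
qed

lemma collapse1_comp:
  assumes F: "rd_1arrow F" and G: "rd_1arrow G" and eq: "Tgt F = Src G"
  shows "collapse1 (rd_comp G F) = rd_comp (collapse1 G) (collapse1 F)"
proof (rule rd_arr_eqI)
  interpret F: rd_1arrow F by (rule F)
  interpret G: rd_1arrow G by (rule G)
  show "rd_1arrow (collapse1 (rd_comp G F))" "rd_1arrow (rd_comp (collapse1 G) (collapse1 F))"
    by (simp_all add: rd_1arrow_comp rd_1arrow.rd_1arrow_collapse1 F G eq)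
  fix k assume "k \<in> Arr (Src (collapse1 (rd_comp G F)))"
  then have k: "k \<in> Arr (Src F)" "k \<in> Arr (collapse (Src F))" by (simp_all add: F.S.Arr_collapse)
  show "FArr (collapse1 (rd_comp G F)) k = FArr (rd_comp (collapse1 G) (collapse1 F)) k"
    using k G.FArr_collapse1_ecls[of "FArr F k"] F.FArr_arr[OF k(1)] eq by simp
qed simp_all

lemma rd_2arrow_collapse2:
  assumes \<theta>: "rd_2arrow \<theta>"
  shows "rd_2arrow (collapse2 \<theta>)"
proof -
  interpret F: rd_1arrow "Src2 \<theta>" by (rule rd_2arrow.src2[OF \<theta>])
  interpret G: rd_1arrow "Tgt2 \<theta>" by (rule rd_2arrow.tgt2[OF \<theta>])
  let ?F = "Src2 \<theta>" and ?G = "Tgt2 \<theta>"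
  let ?R = "Src ?F" and ?S = "Tgt ?F"
  note par = rd_2arrow.parallel[OF \<theta>]
  note \<theta>_in = rd_2arrow.Cmp_in[OF \<theta>]
  show ?thesis
  proof (rule rd_2arrow.intro, unfold collapse2_simps(1,2) collapse1_simps(1-4))
    show "rd_1arrow (collapse1 ?F)" "rd_1arrow (collapse1 ?G)"
      by (rule F.rd_1arrow_collapse1, rule G.rd_1arrow_collapse1)
    show "Cmp (collapse2 \<theta>) \<in> extensional (Ob (collapse ?R))" by (simp add: collapse2_def)
    show "Cmp (collapse2 \<theta>) X \<in> Hom (collapse ?S) (FOb ?F X) (FOb ?G X)"
      if "X \<in> Ob (collapse ?R)" for X
      using that F.T.ecls_Hom_collapse[OF \<theta>_in] by simp
    show "FArr (collapse1 ?G) f \<cdot>\<^bsub>collapse ?S\<^esub> Cmp (collapse2 \<theta>) X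
        = Cmp (collapse2 \<theta>) Y \<cdot>\<^bsub>collapse ?S\<^esub> FArr (collapse1 ?F) f"
      if "f \<in> Hom (collapse ?R) X Y" for f X Y
    proof -
      have f: "f \<in> Hom ?R X Y" using that by (simp add: F.S.Hom_collapse)
      note ob = F.S.Hom_ob[OF f]
      show ?thesis
        using F.T.ecls_comp_ecls[OF F.FArr_in[OF f] \<theta>_in[OF ob(2)]]
          F.T.ecls_comp_ecls[OF \<theta>_in[OF ob(1)] G.FArr_in[unfolded par, OF f]]
          rd_2arrow.Cmp_natural[OF \<theta> f] ob HomD(1)[OF that] by (simp add: par)
    qed
    show "rle (collapse ?S) (FOb ?F X) (FOb ?F Y) (FRel ?F X Y \<alpha>)
        (reidx (collapse ?S) (Cmp (collapse2 \<theta>) X) (Cmp (collapse2 \<theta>) Y) (FRel ?G X Y \<alpha>))"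
      if "X \<in> Ob (collapse ?R)" "Y \<in> Ob (collapse ?R)" "\<alpha> \<in> Rel (collapse ?R) X Y" for X Y \<alpha>
    proof -
      have ob: "X \<in> Ob ?R" "Y \<in> Ob ?R" and \<alpha>: "\<alpha> \<in> Rel ?R X Y" using that by simp_all
      show ?thesis
        using F.T.reidx_ecls[OF \<theta>_in[OF ob(1)] \<theta>_in[OF ob(2)] G.FRel_in[unfolded par, OF ob \<alpha>]]
          rd_2arrow.Cmp_rle[OF \<theta> ob \<alpha>] ob by simp
    qed
  qed (simp_all add: par)
qed

lemma collapse2_id2:
  assumes F: "rd_1arrow F"
  shows "collapse2 (rd_id2 F) = rd_id2 (collapse1 F)"
  by (rule rd_cell_eqI)
    (simp_all add: rd_2arrow_collapse2 rd_2arrow_id2 rd_1arrow.rd_1arrow_collapse1 F)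

lemma collapse2_vcomp:
  assumes \<theta>: "rd_2arrow \<theta>" and \<phi>: "rd_2arrow \<phi>" and eq: "Tgt2 \<theta> = Src2 \<phi>"
  shows "collapse2 (rd_vcomp \<phi> \<theta>) = rd_vcomp (collapse2 \<phi>) (collapse2 \<theta>)"
proof (rule rd_cell_eqI)
  interpret F: rd_1arrow "Src2 \<theta>" by (rule rd_2arrow.src2[OF \<theta>])
  show "rd_2arrow (collapse2 (rd_vcomp \<phi> \<theta>))" "rd_2arrow (rd_vcomp (collapse2 \<phi>) (collapse2 \<theta>))"
    by (simp_all add: rd_2arrow_collapse2 rd_2arrow_vcomp \<theta> \<phi> eq)
  note par = rd_2arrow.parallel[OF \<theta>, unfolded eq]
  fix X assume "X \<in> Ob (Src (Src2 (collapse2 (rd_vcomp \<phi> \<theta>))))"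
  then have X: "X \<in> Ob (Src (Src2 \<theta>))" by simp
  show "Cmp (collapse2 (rd_vcomp \<phi> \<theta>)) X = Cmp (rd_vcomp (collapse2 \<phi>) (collapse2 \<theta>)) X"
    using X F.T.ecls_comp_ecls[OF rd_2arrow.Cmp_in[OF \<theta> X, unfolded eq],
        of "Cmp \<phi> X"] rd_2arrow.Cmp_in[OF \<phi>, of X]
    by (simp add: par)
qed (simp_all add: eq)

lemma collapse2_hcomp:
  assumes \<theta>: "rd_2arrow \<theta>" and \<phi>: "rd_2arrow \<phi>" and eq: "Tgt (Src2 \<theta>) = Src (Src2 \<phi>)"
  shows "collapse2 (rd_hcomp \<phi> \<theta>) = rd_hcomp (collapse2 \<phi>) (collapse2 \<theta>)"
proof (rule rd_cell_eqI)
  interpret F: rd_1arrow "Src2 \<theta>" by (rule rd_2arrow.src2[OF \<theta>])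
  interpret F': rd_1arrow "Tgt2 \<theta>" by (rule rd_2arrow.tgt2[OF \<theta>])
  interpret G: rd_1arrow "Src2 \<phi>" by (rule rd_2arrow.src2[OF \<phi>])
  interpret G': rd_1arrow "Tgt2 \<phi>" by (rule rd_2arrow.tgt2[OF \<phi>])
  note par = rd_2arrow.parallel[OF \<theta>] rd_2arrow.parallel[OF \<phi>]
  show "rd_2arrow (collapse2 (rd_hcomp \<phi> \<theta>))" "rd_2arrow (rd_hcomp (collapse2 \<phi>) (collapse2 \<theta>))"
    by (simp_all add: rd_2arrow_collapse2 rd_2arrow_hcomp \<theta> \<phi> eq)
  show "Src2 (collapse2 (rd_hcomp \<phi> \<theta>)) = Src2 (rd_hcomp (collapse2 \<phi>) (collapse2 \<theta>))"
    "Tgt2 (collapse2 (rd_hcomp \<phi> \<theta>)) = Tgt2 (rd_hcomp (collapse2 \<phi>) (collapse2 \<theta>))"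
    by (simp_all add: collapse1_comp F.rd_1arrow_axioms F'.rd_1arrow_axioms
        G.rd_1arrow_axioms G'.rd_1arrow_axioms eq par)
  fix X assume "X \<in> Ob (Src (Src2 (collapse2 (rd_hcomp \<phi> \<theta>))))"
  then have X: "X \<in> Ob (Src (Src2 \<theta>))" by simp
  note FX = F.FOb_in[OF X, unfolded eq]
  note \<theta>X = rd_2arrow.Cmp_in[OF \<theta> X, unfolded eq] and \<phi>X = rd_2arrow.Cmp_in[OF \<phi> FX]
  have "FArr (collapse1 (Tgt2 \<phi>)) (ecls (Src (Src2 \<phi>)) (Cmp \<theta> X))
      = ecls (Tgt (Src2 \<phi>)) (FArr (Tgt2 \<phi>) (Cmp \<theta> X))"
    using G'.FArr_collapse1_ecls[of "Cmp \<theta> X"] HomD(1)[OF \<theta>X] by (simp add: par)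
  then show "Cmp (collapse2 (rd_hcomp \<phi> \<theta>)) X = Cmp (rd_hcomp (collapse2 \<phi>) (collapse2 \<theta>)) X"
    using X FX G.T.ecls_comp_ecls[OF \<phi>X G'.FArr_in[unfolded par, OF \<theta>X]] by (simp add: eq)
qed

lemma E_functor_simps [simp]:
  "on0 E_functor = collapse" "on1 E_functor = collapse1" "on2 E_functor = collapse2"
  by (simp_all add: E_functor_def)

lemma twofun_id_simps [simp]:
  "on0 twofun_id X = X" "on1 twofun_id f = f" "on2 twofun_id t = t"
  by (simp_all add: twofun_id_def)

lemma twofun_comp_id: "twofun_comp F twofun_id = F" "twofun_comp twofun_id F = F"
  by (simp_all add: twofun_comp_def twofun_id_def comp_def)

lemma two_functor_E_RD: "two_functor RD RD E_functor"
  unfolding two_functor_def is_functor_def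
  by (auto simp: rd_2arrow.parallel two_category_RD category_under_RD category_vert_RD Hom_def
      relational_doctrine.relational_doctrine_collapse rd_1arrow.rd_1arrow_collapse1
      collapse1_id collapse1_comp rd_2arrow_collapse2 collapse2_id2 collapse2_vcomp collapse2_hcomp)

lemma sub_two_category_ERD: "sub_two_category RD extensional_doctrine (\<lambda>_. True)"
  by (intro sub_two_category.intro sub_two_category_axioms.intro) (simp_all add: two_category_RD)

lemmas two_category_ERD =
  sub_two_category.two_category_sub[OF sub_two_category_ERD, folded ERD_def]

lemma two_functor_E: "two_functor RD ERD E_functor"
  unfolding ERD_def
  by (rule two_functor_into_sub[OF two_functor_E_RD two_category_ERD[unfolded ERD_def]])
    (simp_all add: relational_doctrine.extensional_collapse)

lemma two_functor_U: "two_functor ERD RD twofun_id"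
  unfolding ERD_def by (rule sub_two_category.two_functor_inclusion[OF sub_two_category_ERD])

section \<open>Unit and counit\<close>

lemma collapse_unit_simps [simp]:
  "Src (collapse_unit R) = R" "Tgt (collapse_unit R) = collapse R"
  "X \<in> Ob R \<Longrightarrow> FOb (collapse_unit R) X = X"
  "f \<in> Arr R \<Longrightarrow> FArr (collapse_unit R) f = ecls R f"
  "X \<in> Ob R \<Longrightarrow> Y \<in> Ob R \<Longrightarrow> \<alpha> \<in> Rel R X Y \<Longrightarrow> FRel (collapse_unit R) X Y \<alpha> = \<alpha>"
  by (simp_all add: collapse_unit_def restrict_rel_apply)

lemma collapse_counit_simps [simp]:
  "Src (collapse_counit S) = collapse S" "Tgt (collapse_counit S) = S"
  "X \<in> Ob S \<Longrightarrow> FOb (collapse_counit S) X = X"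
  "X \<in> Ob S \<Longrightarrow> Y \<in> Ob S \<Longrightarrow> \<alpha> \<in> Rel S X Y \<Longrightarrow> FRel (collapse_counit S) X Y \<alpha> = \<alpha>"
  by (simp_all add: collapse_counit_def restrict_rel_apply)

context relational_doctrine
begin

lemma rd_1arrow_collapse_unit: "rd_1arrow (collapse_unit R)"
  unfolding collapse_unit_def
  by (rule rd_1arrow_identity_on_relations[OF relational_doctrine_collapse])
    (simp_all add: ecls_Hom_collapse ecls_comp_ecls reidx_ecls)

text \<open>
  In an extensional doctrine every class is a singleton, so the arrow chosen by the definite
  description is the name of the class itself.
\<close>

lemma FArr_collapse_counit:
  assumes "extensional_doctrine R" and "f \<in> Arr R"
  shows "FArr (collapse_counit R) f = f"
proof -
  have "(THE g. g \<in> Arr R \<and> ecls R g = f) = f"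
    using assms ecls_extensional by (intro the_equality) auto
  then show ?thesis
    using assms ecls_extensional by (simp add: collapse_counit_def Arr_collapse)
qed

lemma rd_1arrow_collapse_counit:
  assumes R: "extensional_doctrine R"
  shows "rd_1arrow (collapse_counit R)"
proof -
  interpret e: relational_doctrine "collapse R" by (rule relational_doctrine_collapse)
  have e: "f \<in> Hom R X Y" "(THE g. g \<in> Arr R \<and> ecls R g = f) = f" "ecls R f = f"
    if "f \<in> Hom (collapse R) X Y" for f X Y
    using that FArr_collapse_counit[OF R, of f] HomD(1)[OF that]
    by (auto simp: Hom_collapse collapse_counit_def dest: HomD(1))
  note ext = ecls_extensional[OF R]
  have "rd_1arrow \<lparr> Src = collapse R, Tgt = R, FOb = restrict (\<lambda>X. X) (Ob (collapse R)),
      FArr = restrict (\<lambda>k. THE g. g \<in> Arr R \<and> ecls R g = k) (Arr (collapse R)),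
      FRel = restrict_rel (collapse R) (\<lambda>X Y \<alpha>. \<alpha>) \<rparr>"
  proof (rule e.rd_1arrow_identity_on_relations[OF relational_doctrine_axioms])
    show "(THE g. g \<in> Arr R \<and> ecls R g = Id (collapse R) X) = Id R X" if "X \<in> Ob (collapse R)" for X
      using e(2)[OF e.id_in[OF that]] that ext[OF HomD(1)[OF id_in]] by simp
    show "(THE h. h \<in> Arr R \<and> ecls R h = g \<cdot>\<^bsub>collapse R\<^esub> f)
        = (THE h. h \<in> Arr R \<and> ecls R h = g) \<cdot> (THE h. h \<in> Arr R \<and> ecls R h = f)"
      if f: "f \<in> Hom (collapse R) X Y" and g: "g \<in> Hom (collapse R) Y Z" for f g X Y Z
      using e(2)[OF e.comp_in[OF f g]] e(2)[OF f] e(2)[OF g]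
        ext[OF HomD(1)[OF comp_in[OF e(1)[OF f] e(1)[OF g]]]] by simp
  qed (simp_all add: e)
  then show ?thesis
    by (simp add: collapse_counit_def restrict_rel_def)
qed

end

lemma collapse_unit_natural:
  assumes F: "rd_1arrow F"
  shows "rd_comp (collapse1 F) (collapse_unit (Src F)) = rd_comp (collapse_unit (Tgt F)) F"
proof (rule rd_arr_eqI)
  interpret rd_1arrow F by (rule F)
  show "rd_1arrow (rd_comp (collapse1 F) (collapse_unit (Src F)))"
    "rd_1arrow (rd_comp (collapse_unit (Tgt F)) F)"
    by (simp_all add: rd_1arrow_comp rd_1arrow_collapse1 F S.rd_1arrow_collapse_unit
        T.rd_1arrow_collapse_unit)
qed (use rd_1arrow.FOb_in[OF F] rd_1arrow.FRel_in[OF F] rd_1arrow.FArr_arr[OF F]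
    rd_1arrow.FArr_collapse1_ecls[OF F] in simp_all)

lemma collapse_unit_2natural:
  assumes \<theta>: "rd_2arrow \<theta>"
  shows "rd_hcomp (collapse2 \<theta>) (rd_id2 (collapse_unit (Src (Src2 \<theta>))))
    = rd_hcomp (rd_id2 (collapse_unit (Tgt (Src2 \<theta>)))) \<theta>"
proof (rule rd_cell_eqI)
  interpret F: rd_1arrow "Src2 \<theta>" by (rule rd_2arrow.src2[OF \<theta>])
  interpret G: rd_1arrow "Tgt2 \<theta>" by (rule rd_2arrow.tgt2[OF \<theta>])
  interpret G': rd_1arrow "collapse1 (Tgt2 \<theta>)" by (rule G.rd_1arrow_collapse1)
  interpret F': rd_1arrow "collapse1 (Src2 \<theta>)" by (rule F.rd_1arrow_collapse1)
  note par = rd_2arrow.parallel[OF \<theta>]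
  show "rd_2arrow (rd_hcomp (collapse2 \<theta>) (rd_id2 (collapse_unit (Src (Src2 \<theta>)))))"
    "rd_2arrow (rd_hcomp (rd_id2 (collapse_unit (Tgt (Src2 \<theta>)))) \<theta>)"
    by (simp_all add: rd_2arrow_hcomp rd_2arrow_id2 rd_2arrow_collapse2 \<theta>
        F.S.rd_1arrow_collapse_unit F.T.rd_1arrow_collapse_unit)
  show "Src2 (rd_hcomp (collapse2 \<theta>) (rd_id2 (collapse_unit (Src (Src2 \<theta>)))))
      = Src2 (rd_hcomp (rd_id2 (collapse_unit (Tgt (Src2 \<theta>)))) \<theta>)"
    "Tgt2 (rd_hcomp (collapse2 \<theta>) (rd_id2 (collapse_unit (Src (Src2 \<theta>)))))
      = Tgt2 (rd_hcomp (rd_id2 (collapse_unit (Tgt (Src2 \<theta>)))) \<theta>)"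
    using collapse_unit_natural[OF F.rd_1arrow_axioms] collapse_unit_natural[OF G.rd_1arrow_axioms]
    by (simp_all add: par)
  fix X assume "X \<in> Ob (Src (Src2 (rd_hcomp (collapse2 \<theta>) (rd_id2 (collapse_unit (Src (Src2 \<theta>)))))))"
  then have X: "X \<in> Ob (Src (Src2 \<theta>))" by simp
  note \<theta>X = F.T.ecls_Hom_collapse[OF rd_2arrow.Cmp_in[OF \<theta> X]]
  have "FArr (collapse1 (Tgt2 \<theta>)) (Id (collapse (Src (Src2 \<theta>))) X)
      = Id (collapse (Tgt (Src2 \<theta>))) (FOb (Tgt2 \<theta>) X)"
    using G'.FArr_id[of X] X by (simp add: par)
  then show "Cmp (rd_hcomp (collapse2 \<theta>) (rd_id2 (collapse_unit (Src (Src2 \<theta>))))) X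
      = Cmp (rd_hcomp (rd_id2 (collapse_unit (Tgt (Src2 \<theta>)))) \<theta>) X"
    using X F.FOb_in[OF X] HomD(1)[OF rd_2arrow.Cmp_in[OF \<theta> X]]
      F'.T.comp_id_left F'.T.comp_id_right \<theta>X by simp
qed

lemma collapse_counit_natural:
  assumes F: "rd_1arrow F" and ext: "extensional_doctrine (Src F)" "extensional_doctrine (Tgt F)"
  shows "rd_comp F (collapse_counit (Src F)) = rd_comp (collapse_counit (Tgt F)) (collapse1 F)"
proof (rule rd_arr_eqI)
  interpret rd_1arrow F by (rule F)
  show "rd_1arrow (rd_comp F (collapse_counit (Src F)))"
    "rd_1arrow (rd_comp (collapse_counit (Tgt F)) (collapse1 F))"
    by (simp_all add: rd_1arrow_comp rd_1arrow_collapse1 F S.rd_1arrow_collapse_counit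
        T.rd_1arrow_collapse_counit ext)
  fix f assume "f \<in> Arr (Src (rd_comp F (collapse_counit (Src F))))"
  then have f: "f \<in> Arr (Src F)" "f \<in> Arr (collapse (Src F))" by (simp_all add: S.Arr_collapse)
  show "FArr (rd_comp F (collapse_counit (Src F))) f
      = FArr (rd_comp (collapse_counit (Tgt F)) (collapse1 F)) f"
    using f FArr_arr[OF f(1)] S.FArr_collapse_counit[OF ext(1)] T.FArr_collapse_counit[OF ext(2)]
      T.ecls_extensional[OF ext(2)] by simp
qed (use rd_1arrow.FOb_in[OF F] rd_1arrow.FRel_in[OF F] in simp_all)

lemma collapse_counit_2natural:
  assumes \<theta>: "rd_2arrow \<theta>"
    and ext: "extensional_doctrine (Src (Src2 \<theta>))" "extensional_doctrine (Tgt (Src2 \<theta>))"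
  shows "rd_hcomp \<theta> (rd_id2 (collapse_counit (Src (Src2 \<theta>))))
    = rd_hcomp (rd_id2 (collapse_counit (Tgt (Src2 \<theta>)))) (collapse2 \<theta>)"
proof (rule rd_cell_eqI)
  interpret F: rd_1arrow "Src2 \<theta>" by (rule rd_2arrow.src2[OF \<theta>])
  interpret G: rd_1arrow "Tgt2 \<theta>" by (rule rd_2arrow.tgt2[OF \<theta>])
  note par = rd_2arrow.parallel[OF \<theta>]
  show "rd_2arrow (rd_hcomp \<theta> (rd_id2 (collapse_counit (Src (Src2 \<theta>)))))"
    "rd_2arrow (rd_hcomp (rd_id2 (collapse_counit (Tgt (Src2 \<theta>)))) (collapse2 \<theta>))"
    by (simp_all add: rd_2arrow_hcomp rd_2arrow_id2 rd_2arrow_collapse2 \<theta>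
        F.S.rd_1arrow_collapse_counit F.T.rd_1arrow_collapse_counit ext)
  show "Src2 (rd_hcomp \<theta> (rd_id2 (collapse_counit (Src (Src2 \<theta>)))))
      = Src2 (rd_hcomp (rd_id2 (collapse_counit (Tgt (Src2 \<theta>)))) (collapse2 \<theta>))"
    "Tgt2 (rd_hcomp \<theta> (rd_id2 (collapse_counit (Src (Src2 \<theta>)))))
      = Tgt2 (rd_hcomp (rd_id2 (collapse_counit (Tgt (Src2 \<theta>)))) (collapse2 \<theta>))"
    using collapse_counit_natural[OF F.rd_1arrow_axioms] collapse_counit_natural[OF G.rd_1arrow_axioms]
      ext by (simp_all add: par)
  fix X assume "X \<in> Ob (Src (Src2 (rd_hcomp \<theta> (rd_id2 (collapse_counit (Src (Src2 \<theta>)))))))"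
  then have X: "X \<in> Ob (Src (Src2 \<theta>))" by simp
  note \<theta>X = rd_2arrow.Cmp_in[OF \<theta> X]
  show "Cmp (rd_hcomp \<theta> (rd_id2 (collapse_counit (Src (Src2 \<theta>))))) X
      = Cmp (rd_hcomp (rd_id2 (collapse_counit (Tgt (Src2 \<theta>)))) (collapse2 \<theta>)) X"
    using X F.FOb_in[OF X] \<theta>X HomD(1)[OF \<theta>X] G.FArr_id[of X]
      F.T.ecls_extensional[OF ext(2) HomD(1)[OF \<theta>X]] F.T.FArr_collapse_counit[OF ext(2) HomD(1)[OF \<theta>X]]
    by (simp add: par F.T.comp_id_left F.T.comp_id_right)
qed

lemma collapse_triangle_left:
  assumes "relational_doctrine R"
  shows "rd_comp (collapse_counit (collapse R)) (collapse1 (collapse_unit R)) = rd_id (collapse R)"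
proof (rule rd_arr_eqI)
  interpret relational_doctrine R by fact
  interpret e: relational_doctrine "collapse R" by (rule relational_doctrine_collapse)
  interpret u: rd_1arrow "collapse_unit R" by (rule rd_1arrow_collapse_unit)
  show "rd_1arrow (rd_comp (collapse_counit (collapse R)) (collapse1 (collapse_unit R)))"
    "rd_1arrow (rd_id (collapse R))"
    by (simp_all add: rd_1arrow_comp rd_1arrow_id e.rd_1arrow_collapse_counit extensional_collapse
        u.rd_1arrow_collapse1 e.relational_doctrine_axioms)
  fix f assume "f \<in> Arr (Src (rd_comp (collapse_counit (collapse R)) (collapse1 (collapse_unit R))))"
  then have f: "f \<in> Arr (collapse R)" by simp
  then show "FArr (rd_comp (collapse_counit (collapse R)) (collapse1 (collapse_unit R))) f
      = FArr (rd_id (collapse R)) f"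
    using e.ecls_extensional[OF extensional_collapse f] e.FArr_collapse_counit[OF extensional_collapse f]
    by (simp add: Arr_collapse[of f])
qed simp_all

lemma collapse_triangle_right:
  assumes "relational_doctrine R" and ext: "extensional_doctrine R"
  shows "rd_comp (collapse_counit R) (collapse_unit R) = rd_id R"
proof -
  interpret relational_doctrine R by fact
  show ?thesis
    by (rule rd_arr_eqI)
      (simp_all add: rd_1arrow_comp rd_1arrow_id rd_1arrow_collapse_counit rd_1arrow_collapse_unit
        ext relational_doctrine_axioms ecls_extensional FArr_collapse_counit)
qed

lemma Hom_ERD:
  "F \<in> Hom (under ERD) R S \<longleftrightarrow> rd_1arrow F \<and> Src F = R \<and> Tgt F = S \<and>
     extensional_doctrine R \<and> extensional_doctrine S"
  "\<theta> \<in> Hom (horiz ERD) R S \<Longrightarrow> rd_2arrow \<theta> \<and> Src (Src2 \<theta>) = R \<and> Tgt (Src2 \<theta>) = S \<and>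
     extensional_doctrine R \<and> extensional_doctrine S"
  by (auto simp: ERD_def Hom_def rd_2arrow.parallel)

lemma ERD_simps:
  "Ob (under ERD) = {R. relational_doctrine R \<and> extensional_doctrine R}"
  "Id (under ERD) = rd_id" "Comp (under ERD) = rd_comp" "Id (vert ERD) = rd_id2"
  "hcomp ERD = rd_hcomp"
  by (auto simp: ERD_def)

theorem collapse_two_adjunction:
  "two_adjunction RD ERD E_functor twofun_id collapse_unit collapse_counit"
proof -
  have "two_natural RD RD twofun_id (twofun_comp twofun_id E_functor) collapse_unit"
    unfolding two_natural_def twofun_comp_id
    by (auto simp: two_functor_E_RD two_functor_id two_category_RD Hom_def rd_2arrow.parallel
        collapse_unit_natural
        relational_doctrine.rd_1arrow_collapse_unit collapse_unit_2natural)
  moreover have "two_functor ERD ERD E_functor"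
    using two_functor_from_sub[OF two_functor_E two_category_ERD[unfolded ERD_def], folded ERD_def] .
  then have "two_natural ERD ERD (twofun_comp E_functor twofun_id) twofun_id collapse_counit"
    unfolding two_natural_def twofun_comp_id
    by (auto simp: two_functor_id two_category_ERD ERD_simps Hom_ERD(1) collapse_counit_natural
        relational_doctrine.rd_1arrow_collapse_counit relational_doctrine.extensional_collapse
        collapse_counit_2natural dest!: Hom_ERD(2))
  ultimately show ?thesis
    unfolding two_adjunction_def
    by (simp add: two_functor_E two_functor_U ERD_simps collapse_triangle_left collapse_triangle_right)
qed

section \<open>Quotient arrows under the collapse\<close>

text \<open>
  Two quotient arrows of \<open>\<rho>\<close> differ by an isomorphism, which \<open>F\<close> preserves. So \<open>F\<close> preserves
  all quotient arrows of \<open>\<rho>\<close> if it preserves one of them.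
\<close>

lemma (in rd_1arrow) quotient_arrow_FArr_transfer:
  assumes p: "quotient_arrow (Src F) X \<rho> p" and q: "quotient_arrow (Src F) X \<rho> q"
    and Fp: "quotient_arrow (Tgt F) (FOb F X) (FRel F X X \<rho>) (FArr F p)"
  shows "quotient_arrow (Tgt F) (FOb F X) (FRel F X X \<rho>) (FArr F q)"
proof -
  let ?W = "Cod (Src F) p" and ?V = "Cod (Src F) q"
  obtain i j where i: "i \<in> Hom (Src F) ?W ?V" and j: "j \<in> Hom (Src F) ?V ?W"
    and ij: "j \<cdot>\<^bsub>Src F\<^esub> i = Id (Src F) ?W" "i \<cdot>\<^bsub>Src F\<^esub> j = Id (Src F) ?V"
    and qi: "q = i \<cdot>\<^bsub>Src F\<^esub> p"
    using S.quotient_arrow_unique[OF p q] .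
  have p': "p \<in> Hom (Src F) X ?W" using p by (simp add: quotient_arrow_def Hom_def)
  have c: "Cod (Tgt F) (FArr F p) = FOb F ?W" using FArr_in[OF p'] by (simp add: Hom_def)
  show ?thesis
    using T.quotient_arrow_comp_iso[OF Fp, unfolded c, OF FArr_in[OF i] FArr_in[OF j]]
      FArr_comp[OF i j] FArr_comp[OF j i] FArr_comp[OF p' i] ij qi
      FArr_id[OF S.Hom_ob(1)[OF i]] FArr_id[OF S.Hom_ob(2)[OF i]] by simp
qed

lemma (in relational_doctrine) preserves_quotients_collapse_unit:
  assumes R: "has_quotients R"
  shows "preserves_quotients (collapse_unit R)"
  unfolding preserves_quotients_def
proof (intro allI impI)
  interpret u: rd_1arrow "collapse_unit R" by (rule rd_1arrow_collapse_unit)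
  fix X \<rho> q assume q: "quotient_arrow (Src (collapse_unit R)) X \<rho> q"
  then have \<rho>: "equiv_rel R X \<rho>" by (simp add: quotient_arrow_def)
  then obtain p where p: "quotient_arrow R X \<rho> p" "descent R p"
    using R by (auto simp: has_quotients_def)
  have "p \<in> Arr R" "X \<in> Ob R" "\<rho> \<in> Rel R X X"
    using p(1) by (auto simp: quotient_arrow_def equiv_rel_def)
  then show "quotient_arrow (Tgt (collapse_unit R)) (FOb (collapse_unit R) X)
      (FRel (collapse_unit R) X X \<rho>) (FArr (collapse_unit R) q)"
    using u.quotient_arrow_FArr_transfer[of X \<rho> p q] p q quotient_arrow_ecls_descent[OF p] by simp
qed

text \<open>
  The universal property of a quotient arrow of the collapse says nothing about quotient arrows
  of \<open>Src F\<close>. But the same relation also has a quotient arrow \<open>p\<close> in \<open>Src F\<close>, its class is another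
  quotient arrow in the collapse, and it is preserved because \<open>F\<close> preserves \<open>p\<close> and the unit at
  \<open>Tgt F\<close> preserves the image of \<open>p\<close>.
\<close>

lemma (in rd_1arrow) preserves_quotients_collapse1:
  assumes F: "preserves_quotients F" and R: "has_quotients (Src F)" and T: "has_quotients (Tgt F)"
  shows "preserves_quotients (collapse1 F)"
  unfolding preserves_quotients_def
proof (intro allI impI)
  interpret e: rd_1arrow "collapse1 F" by (rule rd_1arrow_collapse1)
  have ecls: "quotient_arrow (collapse R) X \<rho> (ecls R q)"
    if R: "relational_doctrine R" "has_quotients R" and q: "quotient_arrow R X \<rho> q" for R X \<rho> q
  proof -
    have "q \<in> Arr R" "X \<in> Ob R" "\<rho> \<in> Rel R X X"
      using q by (auto simp: quotient_arrow_def equiv_rel_def)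
    moreover have "quotient_arrow (Tgt (collapse_unit R)) (FOb (collapse_unit R) X)
        (FRel (collapse_unit R) X X \<rho>) (FArr (collapse_unit R) q)"
      using relational_doctrine.preserves_quotients_collapse_unit[OF R] q
      by (simp add: preserves_quotients_def)
    ultimately show ?thesis by simp
  qed
  fix X \<rho> q assume q: "quotient_arrow (Src (collapse1 F)) X \<rho> q"
  then have "equiv_rel (Src F) X \<rho>"
    by (simp add: quotient_arrow_def S.equiv_rel_collapse)
  then obtain p where p: "quotient_arrow (Src F) X \<rho> p"
    using R by (auto simp: has_quotients_def)
  then have "p \<in> Arr (Src F)"
    by (simp add: quotient_arrow_def)
  moreover have "quotient_arrow (Tgt F) (FOb F X) (FRel F X X \<rho>) (FArr F p)"
    using F p by (simp add: preserves_quotients_def)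
  ultimately have "quotient_arrow (Tgt (collapse1 F)) (FOb (collapse1 F) X) (FRel (collapse1 F) X X \<rho>)
      (FArr (collapse1 F) (ecls (Src F) p))"
    using ecls[OF tgt T] FArr_collapse1_ecls by simp
  then show "quotient_arrow (Tgt (collapse1 F)) (FOb (collapse1 F) X) (FRel (collapse1 F) X X \<rho>)
      (FArr (collapse1 F) q)"
    using e.quotient_arrow_FArr_transfer[of X \<rho> "ecls (Src F) p" q] q ecls[OF src R p] by simp
qed

text \<open>
  For extensional \<open>R\<close> the bases of \<open>R\<close> and of its collapse have the same arrows and the same
  composites of composable arrows, so both have the same quotient arrows. The two records may
  still differ, at identities and composites that do not exist in \<open>R\<close>.
\<close>

lemma (in relational_doctrine) preserves_quotients_collapse_counit:
  assumes R: "extensional_doctrine R"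
  shows "preserves_quotients (collapse_counit R)"
  unfolding preserves_quotients_def
proof (intro allI impI)
  note ext = ecls_extensional[OF R]
  have Hom: "f \<in> Hom (collapse R) X Y \<longleftrightarrow> f \<in> Hom R X Y" for f X Y
    using ext[OF HomD(1)[of f R X Y]] by (auto simp: Hom_collapse)
  have ker: "kernel (collapse R) f = kernel R f" if "f \<in> Hom R X Y" for f X Y
    using kernel_ecls[OF that] ext[OF HomD(1)[OF that]] by simp
  have comp: "g \<cdot>\<^bsub>collapse R\<^esub> f = g \<cdot> f" if "f \<in> Hom R X Y" "g \<in> Hom R Y Z" for f g X Y Z
    using ext[OF HomD(1)[OF comp_in[OF that]]] by simp
  fix X \<rho> q assume q: "quotient_arrow (Src (collapse_counit R)) X \<rho> q"
  then have q': "q \<in> Hom R X (Cod R q)" "equiv_rel R X \<rho>"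
    by (auto simp: quotient_arrow_def Hom_def Arr_collapse equiv_rel_collapse)
  have "quotient_arrow R X \<rho> q"
    unfolding quotient_arrow_def
  proof (intro conjI allI ballI impI)
    show "rle R X X \<rho> (kernel R q)"
      using q ker[OF q'(1)] by (simp add: quotient_arrow_def)
    fix Z f assume f: "f \<in> Hom R X Z" and "rle R X X \<rho> (kernel R f)"
    then have "\<exists>!h. h \<in> Hom R (Cod R q) Z \<and> f = h \<cdot>\<^bsub>collapse R\<^esub> q"
      using q ker[OF f] by (simp add: quotient_arrow_def Hom)
    then show "\<exists>!h. h \<in> Hom R (Cod R q) Z \<and> f = h \<cdot> q"
      using comp[OF q'(1)] by metis
  qed (use q' in \<open>simp_all add: Hom_def\<close>)
  then show "quotient_arrow (Tgt (collapse_counit R)) (FOb (collapse_counit R) X)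
      (FRel (collapse_counit R) X X \<rho>) (FArr (collapse_counit R) q)"
    using q' FArr_collapse_counit[OF R HomD(1)[OF q'(1)]] by (simp add: equiv_rel_def)
qed

lemma preserves_quotients_id: "preserves_quotients (rd_id R)"
  by (auto simp: preserves_quotients_def quotient_arrow_def equiv_rel_def)

lemma preserves_quotients_comp:
  assumes "preserves_quotients F" "preserves_quotients G" "Tgt F = Src G"
  shows "preserves_quotients (rd_comp G F)"
  unfolding preserves_quotients_def
proof (intro allI impI)
  fix X \<rho> q assume q: "quotient_arrow (Src (rd_comp G F)) X \<rho> q"
  then have "X \<in> Ob (Src F)" "\<rho> \<in> Rel (Src F) X X" "q \<in> Arr (Src F)"
    by (auto simp: quotient_arrow_def equiv_rel_def)
  then show "quotient_arrow (Tgt (rd_comp G F)) (FOb (rd_comp G F) X) (FRel (rd_comp G F) X X \<rho>)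
      (FArr (rd_comp G F) q)"
    using assms q by (simp add: preserves_quotients_def)
qed

lemma sub_two_category_QRD: "sub_two_category RD has_quotients preserves_quotients"
  by (intro sub_two_category.intro sub_two_category_axioms.intro)
    (auto simp: two_category_RD preserves_quotients_id preserves_quotients_comp Hom_def)

lemma sub_two_category_EQRD: "sub_two_category ERD has_quotients preserves_quotients"
  by (intro sub_two_category.intro sub_two_category_axioms.intro)
    (auto simp: two_category_ERD ERD_simps Hom_ERD preserves_quotients_id preserves_quotients_comp)

lemma sub_twocat_commute:
  "sub_twocat (sub_twocat K P Q) P' Q' = sub_twocat (sub_twocat K P' Q') P Q"
  unfolding sub_twocat_def Let_def
  by (auto intro!: twocat.equality cat.equality)

text \<open>
  This presentation makes the 2-adjunction between \<open>QRD\<close> and \<open>EQRD\<close> a restriction of the one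
  between \<open>RD\<close> and \<open>ERD\<close> by the same two predicates on both sides.
\<close>

lemma EQRD_eq: "EQRD = sub_twocat ERD has_quotients preserves_quotients"
  unfolding EQRD_def QRD_def ERD_def by (rule sub_twocat_commute)

theorem theorem5p1:
  shows "two_adjunction
      (RD :: (('o, 'a, 'r) doctrine, ('o, 'a, 'r) rd_arr, ('o, 'a, 'r) rd_cell) twocat) ERD
      E_functor twofun_id collapse_unit collapse_counit
    \<and> is_sub_twocat
      (QRD :: (('o, 'a, 'r) doctrine, ('o, 'a, 'r) rd_arr, ('o, 'a, 'r) rd_cell) twocat) RD
    \<and> is_sub_twocat
      (EQRD :: (('o, 'a, 'r) doctrine, ('o, 'a, 'r) rd_arr, ('o, 'a, 'r) rd_cell) twocat) ERD
    \<and> two_adjunction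
      (QRD :: (('o, 'a, 'r) doctrine, ('o, 'a, 'r) rd_arr, ('o, 'a, 'r) rd_cell) twocat) EQRD
      E_functor twofun_id collapse_unit collapse_counit"
proof (intro conjI)
  show "two_adjunction RD ERD E_functor twofun_id collapse_unit collapse_counit"
    by (rule collapse_two_adjunction)
  show "is_sub_twocat QRD RD"
    unfolding QRD_def by (rule sub_two_category.is_sub_twocat_sub[OF sub_two_category_QRD])
  show "is_sub_twocat EQRD ERD"
    unfolding EQRD_eq by (rule sub_two_category.is_sub_twocat_sub[OF sub_two_category_EQRD])
  show "two_adjunction QRD EQRD E_functor twofun_id collapse_unit collapse_counit"
    unfolding QRD_def EQRD_eq
  proof (rule two_adjunction_restrict[OF collapse_two_adjunction
        sub_two_category.two_category_sub[OF sub_two_category_QRD]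
        sub_two_category.two_category_sub[OF sub_two_category_EQRD]])
    show "has_quotients (on0 E_functor R)"
      if "R \<in> Ob (under (sub_twocat RD has_quotients preserves_quotients))" for R
      using that by (simp add: relational_doctrine.has_quotients_collapse)
    show "preserves_quotients (on1 E_functor F)"
      if "F \<in> Arr (under (sub_twocat RD has_quotients preserves_quotients))" for F
      using that by (simp add: rd_1arrow.preserves_quotients_collapse1)
    show "preserves_quotients (collapse_unit R)"
      if "R \<in> Ob (under (sub_twocat RD has_quotients preserves_quotients))" for R
      using that by (simp add: relational_doctrine.preserves_quotients_collapse_unit)
    show "preserves_quotients (collapse_counit S)"
      if "S \<in> Ob (under (sub_twocat ERD has_quotients preserves_quotients))" for S
      using that by (simp add: ERD_simps relational_doctrine.preserves_quotients_collapse_counit)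
  qed simp_all
qed

end
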